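(* Let $\nu>0$, $T>0$, and let $\alpha,\beta\ge0$ with $\frac12<\beta<\frac54$ and $\alpha+\beta=\frac54$. Let $r>\max(2\beta,\beta+1)$. Then for any $v_0\in V^r$ and $\theta_0\in H^{r-\beta}$ there exists a solution $(v,\theta)$ on $[0,T]$ of the system \[ \partial_t v+B(u,v)+\nu\Lambda^{2\beta}v=\Pi(\theta e_3),\qquad \partial_t\theta+u\cdot\nabla\theta=0,\qquad v=\Lambda^{2\alpha}u, \] with $v(0)=v_0$, $\theta(0)=\theta_0$, such that \[ v\in C([0,T];V^r)\cap L^2(0,T;V^{r+\beta}),\qquad \theta\in C([0,T];H^{r-\beta}). \]
   Context: Let $\mathbb T=[0,2\pi]^3$ with periodic boundary conditions. For $s\in\mathbb R$, $H^s$ is the space of real periodic functions/distributions $f=\sum_{k\in\mathbb Z^3\setminus\{0\}}f_ke^{ik\cdot x}$ (zero mean) with $f_{-k}=\overline{f_k}$ and $\|f\|_{H^s}^2=\sum_k|f_k|^2|k|^{2s}<\infty$. $V^s$ is the analogous space of vector fields $w=\sum_{k\neq0}w_ke^{ik\cdot x}$, $w_k\in\mathbb C^3$, $w_{-k}=\overline{w_k}$, $w_k\cdot k=0$ (divergence free, zero mean), with $\|w\|_{V^s}^2=\sum_k|w_k|^2|k|^{2s}$. $\Lambda^s$ is the Fourier multiplier by $|k|^s$ (so $\Lambda^2=-\Delta$). $\Pi$ is the Leray–Helmholtz projection onto divergence-free fields; $B(u,v)=\Pi((u\cdot\nabla)v)$. $e_3=(0,0,1)$. The solution is understood in the weak (distributional)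 sense with $u=\Lambda^{-2\alpha}v$; with the stated regularity the equations hold with all spatial derivatives defined. *)

theory Defs
  imports "HOL-Analysis.Analysis"
begin

text \<open>Periodic functions on the torus [0,2pi]^3 are represented by their Fourier
coefficients, indexed by wave vectors k in Z^3.\<close>

type_synonym wv = "int ^ 3"
type_synonym sfield = "wv \<Rightarrow> complex"
type_synonym vfield = "wv \<Rightarrow> complex ^ 3"

definition kvec :: "wv \<Rightarrow> real ^ 3" where
  "kvec k = (\<chi> i. of_int (k $ i))"

definition kabs :: "wv \<Rightarrow> real" where
  "kabs k = norm (kvec k)"

definition cdot :: "complex ^ 3 \<Rightarrow> real ^ 3 \<Rightarrow> complex" where
  "cdot w x = (\<Sum>i\<in>UNIV. w $ i * complex_of_real (x $ i))"

definition vcnj :: "complex ^ 3 \<Rightarrow> complex ^ 3" where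
  "vcnj w = (\<chi> i. cnj (w $ i))"

definition cvec :: "real ^ 3 \<Rightarrow> complex ^ 3" where
  "cvec x = (\<chi> i. complex_of_real (x $ i))"

text \<open>Squared Sobolev norms (ennreal-valued, so that infinity means "not in the space").\<close>
definition snorm2 :: "real \<Rightarrow> sfield \<Rightarrow> ennreal" where
  "snorm2 s f = (\<Sum>\<^sub>\<infinity> k\<in>{k. k \<noteq> 0}. ennreal ((cmod (f k))\<^sup>2 * kabs k powr (2 * s)))"

definition vnorm2 :: "real \<Rightarrow> vfield \<Rightarrow> ennreal" where
  "vnorm2 s w = (\<Sum>\<^sub>\<infinity> k\<in>{k. k \<noteq> 0}. ennreal ((norm (w k))\<^sup>2 * kabs k powr (2 * s)))"

text \<open>H^s: real, zero-mean scalar fields; V^s: real, zero-mean, divergence-free vector fields.\<close>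
definition Hs :: "real \<Rightarrow> sfield set" where
  "Hs s = {f. f 0 = 0 \<and> (\<forall>k. f (- k) = cnj (f k)) \<and> snorm2 s f < \<infinity>}"

definition Vs :: "real \<Rightarrow> vfield set" where
  "Vs s = {w. w 0 = 0 \<and> (\<forall>k. w (- k) = vcnj (w k)) \<and> (\<forall>k. cdot (w k) (kvec k) = 0)
              \<and> vnorm2 s w < \<infinity>}"

definition LamV :: "real \<Rightarrow> vfield \<Rightarrow> vfield" where
  "LamV s w = (\<lambda>k. (kabs k powr s) *\<^sub>R w k)"

definition leray :: "wv \<Rightarrow> complex ^ 3 \<Rightarrow> complex ^ 3" where
  "leray k w = w - (cdot w (kvec k) / complex_of_real ((kabs k)\<^sup>2)) *s cvec (kvec k)"

text \<open>Fourier coefficient of (u.grad) v at mode k: sum over l of i (u_{k-l}.l) v_l.\<close>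
definition conv_term :: "vfield \<Rightarrow> vfield \<Rightarrow> wv \<Rightarrow> wv \<Rightarrow> complex ^ 3" where
  "conv_term u v k l = (\<i> * cdot (u (k - l)) (kvec l)) *s v l"

definition adv_term :: "vfield \<Rightarrow> sfield \<Rightarrow> wv \<Rightarrow> wv \<Rightarrow> complex" where
  "adv_term u \<theta> k l = \<i> * cdot (u (k - l)) (kvec l) * \<theta> l"

definition Bop :: "vfield \<Rightarrow> vfield \<Rightarrow> vfield" where
  "Bop u v k = leray k (\<Sum>\<^sub>\<infinity> l. conv_term u v k l)"

definition advect :: "vfield \<Rightarrow> sfield \<Rightarrow> sfield" where
  "advect u \<theta> k = (\<Sum>\<^sub>\<infinity> l. adv_term u \<theta> k l)"

definition buoy :: "sfield \<Rightarrow> vfield" where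
  "buoy \<theta> k = leray k (\<chi> i. if i = 3 then \<theta> k else 0)"

definition contV :: "real \<Rightarrow> real \<Rightarrow> (real \<Rightarrow> vfield) \<Rightarrow> bool" where
  "contV T s v \<longleftrightarrow> (\<forall>t\<in>{0..T}. v t \<in> Vs s) \<and>
     (\<forall>t0\<in>{0..T}. ((\<lambda>t. vnorm2 s (\<lambda>k. v t k - v t0 k)) \<longlongrightarrow> 0) (at t0 within {0..T}))"

definition contH :: "real \<Rightarrow> real \<Rightarrow> (real \<Rightarrow> sfield) \<Rightarrow> bool" where
  "contH T s \<theta> \<longleftrightarrow> (\<forall>t\<in>{0..T}. \<theta> t \<in> Hs s) \<and>
     (\<forall>t0\<in>{0..T}. ((\<lambda>t. snorm2 s (\<lambda>k. \<theta> t k - \<theta> t0 k)) \<longlongrightarrow> 0) (at t0 within {0..T}))"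

definition L2V :: "real \<Rightarrow> real \<Rightarrow> (real \<Rightarrow> vfield) \<Rightarrow> bool" where
  "L2V T s v \<longleftrightarrow> (\<integral>\<^sup>+ t. vnorm2 s (v t) * indicator {0..T} t \<partial>lborel) < \<infinity>"

text \<open>Weak solution on [0,T], written mode by mode in time-integrated form
 (equivalent to the distributional formulation for continuous-in-time solutions),
 with u = Lambda^{-2 alpha} v.\<close>
definition is_solution ::
  "real \<Rightarrow> real \<Rightarrow> real \<Rightarrow> real \<Rightarrow> (real \<Rightarrow> vfield) \<Rightarrow> (real \<Rightarrow> sfield) \<Rightarrow> bool" where
  "is_solution \<nu> \<alpha> \<beta> T v \<theta> \<longleftrightarrow>
     (let u = (\<lambda>t. LamV (- 2 * \<alpha>) (v t)) in
      (\<forall>s\<in>{0..T}. \<forall>k. (conv_term (u s) (v s) k) summable_on UNIV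
                     \<and> (adv_term (u s) (\<theta> s) k) summable_on UNIV) \<and>
      (\<forall>t\<in>{0..T}. \<forall>k. k \<noteq> 0 \<longrightarrow>
         ((\<lambda>s. buoy (\<theta> s) k - Bop (u s) (v s) k - (\<nu> * kabs k powr (2 * \<beta>)) *\<^sub>R v s k)
            has_integral (v t k - v 0 k)) {0..t}) \<and>
      (\<forall>t\<in>{0..T}. \<forall>k. k \<noteq> 0 \<longrightarrow>
         ((\<lambda>s. - advect (u s) (\<theta> s) k) has_integral (\<theta> t k - \<theta> 0 k)) {0..t}))"

end

theory Submission
  imports Defs "HOL-Complex_Analysis.Great_Picard" "HOL-Probability.Discrete_Topology"
begin

text \<open>Galerkin truncation in Fourier space, where all estimates are finite sums.

For a radial weight \<open>m\<close>, the trilinear form \<open>\<langle>(u \<cdot> \<nabla>) w, m\<^sup>2 w\<rangle>\<close> only involves the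
commutator \<open>m(k) - m(l)\<close>, because \<open>u\<close> is real and divergence free. Splitting into low-high and
high-low interactions and using Cauchy--Schwarz with elementary lattice sums,
\<open>\<alpha> + \<beta> = 5/4\<close> is exactly what bounds the velocity form by
\<open>\<parallel>v\<parallel>\<^sub>\<beta> \<parallel>\<Lambda>\<^sup>\<beta> v\<parallel>\<^sub>m \<parallel>v\<parallel>\<^sub>m\<close>. The energy identity gives \<open>\<integral> \<parallel>v\<parallel>\<^sub>\<beta>\<^sup>2\<close>, hence by Gronwall
\<open>v\<close> in \<open>L\<^sup>\<infinity> V\<^sup>\<beta>\<close> and in \<open>L\<^sup>2 V\<close> of order \<open>2\<beta>\<close>. The temperature estimate needs
\<open>\<Sum>|k| |u k|\<close>, which the order \<open>2\<beta>\<close> norm of \<open>v\<close> controls up to a logarithm of the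
highest norm \<open>X\<close>; so \<open>ln (1 + X)\<close> satisfies a linear Gronwall inequality.

Once \<open>X\<close> is bounded, the estimate is linear for every weight \<open>|k|\<^sup>s min 1 (|k| / R)\<close> with constants
independent of \<open>R\<close>. For \<open>R \<longrightarrow> \<infinity>\<close> the initial values tend to 0, so the Fourier tails are small uniformly
in time and in the truncation. Hence mode-by-mode convergence of a subsequence suffices to pass to the limit
in the equations, and continuity of the modes gives strong continuity in the Sobolev norms.\<close>

section \<open>Lattice sums\<close>

text \<open>The obstacle is that \<open>\<theta>\<close> has no dissipation and that its transport
  bound is critical. Since \<open>1 - 2 * \<alpha> = 2 * \<beta> - 3/2\<close>, the sum of
  \<open>kabs k * norm (u k)\<close> is that of
  \<open>kabs k powr (2 * \<beta> - 3/2) * norm (v k)\<close>; Cauchy--Schwarz against the norm of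
  order \<open>2 * \<beta>\<close> leaves the sum of \<open>kabs k powr (-3)\<close>, which diverges
  logarithmically in three dimensions. That order is what can be had while \<open>\<theta>\<close>
  is controlled only in L^2: for the weight \<open>kabs k powr \<beta>\<close> buoyancy sees just
  the conserved L^2 norm of \<open>\<theta>\<close>, and dissipation then reaches order
  \<open>2 * \<beta>\<close>. The orders \<open>r\<close> and \<open>r - \<beta>\<close> come from
  the same count. Buoyancy gains \<open>\<beta>\<close> from dissipation, so \<open>v\<close> at
  order \<open>r\<close> asks for \<open>\<theta>\<close> at order \<open>r - \<beta>\<close>;
  transporting \<open>\<theta>\<close> at that order asks for \<open>u\<close> at order
  \<open>r - \<beta> + 5/2\<close>, that is for \<open>v\<close> at order
  \<open>r + \<beta>\<close>, exactly what dissipation supplies.\<close>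

lemma kvec_simps [simp]: "kvec 0 = 0" "kvec (- k) = - kvec k" "kvec (k - l) = kvec k - kvec l"
  by (simp_all add: kvec_def vec_eq_iff)

lemma kabs_0 [simp]: "kabs 0 = 0"
  and kabs_minus [simp]: "kabs (- k) = kabs k"
  and kabs_nonneg [simp]: "0 \<le> kabs k"
  by (simp_all add: kabs_def)

lemma kabs_ge_1:
  assumes "k \<noteq> 0"
  shows "1 \<le> kabs k"
proof -
  obtain i where "k $ i \<noteq> 0"
    using assms by (auto simp: vec_eq_iff)
  then have "1 \<le> \<bar>k $ i\<bar>"
    by linarith
  then have "1 \<le> \<bar>kvec k $ i\<bar>"
    by (simp add: kvec_def)
  also have "\<dots> \<le> kabs k"
    unfolding kabs_def by (rule component_le_norm_cart)
  finally show ?thesis .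
qed

lemma kabs_pos: "k \<noteq> 0 \<Longrightarrow> 0 < kabs k"
  using kabs_ge_1[of k] by linarith

lemma kabs_eq_0_iff: "kabs k = 0 \<longleftrightarrow> k = 0"
  using kabs_pos[of k] by force

lemma kabs_diff_le: "kabs k \<le> kabs (k - l) + kabs l"
  unfolding kabs_def using norm_triangle_ineq[of "kvec (k - l)" "kvec l"] by simp

lemma kabs_diff_commute: "kabs (k - l) = kabs (l - k)"
  using kabs_minus[of "k - l"] by (simp del: kabs_minus)

lemma kabs_triangle_diff: "\<bar>kabs k - kabs l\<bar> \<le> kabs (k - l)"
  using kabs_diff_le[of k l] kabs_diff_le[of l k] kabs_diff_commute[of k l] by linarith

lemma powr_square: "(x powr a)\<^sup>2 = x powr (2 * a)" for x :: real
  by (simp add: power2_eq_square flip: powr_add)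

lemma box_finite_card:
  fixes n :: nat
  shows "finite {k::wv. \<forall>i. \<bar>k $ i\<bar> \<le> int n}" (is "finite ?B")
    and "card {k::wv. \<forall>i. \<bar>k $ i\<bar> \<le> int n} \<le> (2 * n + 1) ^ 3"
proof -
  let ?I = "{- int n..int n}"
  let ?f = "\<lambda>k::wv. (k $ 1, k $ 2, k $ 3)"
  have sub: "?f ` ?B \<subseteq> ?I \<times> ?I \<times> ?I"
    by (auto simp: abs_le_iff minus_le_iff)
  have inj: "inj_on ?f ?B"
    by (auto simp: inj_on_def vec_eq_iff forall_3)
  show "finite ?B"
    by (rule inj_on_finite[OF inj sub]) simp
  have "card ?B \<le> card (?I \<times> ?I \<times> ?I)"
    by (rule card_inj_on_le[OF inj sub]) simp
  also have "\<dots> = (2 * n + 1) ^ 3"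
    by (simp add: card_cartesian_product power3_eq_cube nat_add_distrib nat_mult_distrib mult.commute)
  finally show "card ?B \<le> (2 * n + 1) ^ 3" .
qed

lemma kabs_component_le: "of_int \<bar>k $ i\<bar> \<le> kabs k"
  using component_le_norm_cart[of "kvec k" i] by (simp add: kabs_def kvec_def)

lemma kabs_ball_subset:
  assumes "R \<le> real n"
  shows "{k. kabs k \<le> R} \<subseteq> {k::wv. \<forall>i. \<bar>k $ i\<bar> \<le> int n}"
proof clarify
  fix k :: wv and i assume "kabs k \<le> R"
  then have "real_of_int \<bar>k $ i\<bar> \<le> real n"
    using kabs_component_le[of k i] assms by linarith
  then show "\<bar>k $ i\<bar> \<le> int n" by linarith
qed

definition modes :: "real \<Rightarrow> wv set" where
  "modes N = {k. k \<noteq> 0 \<and> kabs k \<le> N}"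

lemma finite_modes [simp]: "finite (modes N)"
proof -
  obtain n :: nat where "N \<le> real n" using real_arch_simple by blast
  then show ?thesis
    using kabs_ball_subset[of N n] box_finite_card(1)[of n]
    by (auto simp: modes_def intro: finite_subset)
qed

lemma modes_uminus [simp]: "- k \<in> modes N \<longleftrightarrow> k \<in> modes N"
  by (simp add: modes_def)

lemma zero_notin_modes [simp]: "0 \<notin> modes N"
  by (simp add: modes_def)

lemma finite_subset_modes:
  assumes "finite F" "0 \<notin> F"
  obtains n :: nat where "F \<subseteq> modes (real n)"
proof -
  obtain n :: nat where "Max (insert 0 (kabs ` F)) \<le> real n" using real_arch_simple by blast
  then have "F \<subseteq> modes (real n)"
    using assms by (auto simp: modes_def Max_le_iff)
  then show ?thesis using that by blast
qed

text \<open>The shell between the radii 2^n and 2^(n+1) lies in a cube with at most 125 * 8^n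
  lattice points, and there \<open>kabs k powr q\<close> is at most \<open>max 1 (2 powr q)\<close>
  times 2^(q n), whichever sign \<open>q\<close> has. Induction peels off the outermost shell; for
  \<open>m = 0\<close> nothing is left, because nonzero modes have length at least 1.\<close>

lemma dyadic_sum_le:
  fixes q :: real
  assumes "finite F" "\<And>k. k \<in> F \<Longrightarrow> k \<noteq> 0 \<and> kabs k < 2 ^ m"
  shows "(\<Sum>k\<in>F. kabs k powr q) \<le> (\<Sum>n<m. 125 * max 1 (2 powr q) * (2 powr (q + 3)) ^ n)"
  using assms
proof (induction m arbitrary: F)
  case 0
  then have "F = {}"
    using kabs_ge_1 by fastforce
  then show ?case by simp
next
  case (Suc m)
  let ?A = "{k \<in> F. kabs k < 2 ^ m}" and ?B = "{k \<in> F. \<not> kabs k < 2 ^ m}"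
  have "(\<Sum>k\<in>F. kabs k powr q) = (\<Sum>k\<in>?A. kabs k powr q) + (\<Sum>k\<in>?B. kabs k powr q)"
    using Suc.prems(1) by (subst sum.union_disjoint[symmetric]) (auto intro: sum.cong)
  moreover have "(\<Sum>k\<in>?A. kabs k powr q) \<le> (\<Sum>n<m. 125 * max 1 (2 powr q) * (2 powr (q + 3)) ^ n)"
    using Suc.prems by (intro Suc.IH) auto
  moreover have "(\<Sum>k\<in>?B. kabs k powr q) \<le> 125 * max 1 (2 powr q) * (2 powr (q + 3)) ^ m"
  proof -
    have "?B \<subseteq> {k. kabs k \<le> 2 ^ Suc m}"
      using Suc.prems by (auto intro: less_imp_le)
    also have "\<dots> \<subseteq> {k::wv. \<forall>i. \<bar>k $ i\<bar> \<le> int (2 ^ Suc m)}"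
      by (rule kabs_ball_subset) simp
    finally have "card ?B \<le> (2 * 2 ^ Suc m + 1) ^ 3"
      using box_finite_card[of "2 ^ Suc m"] card_mono order_trans by meson
    also have "\<dots> \<le> (5 * 2 ^ m) ^ 3"
      by (rule power_mono) simp_all
    also have "\<dots> = 125 * 8 ^ m"
      using power_mult[of "2::nat" m 3] power_mult[of "2::nat" 3 m] by (simp add: power_mult_distrib mult.commute)
    finally have card: "real (card ?B) \<le> 125 * 8 ^ m"
      using of_nat_le_iff[where ?'a = real, of "card ?B" "125 * 8 ^ m"] by simp
    have "kabs k powr q \<le> max 1 (2 powr q) * (2 powr q) ^ m" if "k \<in> ?B" for k
    proof -
      have lo: "2 ^ m \<le> kabs k" and hi: "kabs k \<le> 2 * 2 ^ m"
        using that Suc.prems(2)[of k] by auto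
      have e: "(2 powr q) ^ m = (2 ^ m) powr q"
        by (simp add: powr_power powr_powr mult.commute flip: powr_realpow)
      show ?thesis
      proof (cases "0 \<le> q")
        case True
        have "kabs k powr q \<le> (2 * 2 ^ m) powr q"
          by (rule powr_mono2) (use True hi in auto)
        also have "\<dots> = 2 powr q * (2 powr q) ^ m"
          by (simp add: e powr_mult)
        also have "\<dots> \<le> max 1 (2 powr q) * (2 powr q) ^ m"
          by (intro mult_right_mono) auto
        finally show ?thesis .
      next
        case False
        have "kabs k powr q \<le> (2 ^ m) powr q"
          by (rule powr_mono2') (use False lo in auto)
        also have "\<dots> \<le> max 1 (2 powr q) * (2 powr q) ^ m"
          unfolding e using mult_right_mono[of 1 "max 1 (2 powr q)" "(2^m) powr q"] by simp
        finally show ?thesis .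
      qed
    qed
    then have "(\<Sum>k\<in>?B. kabs k powr q) \<le> real (card ?B) * (max 1 (2 powr q) * (2 powr q) ^ m)"
      using sum_bounded_above[of ?B "\<lambda>k. kabs k powr q"] by simp
    also have "\<dots> \<le> (125 * 8 ^ m) * (max 1 (2 powr q) * (2 powr q) ^ m)"
      by (rule mult_right_mono[OF card]) (simp add: le_max_iff_disj)
    also have "\<dots> = 125 * max 1 (2 powr q) * (2 powr (q + 3)) ^ m"
      by (simp add: powr_add power_mult_distrib)
    finally show ?thesis .
  qed
  ultimately show ?case by simp
qed

lemma dyadic_exponent:
  fixes R :: real
  assumes "1 \<le> R"
  obtains m :: nat where "R < 2 ^ m" "2 ^ m \<le> 2 * R" "real m \<le> 2 * (1 + ln R)"
proof -
  define n where "n = nat \<lfloor>log 2 R\<rfloor>"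
  have n0: "0 \<le> log 2 R" using assms by simp
  then have n: "real n \<le> log 2 R" "log 2 R < real n + 1"
    unfolding n_def by linarith+
  have "2 powr real n \<le> R" "R < 2 powr (real n + 1)"
    using n assms by (auto simp: powr_le_iff less_powr_iff)
  then have a: "2 ^ n \<le> R" "R < 2 ^ Suc n"
    by (simp_all add: powr_add powr_realpow)
  have "ln R = ln 2 * log 2 R" by (simp add: log_def)
  moreover have "1/2 \<le> ln (2::real)" using ln2_ge_two_thirds by simp
  ultimately have "log 2 R \<le> 2 * ln R" using n0 mult_right_mono[of "1/2" "ln 2" "log 2 R"] by simp
  then have "real (Suc n) \<le> 2 * (1 + ln R)" using n by simp
  then show ?thesis using that[of "Suc n"] a by simp
qed

text \<open>The next three lemmas are the three regimes of the geometric series with ratio 2^(q+3):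
  above 1, where the outermost shell dominates, then equal to 1, then below 1.\<close>

lemma lattice_sum_growth:
  fixes q :: real
  assumes "-3 < q"
  obtains C where "0 < C" "\<And>F R. \<lbrakk>finite F; \<And>k. k \<in> F \<Longrightarrow> k \<noteq> 0 \<and> kabs k \<le> R; 0 \<le> R\<rbrakk>
    \<Longrightarrow> (\<Sum>k\<in>F. kabs k powr q) \<le> C * R powr (q + 3)"
proof -
  define a where "a = (2::real) powr (q + 3)"
  define D where "D = 125 * max 1 (2 powr q)"
  have a: "1 < a" unfolding a_def using assms by simp
  have D: "0 < D" unfolding D_def by (simp add: less_max_iff_disj)
  show ?thesis
  proof (rule that[of "D * a / (a - 1)"])
    show "0 < D * a / (a - 1)" using a D by simp
    fix F and R :: real
    assume F: "finite F" "\<And>k. k \<in> F \<Longrightarrow> k \<noteq> 0 \<and> kabs k \<le> R" and "0 \<le> R"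
    show "(\<Sum>k\<in>F. kabs k powr q) \<le> D * a / (a - 1) * R powr (q + 3)"
    proof (cases "1 \<le> R")
      case False
      then have "F = {}" using F(2) kabs_ge_1 by (meson equals0I order_trans)
      then show ?thesis using a D by simp
    next
      case True
      then obtain m :: nat where m: "R < 2 ^ m" "2 ^ m \<le> 2 * R" by (rule dyadic_exponent)
      have "(\<Sum>k\<in>F. kabs k powr q) \<le> (\<Sum>n<m. D * a ^ n)"
        unfolding a_def D_def by (rule dyadic_sum_le) (use F m in force)+
      also have "\<dots> = D * ((a ^ m - 1) / (a - 1))"
        using a by (simp add: geometric_sum flip: sum_distrib_left)
      also have "\<dots> \<le> D * (a ^ m / (a - 1))"
        using a D by (intro mult_left_mono divide_right_mono) auto
      also have "a ^ m = (2 ^ m) powr (q + 3)"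
        by (simp add: a_def powr_power powr_powr mult.commute flip: powr_realpow)
      also have "\<dots> \<le> (2 * R) powr (q + 3)"
        by (rule powr_mono2) (use assms m in auto)
      also have "\<dots> = a * R powr (q + 3)" using True by (simp add: a_def powr_mult)
      finally show ?thesis using a D by (simp add: divide_right_mono mult_left_mono mult_ac)
    qed
  qed
qed

text \<open>At the critical exponent every shell contributes at most 125, so the sum counts shells.
  This is the source of the logarithm in \<open>wiener_log_le\<close>.\<close>

lemma lattice_sum_log:
  obtains C where "0 < C" "\<And>F R. \<lbrakk>finite F; \<And>k. k \<in> F \<Longrightarrow> k \<noteq> 0 \<and> kabs k \<le> R; 1 \<le> R\<rbrakk>
    \<Longrightarrow> (\<Sum>k\<in>F. kabs k powr (-3)) \<le> C * (1 + ln R)"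
proof (rule that[of 250])
  fix F and R :: real
  assume F: "finite F" "\<And>k. k \<in> F \<Longrightarrow> k \<noteq> 0 \<and> kabs k \<le> R" and "1 \<le> R"
  then obtain m :: nat where m: "R < 2 ^ m" "real m \<le> 2 * (1 + ln R)" by (metis dyadic_exponent)
  have "(\<Sum>k\<in>F. kabs k powr (-3)) \<le> (\<Sum>n<m. 125 * max 1 (2 powr (-3)) * (2 powr (-3 + 3)) ^ n)"
    by (rule dyadic_sum_le) (use F m in force)+
  also have "\<dots> = 125 * real m" by (simp add: max_def powr_minus_divide)
  finally show "(\<Sum>k\<in>F. kabs k powr (-3)) \<le> 250 * (1 + ln R)" using m by simp
qed simp

lemma lattice_sum_bounded:
  fixes q :: real
  assumes "q < -3"
  obtains C where "0 < C" "\<And>F. \<lbrakk>finite F; 0 \<notin> F\<rbrakk> \<Longrightarrow> (\<Sum>k\<in>F. kabs k powr q) \<le> C"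
proof -
  define a where "a = (2::real) powr (q + 3)"
  define D where "D = 125 * max 1 (2 powr q)"
  have a: "a < 1" "0 < a" unfolding a_def using assms powr_less_cancel_iff[of 2 "q+3" 0] by simp_all
  have D: "0 < D" unfolding D_def by (simp add: less_max_iff_disj)
  show ?thesis
  proof (rule that[of "D / (1 - a)"])
    show "0 < D / (1 - a)" using a D by simp
    fix F :: "wv set" assume F: "finite F" "0 \<notin> F"
    then obtain n :: nat where n: "F \<subseteq> modes (real n)" by (rule finite_subset_modes)
    \<comment> \<open>Any dyadic radius beyond \<open>n\<close> serves, since the bound is
      independent of the number of shells.\<close>
    have "real n < 2 ^ n" by (metis less_exp of_nat_less_iff of_nat_numeral of_nat_power)
    then have "kabs k < 2 ^ n" if "k \<in> F" for k
      using subsetD[OF n that] le_less_trans[OF _ \<open>real n < 2 ^ n\<close>] by (simp add: modes_def)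
    then have "(\<Sum>k\<in>F. kabs k powr q) \<le> (\<Sum>i<n. D * a ^ i)"
      unfolding a_def D_def using F by (intro dyadic_sum_le) metis+
    also have "\<dots> = D * ((1 - a ^ n) / (1 - a))"
      using a by (simp add: sum_gp_strict flip: sum_distrib_left)
    also have "\<dots> \<le> D * (1 / (1 - a))"
      using a D by (intro mult_left_mono divide_right_mono) auto
    finally show "(\<Sum>k\<in>F. kabs k powr q) \<le> D / (1 - a)" by simp
  qed
qed

section \<open>Weights and convolution bounds\<close>

text \<open>The high-pass factor is a ramp and not a sharp cut-off: the weight stays positive at
  nonzero modes and satisfies the growth condition \<open>admissible\<close> with an exponent
  independent of \<open>R\<close>. On nonzero modes \<open>R = 1\<close> gives back the pure
  power.\<close>

definition wgt :: "real \<Rightarrow> real \<Rightarrow> wv \<Rightarrow> real" where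
  "wgt s R k = kabs k powr s * min 1 (kabs k / R)"

text \<open>What the commutator estimate uses of a power weight: monotonicity in
  \<open>kabs k\<close>, hence radial symmetry, and polynomial growth of degree \<open>p\<close>.
  All later constants depend on the weight through \<open>p\<close> alone.\<close>

definition admissible :: "real \<Rightarrow> (wv \<Rightarrow> real) \<Rightarrow> bool" where
  "admissible p \<mu> \<longleftrightarrow> (\<forall>k. k \<noteq> 0 \<longrightarrow> 0 < \<mu> k) \<and>
     (\<forall>k l. k \<noteq> 0 \<longrightarrow> kabs k \<le> kabs l \<longrightarrow> \<mu> k \<le> \<mu> l \<and> \<mu> l \<le> (kabs l / kabs k) powr p * \<mu> k)"

lemma wgt_one: "k \<noteq> 0 \<Longrightarrow> wgt s 1 k = kabs k powr s"
  using kabs_ge_1[of k] by (simp add: wgt_def)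

lemma wgt_mult_powr: "wgt s R k * kabs k powr q = wgt (s + q) R k"
  by (simp add: wgt_def powr_add mult_ac)

lemma wgt_eq: "\<lbrakk>0 < R; R \<le> kabs k\<rbrakk> \<Longrightarrow> wgt s R k = kabs k powr s"
  by (simp add: wgt_def)

text \<open>The ramp is increasing and grows at most linearly in \<open>kabs k\<close>; this costs
  one extra power and nothing that depends on \<open>R\<close>.\<close>

lemma admissible_wgt:
  assumes "0 \<le> s" "0 < R"
  shows "admissible (s + 1) (wgt s R)"
  unfolding admissible_def
proof (intro conjI allI impI)
  fix k :: wv assume "k \<noteq> 0"
  then show "0 < wgt s R k" using kabs_pos[of k] assms by (simp add: wgt_def)
next
  fix k l :: wv assume "k \<noteq> 0" and le: "kabs k \<le> kabs l"
  then have k: "0 < kabs k" and l: "0 < kabs l" using kabs_pos[of k] by auto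
  have "min 1 (kabs k / R) \<le> min 1 (kabs l / R)"
    using le assms by (intro min.mono divide_right_mono) auto
  then show "wgt s R k \<le> wgt s R l"
    unfolding wgt_def using assms k l le by (intro mult_mono powr_mono2) auto
  have "(kabs l / kabs k) powr (s + 1) * wgt s R k = kabs l powr s * ((kabs l / kabs k) * min 1 (kabs k / R))"
    using k l by (simp add: wgt_def powr_add powr_divide field_simps)
  moreover have "min 1 (kabs l / R) \<le> (kabs l / kabs k) * min 1 (kabs k / R)"
    using k l le assms by (auto simp: min_def field_simps)
  ultimately show "wgt s R l \<le> (kabs l / kabs k) powr (s + 1) * wgt s R k"
    by (metis (no_types) mult_left_mono powr_ge_zero wgt_def)
qed

text \<open>A mean value bound covering all \<open>p \<ge> 0\<close> at once. It follows from
  exp(-x) >= 1 - x at x = p ln t and from ln t <= t - 1.\<close>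

lemma powr_minus_one_le:
  fixes t :: real
  assumes "1 \<le> t" "0 \<le> p"
  shows "t powr p - 1 \<le> p * t powr p * (t - 1)"
proof -
  have "1 - p * ln t \<le> t powr (- p)"
    using exp_ge_add_one_self[of "- p * ln t"] assms by (simp add: powr_def)
  then have "t powr p * (1 - p * ln t) \<le> t powr p * t powr (- p)"
    by (rule mult_left_mono) simp
  also have "\<dots> = 1" using assms by (simp flip: powr_add)
  finally have "t powr p - 1 \<le> t powr p * p * ln t" by (simp add: algebra_simps)
  also have "\<dots> \<le> t powr p * p * (t - 1)"
    using assms ln_le_minus_one[of t] by (intro mult_left_mono) auto
  finally show ?thesis by (simp add: mult_ac)
qed

text \<open>If \<open>2 * kabs (k - l) \<le> kabs l\<close>, the lengths of \<open>k\<close> and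
  \<open>l\<close> differ by a factor of at most 3. The mean value bound then makes the difference
  of the weights of order \<open>kabs (k - l)\<close> over the smaller length, times a weight that
  is at most \<open>\<mu> l\<close>, and the minimum cancels the denominator. Otherwise both lengths
  are at most \<open>3 * kabs (k - l)\<close>, so each weight is at most
  \<open>3 powr p * \<mu> (k - l)\<close>, and the minimum is estimated by
  \<open>kabs l\<close>.\<close>

lemma commutator_kernel:
  assumes p: "0 \<le> p" and adm: "admissible p \<mu>" and nz: "k \<noteq> 0" "l \<noteq> 0" "k \<noteq> l"
  shows "\<bar>\<mu> k - \<mu> l\<bar> * min (kabs k) (kabs l) \<le> (p + 1) * 3 powr p *
      (if 2 * kabs (k - l) \<le> kabs l then kabs (k - l) * \<mu> l else kabs l * \<mu> (k - l))"
proof -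
  have pos: "0 < \<mu> k" "0 < \<mu> l" "0 < \<mu> (k - l)"
    using adm nz by (auto simp: admissible_def)
  have gr: "\<And>a b. a \<noteq> 0 \<Longrightarrow> kabs a \<le> kabs b \<Longrightarrow> \<mu> b \<le> (kabs b / kabs a) powr p * \<mu> a"
    and mono: "\<And>a b. a \<noteq> 0 \<Longrightarrow> kabs a \<le> kabs b \<Longrightarrow> \<mu> a \<le> \<mu> b"
    using adm by (auto simp: admissible_def)
  have tri: "kabs k \<le> kabs (k - l) + kabs l" "kabs l \<le> kabs (k - l) + kabs k"
    using kabs_triangle_diff[of k l] by linarith+
  have c3: "1 \<le> (3::real) powr p" using p ge_one_powr_ge_zero by simp
  have diff: "\<mu> b - \<mu> a \<le> \<mu> a * (p * 3 powr p * (kabs (k - l) / kabs a))"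
    if a: "a \<noteq> 0" and ab: "kabs a \<le> kabs b" "kabs b \<le> 3 * kabs a" "kabs b - kabs a \<le> kabs (k - l)"
      and pa: "0 < \<mu> a" for a b
  proof -
    define t where "t = kabs b / kabs a"
    have "t - 1 = (kabs b - kabs a) / kabs a"
      using kabs_pos[OF a] by (simp add: t_def diff_divide_distrib)
    then have t: "1 \<le> t" "t \<le> 3" "t - 1 \<le> kabs (k - l) / kabs a"
      using ab kabs_pos[OF a] by (auto simp: t_def divide_le_eq divide_right_mono)
    have "t powr p - 1 \<le> p * t powr p * (t - 1)"
      by (rule powr_minus_one_le) (use t p in auto)
    also have "\<dots> \<le> p * 3 powr p * (t - 1)"
      using t p by (intro mult_right_mono mult_left_mono powr_mono2) auto
    also have "\<dots> \<le> p * 3 powr p * (kabs (k - l) / kabs a)"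
      using t p by (intro mult_left_mono) auto
    finally have "\<mu> a * (t powr p - 1) \<le> \<mu> a * (p * 3 powr p * (kabs (k - l) / kabs a))"
      using pa by (intro mult_left_mono) auto
    moreover have "\<mu> b \<le> t powr p * \<mu> a" using gr[OF a ab(1)] by (simp only: t_def)
    ultimately show ?thesis by (simp add: algebra_simps)
  qed
  show ?thesis
  proof (cases "2 * kabs (k - l) \<le> kabs l")
    case True
    have l: "0 < kabs l" and k: "0 < kabs k" using kabs_pos nz by auto
    have "\<bar>\<mu> k - \<mu> l\<bar> * min (kabs k) (kabs l) \<le> p * 3 powr p * (kabs (k - l) * \<mu> l)"
    proof (cases "kabs l \<le> kabs k")
      case le: True
      have "\<mu> k - \<mu> l \<le> \<mu> l * (p * 3 powr p * (kabs (k - l) / kabs l))"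
        using True le l tri pos nz by (intro diff) auto
      then have "(\<mu> k - \<mu> l) * kabs l \<le> \<mu> l * (p * 3 powr p * (kabs (k - l) / kabs l)) * kabs l"
        using l by (intro mult_right_mono) auto
      also have "\<dots> = p * 3 powr p * (kabs (k - l) * \<mu> l)" using l by simp
      finally show ?thesis using le mono[OF nz(2) le] by simp
    next
      case le: False
      have "\<mu> l - \<mu> k \<le> \<mu> k * (p * 3 powr p * (kabs (k - l) / kabs k))"
        using True le k tri pos nz by (intro diff) auto
      then have "(\<mu> l - \<mu> k) * kabs k \<le> \<mu> k * (p * 3 powr p * (kabs (k - l) / kabs k)) * kabs k"
        using k by (intro mult_right_mono) auto
      also have "\<dots> = p * 3 powr p * (kabs (k - l) * \<mu> k)" using k by simp
      also have "\<dots> \<le> p * 3 powr p * (kabs (k - l) * \<mu> l)"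
        using mono[of k l] nz le p by (intro mult_left_mono) auto
      finally show ?thesis using le mono[of k l] nz by simp
    qed
    \<comment> \<open>\<open>p + 1\<close> covers both the factor \<open>p\<close> found here and
      the factor 1 of the other case.\<close>
    also have "\<dots> \<le> (p + 1) * 3 powr p * (kabs (k - l) * \<mu> l)"
      using pos by (intro mult_right_mono) auto
    finally show ?thesis using True by simp
  next
    case False
    have j: "0 < kabs (k - l)" using kabs_pos[of "k - l"] nz by simp
    have b: "\<mu> a \<le> 3 powr p * \<mu> (k - l)" if "kabs a \<le> 3 * kabs (k - l)" "a \<noteq> 0" for a
    proof (cases "kabs a \<le> kabs (k - l)")
      case True
      then have "\<mu> a \<le> 1 * \<mu> (k - l)" using mono[of a "k - l"] that by simp
      also have "\<dots> \<le> 3 powr p * \<mu> (k - l)" using c3 pos by (intro mult_right_mono) auto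
      finally show ?thesis .
    next
      case F: False
      then have "\<mu> a \<le> (kabs a / kabs (k - l)) powr p * \<mu> (k - l)"
        using nz by (intro gr) auto
      also have "\<dots> \<le> 3 powr p * \<mu> (k - l)"
        using that j p pos by (intro mult_right_mono powr_mono2) (auto simp: field_simps)
      finally show ?thesis .
    qed
    have "\<bar>\<mu> k - \<mu> l\<bar> \<le> 3 powr p * \<mu> (k - l)"
      using b[of k] b[of l] False tri nz pos by (auto simp: abs_le_iff)
    then have "\<bar>\<mu> k - \<mu> l\<bar> * min (kabs k) (kabs l) \<le> (3 powr p * \<mu> (k - l)) * kabs l"
      by (rule mult_mono) (use pos in auto)
    also have "\<dots> = 1 * 3 powr p * (kabs l * \<mu> (k - l))" by simp
    also have "\<dots> \<le> (p + 1) * 3 powr p * (kabs l * \<mu> (k - l))"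
      using p pos by (intro mult_right_mono) auto
    finally show ?thesis using False by simp
  qed
qed

lemma sum_shift_le:
  fixes h :: "'a \<Rightarrow> real"
  assumes "finite K" "inj_on g A" "finite A" "\<And>j. j \<in> K \<Longrightarrow> 0 \<le> h j" "\<And>j. j \<notin> K \<Longrightarrow> h j = 0"
  shows "(\<Sum>k\<in>A. h (g k)) \<le> (\<Sum>j\<in>K. h j)"
proof -
  have "(\<Sum>k\<in>A. h (g k)) = (\<Sum>j\<in>g ` A. h j)"
    by (simp add: sum.reindex[OF assms(2)])
  also have "\<dots> = (\<Sum>j\<in>g ` A \<inter> K. h j)"
    using assms by (intro sum.mono_neutral_right) auto
  also have "\<dots> \<le> (\<Sum>j\<in>K. h j)"
    using assms by (intro sum_mono2) auto
  finally show ?thesis .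
qed

section \<open>Cauchy--Schwarz bounds for convolution sums\<close>

lemma sum_mult_le_L2_set: "(\<Sum>x\<in>A. f x * g x) \<le> L2_set f A * L2_set g A"
proof -
  have "(\<Sum>x\<in>A. f x * g x) \<le> (\<Sum>x\<in>A. \<bar>f x\<bar> * \<bar>g x\<bar>)"
    by (intro sum_mono) (simp flip: abs_mult)
  then show ?thesis using L2_set_mult_ineq[of f g A] by linarith
qed

lemma L2_set_Times:
  "L2_set (\<lambda>(k, l). f k * g l) (A \<times> B) = L2_set f A * L2_set g B"
proof -
  have "(\<Sum>x\<in>A \<times> B. (case x of (k, l) \<Rightarrow> f k * g l)\<^sup>2) = (\<Sum>k\<in>A. (f k)\<^sup>2) * (\<Sum>l\<in>B. (g l)\<^sup>2)"
    unfolding sum_product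
    by (subst sum.cartesian_product') (simp only: prod.case power_mult_distrib)
  then show ?thesis by (simp add: L2_set_def real_sqrt_mult)
qed

text \<open>Cauchy--Schwarz over the pairs (k, l), with the kernel joined to \<open>P\<close>.
  Substituting j = k - l leaves the sum of the squared kernel over \<open>l\<close> at fixed
  \<open>j\<close>, which suits kernels whose high frequency is k - l.\<close>

lemma convolution_bound1:
  fixes c :: "wv \<Rightarrow> wv \<Rightarrow> real"
  assumes K: "finite K" and P: "\<And>j. j \<notin> K \<Longrightarrow> P j = 0"
    and B: "\<And>j. j \<in> K \<Longrightarrow> (\<Sum>l\<in>K. (c j l)\<^sup>2) \<le> B"
  shows "(\<Sum>k\<in>K. \<Sum>l\<in>K. c (k - l) l * P (k - l) * Q l * Z k)
      \<le> sqrt B * L2_set P K * L2_set Q K * L2_set Z K"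
proof (cases "K = {}")
  case False
  then obtain j where "j \<in> K" by blast
  then have "(\<Sum>l\<in>K. (c j l)\<^sup>2) \<le> B" by (rule B)
  then have B0: "0 \<le> B" by (rule order_trans[rotated]) (simp add: sum_nonneg)
  let ?f = "\<lambda>(k, l). c (k - l) l * P (k - l)" and ?g = "\<lambda>(k, l). Z k * Q l"
  have "(\<Sum>k\<in>K. \<Sum>l\<in>K. c (k - l) l * P (k - l) * Q l * Z k) = (\<Sum>x\<in>K \<times> K. ?f x * ?g x)"
    unfolding sum.cartesian_product by (intro sum.cong refl) (auto simp: mult_ac)
  also have "\<dots> \<le> L2_set ?f (K \<times> K) * L2_set ?g (K \<times> K)"
    by (rule sum_mult_le_L2_set)
  also have "L2_set ?g (K \<times> K) = L2_set Z K * L2_set Q K"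
    by (rule L2_set_Times)
  also have "L2_set ?f (K \<times> K) \<le> sqrt (B * (\<Sum>j\<in>K. (P j)\<^sup>2))"
    unfolding L2_set_def
  proof (rule real_sqrt_le_mono)
    have "(\<Sum>x\<in>K \<times> K. (?f x)\<^sup>2) = (\<Sum>l\<in>K. \<Sum>k\<in>K. (c (k - l) l * P (k - l))\<^sup>2)"
      by (simp add: case_prod_unfold sum.cartesian_product' ) (rule sum.swap)
    also have "\<dots> \<le> (\<Sum>l\<in>K. \<Sum>j\<in>K. (c j l * P j)\<^sup>2)"
      using K P by (intro sum_mono sum_shift_le[where g = "\<lambda>k. k - _" and h = "\<lambda>j. (c j _ * P j)\<^sup>2"])
        (auto simp: inj_on_def)
    also have "\<dots> = (\<Sum>j\<in>K. (\<Sum>l\<in>K. (c j l)\<^sup>2) * (P j)\<^sup>2)"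
      by (subst sum.swap) (simp add: power_mult_distrib sum_distrib_right)
    also have "\<dots> \<le> (\<Sum>j\<in>K. B * (P j)\<^sup>2)"
      using B by (intro sum_mono mult_right_mono) auto
    finally show "(\<Sum>x\<in>K \<times> K. (?f x)\<^sup>2) \<le> B * (\<Sum>j\<in>K. (P j)\<^sup>2)"
      by (simp add: sum_distrib_left)
  qed
  also have "sqrt (B * (\<Sum>j\<in>K. (P j)\<^sup>2)) = sqrt B * L2_set P K"
    by (simp add: L2_set_def real_sqrt_mult)
  finally have "(\<Sum>k\<in>K. \<Sum>l\<in>K. c (k - l) l * P (k - l) * Q l * Z k)
      \<le> sqrt B * L2_set P K * (L2_set Z K * L2_set Q K)"
    by (simp add: L2_set_nonneg mult_right_mono)
  then show ?thesis by (simp only: mult_ac)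
qed simp

text \<open>The companion with the kernel joined to \<open>Q\<close>: the squared kernel is summed
  over \<open>j\<close> at fixed \<open>l\<close>, which suits kernels whose high frequency is
  \<open>l\<close>.\<close>

lemma convolution_bound2:
  fixes c :: "wv \<Rightarrow> wv \<Rightarrow> real"
  assumes K: "finite K" and P: "\<And>j. j \<notin> K \<Longrightarrow> P j = 0"
    and B: "\<And>l. l \<in> K \<Longrightarrow> (\<Sum>j\<in>K. (c j l)\<^sup>2) \<le> B"
  shows "(\<Sum>k\<in>K. \<Sum>l\<in>K. c (k - l) l * P (k - l) * Q l * Z k)
      \<le> sqrt B * L2_set P K * L2_set Q K * L2_set Z K"
proof (cases "K = {}")
  case False
  then obtain j where "j \<in> K" by blast
  then have "(\<Sum>i\<in>K. (c i j)\<^sup>2) \<le> B" by (rule B)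
  then have B0: "0 \<le> B" by (rule order_trans[rotated]) (simp add: sum_nonneg)
  \<comment> \<open>The bound \<open>B\<close> sums over \<open>j\<close> in \<open>K\<close> only,
    while \<open>k - l\<close> may leave \<open>K\<close>. Cutting the kernel off there is free,
    because \<open>P\<close> vanishes outside \<open>K\<close>.\<close>
  let ?c = "\<lambda>j l. if j \<in> K then c j l else 0"
  let ?f = "\<lambda>(k, l). ?c (k - l) l * Q l" and ?g = "\<lambda>(k, l). Z k * P (k - l)"
  have "(\<Sum>k\<in>K. \<Sum>l\<in>K. c (k - l) l * P (k - l) * Q l * Z k) = (\<Sum>x\<in>K \<times> K. ?f x * ?g x)"
    by (auto simp: sum.cartesian_product case_prod_unfold P intro!: sum.cong)
  also have "\<dots> \<le> L2_set ?f (K \<times> K) * L2_set ?g (K \<times> K)"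
    by (rule sum_mult_le_L2_set)
  also have "\<dots> \<le> sqrt (B * (\<Sum>l\<in>K. (Q l)\<^sup>2)) * sqrt ((\<Sum>k\<in>K. (Z k)\<^sup>2) * (\<Sum>j\<in>K. (P j)\<^sup>2))"
  proof (intro mult_mono)
    show "L2_set ?g (K \<times> K) \<le> sqrt ((\<Sum>k\<in>K. (Z k)\<^sup>2) * (\<Sum>j\<in>K. (P j)\<^sup>2))"
      unfolding L2_set_def
    proof (rule real_sqrt_le_mono)
      have "(\<Sum>x\<in>K \<times> K. (?g x)\<^sup>2) = (\<Sum>k\<in>K. (Z k)\<^sup>2 * (\<Sum>l\<in>K. (P (k - l))\<^sup>2))"
        by (simp add: case_prod_unfold sum.cartesian_product' power_mult_distrib sum_distrib_left)
      also have "\<dots> \<le> (\<Sum>k\<in>K. (Z k)\<^sup>2 * (\<Sum>j\<in>K. (P j)\<^sup>2))"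
        using K P by (intro sum_mono mult_left_mono sum_shift_le[where g = "\<lambda>l. _ - l" and h = "\<lambda>j. (P j)\<^sup>2"])
          (auto simp: inj_on_def)
      finally show "(\<Sum>x\<in>K \<times> K. (?g x)\<^sup>2) \<le> (\<Sum>k\<in>K. (Z k)\<^sup>2) * (\<Sum>j\<in>K. (P j)\<^sup>2)"
        by (simp add: sum_distrib_right)
    qed
    show "L2_set ?f (K \<times> K) \<le> sqrt (B * (\<Sum>l\<in>K. (Q l)\<^sup>2))"
      unfolding L2_set_def
    proof (rule real_sqrt_le_mono)
      have "(\<Sum>x\<in>K \<times> K. (?f x)\<^sup>2) = (\<Sum>k\<in>K. \<Sum>l\<in>K. (?c (k - l) l)\<^sup>2 * (Q l)\<^sup>2)"
        by (subst sum.cartesian_product') (simp only: prod.case power_mult_distrib)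
      also have "\<dots> = (\<Sum>l\<in>K. \<Sum>k\<in>K. (?c (k - l) l)\<^sup>2 * (Q l)\<^sup>2)"
        by (rule sum.swap)
      also have "\<dots> = (\<Sum>l\<in>K. (\<Sum>k\<in>K. (?c (k - l) l)\<^sup>2) * (Q l)\<^sup>2)"
        by (simp only: sum_distrib_right)
      also have "\<dots> \<le> (\<Sum>l\<in>K. B * (Q l)\<^sup>2)"
      proof (intro sum_mono mult_right_mono)
        fix l assume l: "l \<in> K"
        have "(\<Sum>k\<in>K. (?c (k - l) l)\<^sup>2) \<le> (\<Sum>j\<in>K. (?c j l)\<^sup>2)"
          using K by (intro sum_shift_le[where g = "\<lambda>k. k - l" and h = "\<lambda>j. (?c j l)\<^sup>2"]) (auto simp: inj_on_def)
        also have "\<dots> = (\<Sum>j\<in>K. (c j l)\<^sup>2)" by (intro sum.cong) auto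
        also have "\<dots> \<le> B" using B l by blast
        finally show "(\<Sum>k\<in>K. (?c (k - l) l)\<^sup>2) \<le> B" .
      qed auto
      finally show "(\<Sum>x\<in>K \<times> K. (?f x)\<^sup>2) \<le> B * (\<Sum>l\<in>K. (Q l)\<^sup>2)"
        by (simp add: sum_distrib_left)
    qed
  qed (use B0 in \<open>auto simp: L2_set_nonneg intro!: sum_nonneg mult_nonneg_nonneg\<close>)
  also have "\<dots> = sqrt B * L2_set Q K * (L2_set Z K * L2_set P K)"
    by (simp add: L2_set_def real_sqrt_mult)
  finally show ?thesis by (simp only: mult_ac)
qed simp

text \<open>Young's inequality for an l^1 kernel acting on l^2, in dual form: each factor of
  Cauchy--Schwarz receives \<open>sqrt (P (k - l))\<close>.\<close>

lemma convolution_bound3: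
  fixes P :: "wv \<Rightarrow> real"
  assumes K: "finite K" and P: "\<And>j. j \<notin> K \<Longrightarrow> P j = 0" and P0: "\<And>j. 0 \<le> P j"
  shows "(\<Sum>k\<in>K. \<Sum>l\<in>K. P (k - l) * Q l * Z k) \<le> (\<Sum>j\<in>K. P j) * L2_set Q K * L2_set Z K"
proof -
  let ?f = "\<lambda>(k, l). sqrt (P (k - l)) * Q l" and ?g = "\<lambda>(k, l). sqrt (P (k - l)) * Z k"
  have S0: "0 \<le> (\<Sum>j\<in>K. P j)" using P0 by (simp add: sum_nonneg)
  have "(\<Sum>k\<in>K. \<Sum>l\<in>K. P (k - l) * Q l * Z k) = (\<Sum>x\<in>K \<times> K. ?f x * ?g x)"
    unfolding sum.cartesian_product
  proof (intro sum.cong refl, clarify)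
    fix k l
    have "P (k - l) = sqrt (P (k - l)) * sqrt (P (k - l))" using P0 by simp
    then show "P (k - l) * Q l * Z k = sqrt (P (k - l)) * Q l * (sqrt (P (k - l)) * Z k)"
      by (simp only: mult_ac)
  qed
  also have "\<dots> \<le> L2_set ?f (K \<times> K) * L2_set ?g (K \<times> K)"
    by (rule sum_mult_le_L2_set)
  also have "\<dots> \<le> sqrt ((\<Sum>j\<in>K. P j) * (\<Sum>l\<in>K. (Q l)\<^sup>2)) * sqrt ((\<Sum>j\<in>K. P j) * (\<Sum>k\<in>K. (Z k)\<^sup>2))"
    unfolding L2_set_def
  proof (intro mult_mono real_sqrt_le_mono)
    have "(\<Sum>x\<in>K \<times> K. (?f x)\<^sup>2) = (\<Sum>l\<in>K. (\<Sum>k\<in>K. P (k - l)) * (Q l)\<^sup>2)"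
      using P0 by (simp add: case_prod_unfold sum.cartesian_product' power_mult_distrib sum_distrib_right)
        (rule sum.swap)
    also have "\<dots> \<le> (\<Sum>l\<in>K. (\<Sum>j\<in>K. P j) * (Q l)\<^sup>2)"
      using K P P0 by (intro sum_mono mult_right_mono sum_shift_le) (auto simp: inj_on_def)
    finally show "(\<Sum>x\<in>K \<times> K. (?f x)\<^sup>2) \<le> (\<Sum>j\<in>K. P j) * (\<Sum>l\<in>K. (Q l)\<^sup>2)"
      by (simp add: sum_distrib_left)
    have "(\<Sum>x\<in>K \<times> K. (?g x)\<^sup>2) = (\<Sum>k\<in>K. (\<Sum>l\<in>K. P (k - l)) * (Z k)\<^sup>2)"
      using P0 by (simp add: case_prod_unfold sum.cartesian_product' power_mult_distrib sum_distrib_right)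
    also have "\<dots> \<le> (\<Sum>k\<in>K. (\<Sum>j\<in>K. P j) * (Z k)\<^sup>2)"
      using K P P0 by (intro sum_mono mult_right_mono sum_shift_le) (auto simp: inj_on_def)
    finally show "(\<Sum>x\<in>K \<times> K. (?g x)\<^sup>2) \<le> (\<Sum>j\<in>K. P j) * (\<Sum>k\<in>K. (Z k)\<^sup>2)"
      by (simp add: sum_distrib_left)
  qed (use S0 in \<open>auto intro!: sum_nonneg mult_nonneg_nonneg\<close>)
  also have "\<dots> = (\<Sum>j\<in>K. P j) * L2_set Q K * L2_set Z K"
  proof -
    have "sqrt (\<Sum>j\<in>K. P j) * sqrt (\<Sum>j\<in>K. P j) = (\<Sum>j\<in>K. P j)" using S0 by simp
    then show ?thesis by (simp add: L2_set_def real_sqrt_mult algebra_simps)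
  qed
  finally show ?thesis .
qed

section \<open>The trilinear convection form\<close>

lemma norm_smult_complex_vec: "norm (c *s (x :: complex ^ 'n)) = cmod c * norm x"
  by (simp add: norm_vec_def norm_mult L2_set_right_distrib)

lemma vcnj_simps [simp]: "vcnj 0 = 0" "vcnj (vcnj w) = w" "vcnj (a + b) = vcnj a + vcnj b"
    "vcnj (a - b) = vcnj a - vcnj b" "vcnj (r *\<^sub>R a) = r *\<^sub>R vcnj a" "vcnj (c *s a) = cnj c *s vcnj a"
    "vcnj (- a) = - vcnj a"
  by (simp_all add: vcnj_def vec_eq_iff)

lemma vcnj_sum: "vcnj (sum f A) = (\<Sum>x\<in>A. vcnj (f x))"
  by (induction A rule: infinite_finite_induct) auto

lemma cdot_simps [simp]: "cdot 0 x = 0" "cdot (vcnj w) x = cnj (cdot w x)" "cdot w (- x) = - cdot w x"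
    "cdot (a + b) x = cdot a x + cdot b x" "cdot (a - b) x = cdot a x - cdot b x"
    "cdot w (x - y) = cdot w x - cdot w y"
    "cdot (r *\<^sub>R w) x = r *\<^sub>R cdot w x" "cdot (c *s w) x = c * cdot w x" "cdot w 0 = 0"
  by (simp_all add: cdot_def vcnj_def sum.distrib sum_subtractf sum_negf algebra_simps
      sum_distrib_left scaleR_sum_right)

lemma cmod_cdot_le: "cmod (cdot w x) \<le> norm w * norm x"
proof -
  have "cmod (cdot w x) \<le> (\<Sum>i\<in>UNIV. cmod (w $ i) * \<bar>x $ i\<bar>)"
    unfolding cdot_def by (rule sum_norm_le) (simp add: norm_mult)
  also have "\<dots> \<le> L2_set (\<lambda>i. cmod (w $ i)) UNIV * L2_set (\<lambda>i. \<bar>x $ i\<bar>) UNIV"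
    using L2_set_mult_ineq[of "\<lambda>i. cmod (w $ i)" "\<lambda>i. \<bar>x $ i\<bar>" UNIV] by simp
  finally show ?thesis by (simp add: norm_vec_def)
qed

text \<open>On \<open>complex ^ 3\<close> the inner product is the real part of the Hermitian one,
  which is all that energy estimates see.\<close>

lemma inner_smult_complex_vec:
  "v \<bullet> (z *s w) = Re (z * (\<Sum>i\<in>UNIV. cnj (v $ i) * w $ i))" for v w :: "complex ^ 3"
  by (simp add: inner_vec_def inner_complex_def sum_distrib_left algebra_simps)

text \<open>The algebraic conditions of \<open>Vs\<close>, separated from the norm so that they can
  be established on their own for truncations and for limits.\<close>

definition solenoidal :: "vfield \<Rightarrow> bool" where
  "solenoidal w \<longleftrightarrow> w 0 = 0 \<and> (\<forall>k. w (- k) = vcnj (w k)) \<and> (\<forall>k. cdot (w k) (kvec k) = 0)"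

lemma solenoidalD:
  assumes "solenoidal w"
  shows "w 0 = 0" "w (- k) = vcnj (w k)" "cdot (w k) (kvec k) = 0"
  using assms by (auto simp: solenoidal_def)

lemma solenoidal_LamV: "solenoidal w \<Longrightarrow> solenoidal (LamV s w)"
  by (simp add: solenoidal_def LamV_def)

lemma solenoidal_cdot_eq:
  "solenoidal u \<Longrightarrow> cdot (u (k - l)) (kvec l) = cdot (u (k - l)) (kvec k)"
  using solenoidalD(3)[of u "k - l"] by simp

text \<open>As \<open>u (k - l)\<close> is orthogonal to \<open>k - l\<close>, the derivative may be
  charged to \<open>k\<close> or to \<open>l\<close>. The resulting minimum is the one that
  \<open>commutator_kernel\<close> consumes.\<close>

lemma norm_conv_term_le:
  assumes "solenoidal u"
  shows "norm (conv_term u v k l) \<le> norm (u (k - l)) * min (kabs k) (kabs l) * norm (v l)"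
proof -
  have "cmod (cdot (u (k - l)) (kvec l)) \<le> norm (u (k - l)) * min (kabs k) (kabs l)"
    using cmod_cdot_le[of "u (k - l)" "kvec l"] cmod_cdot_le[of "u (k - l)" "kvec k"]
      solenoidal_cdot_eq[OF assms, of k l] by (simp add: kabs_def min_def)
  then show ?thesis
    by (simp add: conv_term_def norm_smult_complex_vec norm_mult mult_right_mono)
qed

text \<open>Transport by a real divergence-free field is skew: exchanging \<open>k\<close> and
  \<open>l\<close> conjugates both the scalar \<open>cdot (u (k - l)) (kvec l)\<close> and the
  Hermitian product, and the factor \<open>\<i>\<close> turns the conjugation into a sign.\<close>

lemma conv_term_swap:
  assumes "solenoidal u"
  shows "v l \<bullet> conv_term u v l k = - (v k \<bullet> conv_term u v k l)"
proof -
  have "u (l - k) = vcnj (u (k - l))"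
    using solenoidalD(2)[OF assms, of "k - l"] by simp
  then have "cdot (u (l - k)) (kvec k) = cnj (cdot (u (k - l)) (kvec l))"
    using solenoidal_cdot_eq[OF assms, of k l] by simp
  moreover have "(\<Sum>i\<in>UNIV. cnj (v l $ i) * v k $ i) = cnj (\<Sum>i\<in>UNIV. cnj (v k $ i) * v l $ i)"
    by (simp add: mult.commute)
  ultimately have "v l \<bullet> conv_term u v l k = Re (\<i> * cnj (cdot (u (k - l)) (kvec l)) * cnj (\<Sum>i\<in>UNIV. cnj (v k $ i) * v l $ i))"
    by (simp only: conv_term_def inner_smult_complex_vec)
  moreover have "v k \<bullet> conv_term u v k l = Re (\<i> * cdot (u (k - l)) (kvec l) * (\<Sum>i\<in>UNIV. cnj (v k $ i) * v l $ i))"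
    by (simp only: conv_term_def inner_smult_complex_vec)
  moreover have "Re (\<i> * cnj z * cnj w) = - Re (\<i> * z * w)" for z w by simp
  ultimately show ?thesis by (simp only:)
qed

text \<open>Input and output modes run over the same set \<open>K\<close>, so the skew symmetry
  survives the truncation.\<close>

definition tri :: "wv set \<Rightarrow> (wv \<Rightarrow> real) \<Rightarrow> vfield \<Rightarrow> vfield \<Rightarrow> real" where
  "tri K \<mu> u v = (\<Sum>k\<in>K. (\<mu> k)\<^sup>2 * (v k \<bullet> (\<Sum>l\<in>K. conv_term u v k l)))"

definition nrm :: "wv set \<Rightarrow> (wv \<Rightarrow> real) \<Rightarrow> vfield \<Rightarrow> real" where
  "nrm K \<mu> v = L2_set (\<lambda>k. \<mu> k * norm (v k)) K"

lemma nrm_nonneg [simp]: "0 \<le> nrm K \<mu> v"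
  by (simp add: nrm_def L2_set_nonneg)

lemma nrm_power2: "(nrm K \<mu> v)\<^sup>2 = (\<Sum>k\<in>K. (\<mu> k)\<^sup>2 * (norm (v k))\<^sup>2)"
  by (simp add: nrm_def L2_set_def sum_nonneg power_mult_distrib)

text \<open>By skew symmetry the double sum with the symmetric weight
  \<open>\<mu> k * \<mu> l\<close> vanishes. Subtracting it from the sum with weight
  \<open>\<mu> k\<close> squared leaves the difference of the two weights.\<close>

lemma tri_commutator:
  assumes "solenoidal u"
  shows "tri K \<mu> u v = (\<Sum>k\<in>K. \<Sum>l\<in>K. \<mu> k * (\<mu> k - \<mu> l) * (v k \<bullet> conv_term u v k l))"
proof -
  let ?S = "\<Sum>k\<in>K. \<Sum>l\<in>K. \<mu> k * \<mu> l * (v k \<bullet> conv_term u v k l)"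
  have "?S = (\<Sum>l\<in>K. \<Sum>k\<in>K. \<mu> k * \<mu> l * (v k \<bullet> conv_term u v k l))"
    by (rule sum.swap)
  also have "\<dots> = (\<Sum>l\<in>K. \<Sum>k\<in>K. - (\<mu> l * \<mu> k * (v l \<bullet> conv_term u v l k)))"
  proof (intro sum.cong refl)
    fix k l
    show "\<mu> k * \<mu> l * (v k \<bullet> conv_term u v k l) = - (\<mu> l * \<mu> k * (v l \<bullet> conv_term u v l k))"
      unfolding conv_term_swap[OF assms, of v l k] by simp
  qed
  also have "\<dots> = - ?S" by (simp only: sum_negf)
  finally have "?S = 0" by simp
  moreover have "tri K \<mu> u v = (\<Sum>k\<in>K. \<Sum>l\<in>K. (\<mu> k)\<^sup>2 * (v k \<bullet> conv_term u v k l))"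
    by (simp add: tri_def inner_sum_right sum_distrib_left)
  ultimately have "tri K \<mu> u v = (\<Sum>k\<in>K. \<Sum>l\<in>K. (\<mu> k)\<^sup>2 * (v k \<bullet> conv_term u v k l)) - ?S"
    by simp
  also have "\<dots> = (\<Sum>k\<in>K. \<Sum>l\<in>K. \<mu> k * (\<mu> k - \<mu> l) * (v k \<bullet> conv_term u v k l))"
    unfolding sum_subtractf[symmetric] by (simp add: algebra_simps power2_eq_square)
  finally show ?thesis .
qed

lemma tri_one [simp]: "solenoidal u \<Longrightarrow> tri K (\<lambda>k. 1) u v = 0"
  by (simp add: tri_commutator)

text \<open>The two halves mirror the case split of \<open>commutator_kernel\<close>:
  \<open>u\<close> carries the low frequency here, and one above half that of \<open>v\<close> in
  \<open>high_low\<close>. Only moduli enter, all cancellation having been used before.\<close>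

definition low_high :: "wv set \<Rightarrow> (wv \<Rightarrow> real) \<Rightarrow> vfield \<Rightarrow> vfield \<Rightarrow> real" where
  "low_high K \<mu> u v = (\<Sum>k\<in>K. \<Sum>l\<in>K. (if 2 * kabs (k - l) \<le> kabs l then kabs (k - l) else 0)
      * norm (u (k - l)) * (\<mu> l * norm (v l)) * (\<mu> k * norm (v k)))"

definition high_low :: "wv set \<Rightarrow> (wv \<Rightarrow> real) \<Rightarrow> vfield \<Rightarrow> vfield \<Rightarrow> real" where
  "high_low K \<mu> u v = (\<Sum>k\<in>K. \<Sum>l\<in>K. (if kabs l < 2 * kabs (k - l) then kabs l else 0)
      * (\<mu> (k - l) * norm (u (k - l))) * norm (v l) * (\<mu> k * norm (v k)))"

lemma tri_le:
  assumes u: "solenoidal u" and p: "0 \<le> p" and adm: "admissible p \<mu>" and K: "0 \<notin> K"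
  shows "\<bar>tri K \<mu> u v\<bar> \<le> (p + 1) * 3 powr p * (low_high K \<mu> u v + high_low K \<mu> u v)"
proof -
  let ?c = "(p + 1) * 3 powr p"
  have term_le: "\<bar>\<mu> k * (\<mu> k - \<mu> l) * (v k \<bullet> conv_term u v k l)\<bar> \<le>
      ?c * ((if 2 * kabs (k - l) \<le> kabs l then kabs (k - l) else 0)
        * norm (u (k - l)) * (\<mu> l * norm (v l)) * (\<mu> k * norm (v k))
      + (if kabs l < 2 * kabs (k - l) then kabs l else 0)
        * (\<mu> (k - l) * norm (u (k - l))) * norm (v l) * (\<mu> k * norm (v k)))"
    if "k \<in> K" "l \<in> K" for k l
  proof (cases "k = l")
    case False
    have nz: "k \<noteq> 0" "l \<noteq> 0" using that K by auto
    then have pos: "0 < \<mu> k" using adm by (auto simp: admissible_def)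
    let ?X = "norm (u (k - l)) * norm (v l) * (\<mu> k * norm (v k))"
    have "\<bar>v k \<bullet> conv_term u v k l\<bar> \<le> norm (v k) * (norm (u (k - l)) * min (kabs k) (kabs l) * norm (v l))"
      using Cauchy_Schwarz_ineq2[of "v k" "conv_term u v k l"]
        mult_left_mono[OF norm_conv_term_le[OF u, of v k l], of "norm (v k)"] by simp
    then have "\<mu> k * \<bar>\<mu> k - \<mu> l\<bar> * \<bar>v k \<bullet> conv_term u v k l\<bar> \<le>
        \<mu> k * \<bar>\<mu> k - \<mu> l\<bar> * (norm (v k) * (norm (u (k - l)) * min (kabs k) (kabs l) * norm (v l)))"
      using pos by (intro mult_left_mono) auto
    also have "\<dots> = \<bar>\<mu> k - \<mu> l\<bar> * min (kabs k) (kabs l) * ?X"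
      by simp
    also have "\<dots> \<le> ?c * (if 2 * kabs (k - l) \<le> kabs l then kabs (k - l) * \<mu> l else kabs l * \<mu> (k - l)) * ?X"
      using pos by (intro mult_right_mono commutator_kernel[OF p adm nz False]) auto
    also have "\<dots> = ?c * ((if 2 * kabs (k - l) \<le> kabs l then kabs (k - l) else 0)
          * norm (u (k - l)) * (\<mu> l * norm (v l)) * (\<mu> k * norm (v k))
        + (if kabs l < 2 * kabs (k - l) then kabs l else 0)
          * (\<mu> (k - l) * norm (u (k - l))) * norm (v l) * (\<mu> k * norm (v k)))"
      by (simp add: not_le)
    finally show ?thesis
      using pos by (simp only: abs_mult abs_of_pos)
  next
    case True
    then show ?thesis using not_less[of "kabs l" 0] by simp
  qed
  have "\<bar>tri K \<mu> u v\<bar> \<le> (\<Sum>k\<in>K. \<Sum>l\<in>K. \<bar>\<mu> k * (\<mu> k - \<mu> l) * (v k \<bullet> conv_term u v k l)\<bar>)"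
    unfolding tri_commutator[OF u] by (intro order_trans[OF sum_abs] sum_mono order_refl)
  also have "\<dots> \<le> ?c * (low_high K \<mu> u v + high_low K \<mu> u v)"
    unfolding low_high_def high_low_def sum.distrib[symmetric] sum_distrib_left
    by (intro sum_mono) (use term_le in \<open>simp add: sum_distrib_left\<close>)
  finally show ?thesis .
qed

text \<open>Once the powers are moved onto the norms, the kernel is |l|^(1-\<gamma>)
  |j|^(\<gamma>-5/2) on |l| < 2|j|. The sum of its square over \<open>l\<close> is of order
  |j|^(5-2\<gamma>) |j|^(2\<gamma>-5), hence bounded; \<open>\<gamma> < 5/2\<close> keeps the summed
  exponent above -3. The number 5/2 is half the dimension plus one derivative.\<close>

lemma high_low_le:
  assumes "\<gamma> < 5/2"
  obtains C where "0 < C" "\<And>K \<mu> u v. \<lbrakk>finite K; 0 \<notin> K; \<And>k. k \<notin> K \<Longrightarrow> u k = 0\<rbrakk> \<Longrightarrow>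
    high_low K \<mu> u v \<le> C * nrm K (\<lambda>k. \<mu> k * kabs k powr (5/2 - \<gamma>)) u * nrm K (\<lambda>k. kabs k powr \<gamma>) v * nrm K \<mu> v"
proof -
  obtain D where D: "0 < D" "\<And>F R. \<lbrakk>finite F; \<And>k. k \<in> F \<Longrightarrow> k \<noteq> 0 \<and> kabs k \<le> R; 0 \<le> R\<rbrakk>
    \<Longrightarrow> (\<Sum>k\<in>F. kabs k powr (2 - 2 * \<gamma>)) \<le> D * R powr ((2 - 2 * \<gamma>) + 3)"
    using lattice_sum_growth[of "2 - 2 * \<gamma>"] assms by auto
  define B where "B = D * 2 powr (5 - 2 * \<gamma>)"
  show ?thesis
  proof (rule that[of "sqrt B"])
    show "0 < sqrt B" using D by (simp add: B_def)
    fix K :: "wv set" and \<mu> :: "wv \<Rightarrow> real" and u v :: vfield assume K: "finite K" "0 \<notin> K" and u: "\<And>k. k \<notin> K \<Longrightarrow> u k = 0"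
    let ?c = "\<lambda>j l. if kabs l < 2 * kabs j then kabs l powr (1 - \<gamma>) * kabs j powr (\<gamma> - 5/2) else 0"
    let ?P = "\<lambda>j. \<mu> j * kabs j powr (5/2 - \<gamma>) * norm (u j)"
    let ?Q = "\<lambda>l. kabs l powr \<gamma> * norm (v l)"
    let ?Z = "\<lambda>k. \<mu> k * norm (v k)"
    have "high_low K \<mu> u v = (\<Sum>k\<in>K. \<Sum>l\<in>K. ?c (k - l) l * ?P (k - l) * ?Q l * ?Z k)"
      unfolding high_low_def
    proof (intro sum.cong refl)
      fix k l assume "k \<in> K" "l \<in> K"
      then have l: "0 < kabs l" using K kabs_pos by metis
      show "(if kabs l < 2 * kabs (k - l) then kabs l else 0) * (\<mu> (k - l) * norm (u (k - l))) * norm (v l) * ?Z k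
        = ?c (k - l) l * ?P (k - l) * ?Q l * ?Z k"
      proof (cases "kabs l < 2 * kabs (k - l)")
        case True
        then have j: "0 < kabs (k - l)" using l by linarith
        have "kabs l powr (1 - \<gamma>) * kabs l powr \<gamma> = kabs l"
          using l by (simp flip: powr_add)
        moreover have "kabs (k - l) powr (\<gamma> - 5/2) * kabs (k - l) powr (5/2 - \<gamma>) = 1"
          using j by (simp flip: powr_add)
        ultimately have "kabs l = kabs l powr (1 - \<gamma>) * kabs l powr \<gamma> *
            (kabs (k - l) powr (\<gamma> - 5/2) * kabs (k - l) powr (5/2 - \<gamma>))"
          by simp
        then have "kabs l * X = (kabs l powr (1 - \<gamma>) * kabs (k - l) powr (\<gamma> - 5/2)) * kabs (k - l) powr (5/2 - \<gamma>) * kabs l powr \<gamma> * X" for X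
          by (simp only: mult_ac)
        from this[of "\<mu> (k - l) * norm (u (k - l)) * norm (v l) * ?Z k"]
        show ?thesis using True by (simp only: if_True mult_ac)
      qed simp
    qed
    also have "\<dots> \<le> sqrt B * L2_set ?P K * L2_set ?Q K * L2_set ?Z K"
    proof (rule convolution_bound1[OF K(1)])
      show "\<And>j. j \<notin> K \<Longrightarrow> ?P j = 0" by (simp add: u)
      fix j assume "j \<in> K"
      then have j: "0 < kabs j" using K kabs_pos by metis
      let ?F = "{l \<in> K. kabs l < 2 * kabs j}"
      have "(\<Sum>l\<in>K. (?c j l)\<^sup>2) = (\<Sum>l\<in>?F. (kabs l powr (1 - \<gamma>) * kabs j powr (\<gamma> - 5/2))\<^sup>2)"
        using K by (intro sum.mono_neutral_cong_right) auto
      also have "\<dots> = (\<Sum>l\<in>?F. kabs l powr (2 - 2 * \<gamma>)) * kabs j powr (2 * \<gamma> - 5)"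
        unfolding sum_distrib_right power_mult_distrib
        by (intro sum.cong) (auto simp: powr_square algebra_simps)
      also have "\<dots> \<le> (D * (2 * kabs j) powr ((2 - 2 * \<gamma>) + 3)) * kabs j powr (2 * \<gamma> - 5)"
        using K by (intro mult_right_mono D) auto
      also have "\<dots> = B * (kabs j powr (5 - 2 * \<gamma>) * kabs j powr (2 * \<gamma> - 5))"
        by (simp add: B_def powr_mult algebra_simps)
      also have "\<dots> = B" using j by (simp flip: powr_add)
      finally show "(\<Sum>l\<in>K. (?c j l)\<^sup>2) \<le> B" .
    qed
    finally show "high_low K \<mu> u v \<le> sqrt B * nrm K (\<lambda>k. \<mu> k * kabs k powr (5/2 - \<gamma>)) u
        * nrm K (\<lambda>k. kabs k powr \<gamma>) v * nrm K \<mu> v"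
      by (simp add: nrm_def)
  qed
qed

text \<open>Here the kernel is |j|^(\<beta>-3/2) |l|^(-\<beta>) on 2|j| <= |l|, and the sum of its
  square over \<open>j\<close> is of order |l|^(2\<beta>) |l|^(-2\<beta>). Positivity of
  \<open>\<beta>\<close> keeps the exponent 2\<beta>-3 above the logarithmic value -3.\<close>

lemma low_high_le:
  assumes "0 < \<beta>"
  obtains C where "0 < C" "\<And>K \<mu> u v. \<lbrakk>finite K; 0 \<notin> K; \<And>k. k \<notin> K \<Longrightarrow> u k = 0\<rbrakk> \<Longrightarrow>
    low_high K \<mu> u v \<le> C * nrm K (\<lambda>k. kabs k powr (5/2 - \<beta>)) u * nrm K (\<lambda>k. \<mu> k * kabs k powr \<beta>) v * nrm K \<mu> v"
proof -
  obtain D where D: "0 < D" "\<And>F R. \<lbrakk>finite F; \<And>k. k \<in> F \<Longrightarrow> k \<noteq> 0 \<and> kabs k \<le> R; 0 \<le> R\<rbrakk>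
    \<Longrightarrow> (\<Sum>k\<in>F. kabs k powr (2 * \<beta> - 3)) \<le> D * R powr ((2 * \<beta> - 3) + 3)"
    using lattice_sum_growth[of "2 * \<beta> - 3"] assms by auto
  show ?thesis
  proof (rule that[of "sqrt D"])
    show "0 < sqrt D" using D by simp
    fix K :: "wv set" and \<mu> :: "wv \<Rightarrow> real" and u v :: vfield assume K: "finite K" "0 \<notin> K" and u: "\<And>k. k \<notin> K \<Longrightarrow> u k = 0"
    let ?c = "\<lambda>j l. if 2 * kabs j \<le> kabs l then kabs j powr (\<beta> - 3/2) * kabs l powr (- \<beta>) else 0"
    let ?P = "\<lambda>j. kabs j powr (5/2 - \<beta>) * norm (u j)"
    let ?Q = "\<lambda>l. \<mu> l * kabs l powr \<beta> * norm (v l)"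
    let ?Z = "\<lambda>k. \<mu> k * norm (v k)"
    have "low_high K \<mu> u v = (\<Sum>k\<in>K. \<Sum>l\<in>K. ?c (k - l) l * ?P (k - l) * ?Q l * ?Z k)"
      unfolding low_high_def
    proof (intro sum.cong refl)
      fix k l assume "k \<in> K" "l \<in> K"
      then have l: "0 < kabs l" using K kabs_pos by metis
      show "(if 2 * kabs (k - l) \<le> kabs l then kabs (k - l) else 0) * norm (u (k - l)) * (\<mu> l * norm (v l)) * ?Z k
        = ?c (k - l) l * ?P (k - l) * ?Q l * ?Z k"
      proof (cases "2 * kabs (k - l) \<le> kabs l")
        case True
        have "kabs (k - l) powr (\<beta> - 3/2) * kabs (k - l) powr (5/2 - \<beta>) = kabs (k - l)"
          by (simp flip: powr_add)
        moreover have "kabs l powr (- \<beta>) * kabs l powr \<beta> = 1"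
          using l by (simp flip: powr_add)
        ultimately have "kabs (k - l) = kabs (k - l) powr (\<beta> - 3/2) * kabs (k - l) powr (5/2 - \<beta>) *
            (kabs l powr (- \<beta>) * kabs l powr \<beta>)"
          by simp
        then have "kabs (k - l) * X = (kabs (k - l) powr (\<beta> - 3/2) * kabs l powr (- \<beta>)) * kabs (k - l) powr (5/2 - \<beta>) * kabs l powr \<beta> * X" for X
          by (simp only: mult_ac)
        from this[of "\<mu> l * norm (u (k - l)) * norm (v l) * ?Z k"]
        show ?thesis using True by (simp only: if_True mult_ac)
      qed simp
    qed
    also have "\<dots> \<le> sqrt D * L2_set ?P K * L2_set ?Q K * L2_set ?Z K"
    proof (rule convolution_bound2[OF K(1)])
      show "\<And>j. j \<notin> K \<Longrightarrow> ?P j = 0" by (simp add: u)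
      fix l assume "l \<in> K"
      then have l: "0 < kabs l" using K kabs_pos by metis
      let ?F = "{j \<in> K. 2 * kabs j \<le> kabs l}"
      have "(\<Sum>j\<in>K. (?c j l)\<^sup>2) = (\<Sum>j\<in>?F. (kabs j powr (\<beta> - 3/2) * kabs l powr (- \<beta>))\<^sup>2)"
        using K by (intro sum.mono_neutral_cong_right) auto
      also have "\<dots> = (\<Sum>j\<in>?F. kabs j powr (2 * \<beta> - 3)) * kabs l powr (- 2 * \<beta>)"
        unfolding sum_distrib_right power_mult_distrib
        by (intro sum.cong) (auto simp: powr_square algebra_simps)
      also have "\<dots> \<le> (D * kabs l powr ((2 * \<beta> - 3) + 3)) * kabs l powr (- 2 * \<beta>)"
      proof (intro mult_right_mono D)
        fix j assume "j \<in> ?F"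
        then have "j \<noteq> 0" "2 * kabs j \<le> kabs l" using K by auto
        then show "j \<noteq> 0 \<and> kabs j \<le> kabs l" using kabs_nonneg[of j] by linarith
      qed (use K in auto)
      also have "(D * kabs l powr ((2 * \<beta> - 3) + 3)) * kabs l powr (- 2 * \<beta>) = D * (kabs l powr (2 * \<beta>) * kabs l powr (- 2 * \<beta>))"
        by (simp add: mult.assoc)
      also have "\<dots> = D" using l by (simp flip: powr_add)
      finally show "(\<Sum>j\<in>K. (?c j l)\<^sup>2) \<le> D" .
    qed
    finally show "low_high K \<mu> u v \<le> sqrt D * nrm K (\<lambda>k. kabs k powr (5/2 - \<beta>)) u
        * nrm K (\<lambda>k. \<mu> k * kabs k powr \<beta>) v * nrm K \<mu> v"
      by (simp add: nrm_def)
  qed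
qed

text \<open>For fields without dissipation no extra power can be put on \<open>v\<close>. The
  gradient of \<open>u\<close> is measured in l^1 on the Fourier side instead, a substitute for its
  supremum norm.\<close>

lemma low_high_le_wiener:
  assumes K: "finite K" "0 \<notin> K" and u: "\<And>k. k \<notin> K \<Longrightarrow> u k = 0" and mu: "\<And>k. k \<in> K \<Longrightarrow> 0 \<le> \<mu> k"
  shows "low_high K \<mu> u v \<le> (\<Sum>j\<in>K. kabs j * norm (u j)) * (nrm K \<mu> v)\<^sup>2"
proof -
  have "low_high K \<mu> u v \<le> (\<Sum>k\<in>K. \<Sum>l\<in>K. kabs (k - l) * norm (u (k - l)) * (\<mu> l * norm (v l)) * (\<mu> k * norm (v k)))"
    unfolding low_high_def using mu by (intro sum_mono) auto
  also have "\<dots> \<le> (\<Sum>j\<in>K. kabs j * norm (u j)) * L2_set (\<lambda>l. \<mu> l * norm (v l)) K * L2_set (\<lambda>k. \<mu> k * norm (v k)) K"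
    using convolution_bound3[OF K(1), of "\<lambda>j. kabs j * norm (u j)"] u by simp
  finally show ?thesis by (simp add: nrm_def power2_eq_square mult_ac)
qed

lemma nrm_LamV:
  "nrm K (\<lambda>k. \<mu> k * kabs k powr s) (LamV q v) = nrm K (\<lambda>k. \<mu> k * kabs k powr (s + q)) v"
  by (simp add: nrm_def LamV_def powr_add mult_ac)

lemma tri_velocity_le:
  assumes "\<alpha> + \<beta> = 5/4" "0 < \<beta>" "\<beta> < 5/4" "0 \<le> p"
  obtains C where "0 < C" "\<And>K \<mu> v. \<lbrakk>finite K; 0 \<notin> K; admissible p \<mu>; solenoidal v; \<And>k. k \<notin> K \<Longrightarrow> v k = 0\<rbrakk> \<Longrightarrow>
    \<bar>tri K \<mu> (LamV (- 2 * \<alpha>) v) v\<bar> \<le>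
      C * nrm K (\<lambda>k. kabs k powr \<beta>) v * nrm K (\<lambda>k. \<mu> k * kabs k powr \<beta>) v * nrm K \<mu> v"
proof -
  obtain C1 where C1: "0 < C1" "\<And>K \<mu> u v. \<lbrakk>finite K; 0 \<notin> K; \<And>k. k \<notin> K \<Longrightarrow> u k = 0\<rbrakk> \<Longrightarrow>
    high_low K \<mu> u v \<le> C1 * nrm K (\<lambda>k. \<mu> k * kabs k powr (5/2 - \<beta>)) u * nrm K (\<lambda>k. kabs k powr \<beta>) v * nrm K \<mu> v"
    by (rule high_low_le[of \<beta>]) (use assms in auto)
  obtain C2 where C2: "0 < C2" "\<And>K \<mu> u v. \<lbrakk>finite K; 0 \<notin> K; \<And>k. k \<notin> K \<Longrightarrow> u k = 0\<rbrakk> \<Longrightarrow>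
    low_high K \<mu> u v \<le> C2 * nrm K (\<lambda>k. kabs k powr (5/2 - \<beta>)) u * nrm K (\<lambda>k. \<mu> k * kabs k powr \<beta>) v * nrm K \<mu> v"
    by (rule low_high_le[of \<beta>]) (use assms in auto)
  \<comment> \<open>The smoothing of order \<open>2 * \<alpha>\<close> turns the
    \<open>5/2 - \<beta>\<close> derivatives demanded of \<open>u\<close> into exactly
    \<open>\<beta>\<close> derivatives of \<open>v\<close>, in both halves of the form.\<close>
  have e: "5/2 - \<beta> + - 2 * \<alpha> = \<beta>" using assms by simp
  show ?thesis
  proof (rule that[of "(p + 1) * 3 powr p * (C1 + C2)"])
    show "0 < (p + 1) * 3 powr p * (C1 + C2)" using C1 C2 assms by simp
    fix K :: "wv set" and \<mu> :: "wv \<Rightarrow> real" and v :: vfield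
    assume K: "finite K" "0 \<notin> K" and adm: "admissible p \<mu>" and sol: "solenoidal v" and v: "\<And>k. k \<notin> K \<Longrightarrow> v k = 0"
    let ?u = "LamV (- 2 * \<alpha>) v"
    have u: "\<And>k. k \<notin> K \<Longrightarrow> ?u k = 0" by (simp add: LamV_def v)
    have n1: "nrm K (\<lambda>k. \<mu> k * kabs k powr (5/2 - \<beta>)) ?u = nrm K (\<lambda>k. \<mu> k * kabs k powr \<beta>) v"
      using nrm_LamV[of K \<mu> "5/2 - \<beta>" "- 2 * \<alpha>" v] unfolding e .
    have n2: "nrm K (\<lambda>k. kabs k powr (5/2 - \<beta>)) ?u = nrm K (\<lambda>k. kabs k powr \<beta>) v"
      using nrm_LamV[of K "\<lambda>k. 1" "5/2 - \<beta>" "- 2 * \<alpha>" v] unfolding e by simp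
    have "\<bar>tri K \<mu> ?u v\<bar> \<le> (p + 1) * 3 powr p * (low_high K \<mu> ?u v + high_low K \<mu> ?u v)"
      by (rule tri_le[OF solenoidal_LamV[OF sol] assms(4) adm K(2)])
    also have "\<dots> \<le> (p + 1) * 3 powr p * ((C1 + C2) *
        (nrm K (\<lambda>k. kabs k powr \<beta>) v * nrm K (\<lambda>k. \<mu> k * kabs k powr \<beta>) v * nrm K \<mu> v))"
      using C1(2)[where u = ?u and v = v and K = K and \<mu> = \<mu>, OF K u]
        C2(2)[where u = ?u and v = v and K = K and \<mu> = \<mu>, OF K u] assms(4)
      unfolding n1 n2 by (intro mult_left_mono) (simp_all add: algebra_simps)
    finally show "\<bar>tri K \<mu> ?u v\<bar> \<le> (p + 1) * 3 powr p * (C1 + C2) * nrm K (\<lambda>k. kabs k powr \<beta>) v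
        * nrm K (\<lambda>k. \<mu> k * kabs k powr \<beta>) v * nrm K \<mu> v"
      by (simp add: mult_ac)
  qed
qed

text \<open>The high-low half is taken at \<open>\<gamma> = 0\<close>: the transported field enters
  only through its L^2 norm, which the flow conserves, and all 5/2 derivatives fall on
  \<open>u\<close>.\<close>

lemma tri_transport_le:
  assumes "0 \<le> p"
  obtains C where "0 < C" "\<And>K \<mu> u v. \<lbrakk>finite K; 0 \<notin> K; admissible p \<mu>; solenoidal u; \<And>k. k \<notin> K \<Longrightarrow> u k = 0\<rbrakk> \<Longrightarrow>
    \<bar>tri K \<mu> u v\<bar> \<le> C * ((\<Sum>j\<in>K. kabs j * norm (u j)) * (nrm K \<mu> v)\<^sup>2
      + nrm K (\<lambda>k. \<mu> k * kabs k powr (5/2)) u * nrm K (\<lambda>k. 1) v * nrm K \<mu> v)"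
proof -
  obtain C1 where C1: "0 < C1" "\<And>K \<mu> u v. \<lbrakk>finite K; 0 \<notin> K; \<And>k. k \<notin> K \<Longrightarrow> u k = 0\<rbrakk> \<Longrightarrow>
    high_low K \<mu> u v \<le> C1 * nrm K (\<lambda>k. \<mu> k * kabs k powr (5/2 - 0)) u * nrm K (\<lambda>k. kabs k powr 0) v * nrm K \<mu> v"
    by (rule high_low_le[of 0]) auto
  show ?thesis
  proof (rule that[of "(p + 1) * 3 powr p * (1 + C1)"])
    show "0 < (p + 1) * 3 powr p * (1 + C1)" using C1 assms by simp
    fix K :: "wv set" and \<mu> :: "wv \<Rightarrow> real" and u v :: vfield
    assume K: "finite K" "0 \<notin> K" and adm: "admissible p \<mu>" and sol: "solenoidal u" and u: "\<And>k. k \<notin> K \<Longrightarrow> u k = 0"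
    let ?A = "(\<Sum>j\<in>K. kabs j * norm (u j)) * (nrm K \<mu> v)\<^sup>2"
    let ?B = "nrm K (\<lambda>k. \<mu> k * kabs k powr (5/2)) u * nrm K (\<lambda>k. 1) v * nrm K \<mu> v"
    have A: "low_high K \<mu> u v \<le> ?A"
    proof (rule low_high_le_wiener[OF K u])
      fix k assume "k \<in> K"
      then have "k \<noteq> 0" using K by auto
      then show "0 \<le> \<mu> k" using adm by (auto simp: admissible_def less_imp_le)
    qed
    have "nrm K (\<lambda>k. kabs k powr 0) v = nrm K (\<lambda>k. 1) v"
      unfolding nrm_def by (rule L2_set_cong) (use K in \<open>auto simp: kabs_eq_0_iff\<close>)
    moreover have "high_low K \<mu> u v \<le> C1 * nrm K (\<lambda>k. \<mu> k * kabs k powr (5/2 - 0)) u * nrm K (\<lambda>k. kabs k powr 0) v * nrm K \<mu> v"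
      by (rule C1(2)[OF K]) (rule u)
    ultimately have B: "high_low K \<mu> u v \<le> C1 * ?B"
      by (simp only: mult.assoc diff_zero)
    have nn: "0 \<le> ?A" "0 \<le> ?B" by (auto intro!: mult_nonneg_nonneg sum_nonneg)
    have "\<bar>tri K \<mu> u v\<bar> \<le> (p + 1) * 3 powr p * (low_high K \<mu> u v + high_low K \<mu> u v)"
      by (rule tri_le[OF sol assms adm K(2)])
    also have "\<dots> \<le> (p + 1) * 3 powr p * ((1 + C1) * (?A + ?B))"
    proof (rule mult_left_mono)
      have "a + b \<le> (1 + C1) * (X + Y)" if "a \<le> X" "b \<le> C1 * Y" "0 \<le> X" "0 \<le> Y" for a b X Y :: real
      proof -
        have "0 \<le> C1 * X" using that C1(1) by simp
        then show ?thesis using that unfolding distrib_left distrib_right mult_1 by linarith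
      qed
      from this[OF A B nn] show "low_high K \<mu> u v + high_low K \<mu> u v \<le> (1 + C1) * (?A + ?B)" .
    qed (use assms in simp)
    finally show "\<bar>tri K \<mu> u v\<bar> \<le> (p + 1) * 3 powr p * (1 + C1) * (?A + ?B)"
      by (simp add: mult_ac)
  qed
qed

section \<open>Gronwall inequality and Lipschitz differential equations\<close>

text \<open>The dissipation \<open>D\<close> is carried along, so that one inequality bounds both
  the quantity and the time integral of the derivatives gained.\<close>

lemma gronwall:
  fixes f f' D k g :: "real \<Rightarrow> real"
  assumes deriv: "\<And>t. t \<in> {0..T} \<Longrightarrow> (f has_real_derivative f' t) (at t within {0..T})"
    and ineq: "\<And>t. t \<in> {0..T} \<Longrightarrow> f' t + D t \<le> k t * f t + g t"
    and cont: "continuous_on {0..T} D" "continuous_on {0..T} k" "continuous_on {0..T} g"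
    and nonneg: "\<And>t. t \<in> {0..T} \<Longrightarrow> 0 \<le> f t" "\<And>t. t \<in> {0..T} \<Longrightarrow> 0 \<le> D t"
      "\<And>t. t \<in> {0..T} \<Longrightarrow> 0 \<le> k t" "\<And>t. t \<in> {0..T} \<Longrightarrow> 0 \<le> g t"
    and t: "t \<in> {0..T}"
  shows "f t + integral {0..t} D \<le> (f 0 + integral {0..T} g) * exp (integral {0..T} k)"
proof -
  let ?D = "\<lambda>t. integral {0..t} D" and ?k = "\<lambda>t. integral {0..t} k" and ?g = "\<lambda>t. integral {0..t} g"
  \<comment> \<open>The integrating factor multiplies \<open>f\<close> and the dissipation integral.
    The integral of \<open>g\<close> is left undamped, since the factor is at most 1; this is what
    makes \<open>h\<close> nonincreasing.\<close>
  define h where "h = (\<lambda>t. (f t + ?D t) * exp (- ?k t) - ?g t)"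
  have int_nonneg: "0 \<le> integral {0..s} q"
    if "\<And>t. t \<in> {0..T} \<Longrightarrow> 0 \<le> q t" "continuous_on {0..T} q" "s \<in> {0..T}" for q :: "real \<Rightarrow> real" and s
    using that by (intro Henstock_Kurzweil_Integration.integral_nonneg integrable_continuous_real)
      (auto intro: continuous_on_subset)
  have int_mono: "integral {0..t} q \<le> integral {0..T} q"
    if "\<And>t. t \<in> {0..T} \<Longrightarrow> 0 \<le> q t" "continuous_on {0..T} q" for q :: "real \<Rightarrow> real"
    using that t by (intro integral_subset_le integrable_continuous_real)
      (auto intro: continuous_on_subset)
  let ?h' = "\<lambda>t. (f' t + D t) * exp (- ?k t) + (f t + ?D t) * (exp (- ?k t) * (- k t)) - g t"
  have h: "(h has_real_derivative ?h' s) (at s within {0..T})" if "s \<in> {0..T}" for s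
    unfolding h_def using that
    by (auto intro!: derivative_eq_intros deriv integral_has_real_derivative[THEN has_field_derivative_subset] cont)
  have neg: "?h' s \<le> 0" if s: "s \<in> {0..T}" for s
  proof -
    let ?E = "exp (- ?k s)"
    have "?E \<le> 1" using int_nonneg[OF nonneg(3) cont(2) s] by simp
    then have 1: "g s * ?E \<le> g s" using nonneg(4)[OF s] mult_left_mono[of ?E 1 "g s"] by simp
    have 2: "(f' s + D s) * ?E \<le> (k s * f s + g s) * ?E"
      by (intro mult_right_mono ineq s) simp
    have 3: "0 \<le> ?D s * (?E * k s)"
      using int_nonneg[OF nonneg(2) cont(1) s] nonneg(3)[OF s] by simp
    show ?thesis using 1 2 3 by (simp add: algebra_simps)
  qed
  have cont_h: "continuous_on {0..t} h"
    using t by (intro continuous_on_subset[OF DERIV_continuous_on[OF h]]) auto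
  have h_at: "(h has_real_derivative ?h' s) (at s)" if "0 < s" "s < t" for s
    using h[of s] that t at_within_Icc_at[of 0 s T] by simp
  have "h t \<le> h 0"
  proof (rule DERIV_nonpos_imp_decreasing_open[of 0 t h])
    fix s assume "0 < s" "s < t"
    then show "\<exists>y. DERIV h s :> y \<and> y \<le> 0"
      using h_at[of s] neg[of s] t by (intro exI[of _ "?h' s"]) auto
  qed (use t cont_h in auto)
  then have "(f t + ?D t) * exp (- ?k t) \<le> f 0 + ?g t"
    by (simp add: h_def)
  also have "\<dots> \<le> f 0 + ?g T" using int_mono[OF nonneg(4) cont(3)] by simp
  finally have "(f t + ?D t) * exp (- ?k t) * exp (?k t) \<le> (f 0 + ?g T) * exp (?k t)"
    by (rule mult_right_mono) simp
  then have "f t + ?D t \<le> (f 0 + ?g T) * exp (?k t)"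
    by (simp add: mult.assoc flip: exp_add)
  also have "\<dots> \<le> (f 0 + ?g T) * exp (?k T)"
    using int_mono[OF nonneg(3) cont(2)] int_nonneg[OF nonneg(4) cont(3), of T] nonneg(1)[of 0] t
    by (intro mult_left_mono) auto
  finally show ?thesis .
qed

text \<open>Picard's fixed point for the rescaled unknown exp(-l t) x(t). In this exponentially
  weighted norm the Picard map contracts on the whole interval at once, so no short intervals have
  to be glued.\<close>

lemma lipschitz_ode:
  fixes F :: "'a::banach \<Rightarrow> 'a"
  assumes lip: "\<And>x y. norm (F x - F y) \<le> L * norm (x - y)" and T: "0 \<le> T"
  obtains x where "x 0 = x0"
    "\<And>t. t \<in> {0..T} \<Longrightarrow> (x has_vector_derivative F (x t)) (at t within {0..T})"
proof -
  define M where "M = max L 1"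
  have M: "0 < M" by (simp add: M_def)
  have lipM: "norm (F x - F y) \<le> M * norm (x - y)" for x y
    by (rule order_trans[OF lip]) (simp add: M_def mult_right_mono)
  have contF: "continuous_on A F" for A
  proof (rule continuous_on_subset[OF uniformly_continuous_imp_continuous])
    show "uniformly_continuous_on UNIV F"
      unfolding uniformly_continuous_on_def
    proof (intro allI impI)
      fix e :: real assume "0 < e"
      then show "\<exists>d>0. \<forall>x\<in>UNIV. \<forall>x'\<in>UNIV. dist x' x < d \<longrightarrow> dist (F x') (F x) < e"
        using M lipM by (intro exI[of _ "e / M"])
          (auto simp: dist_norm pos_less_divide_eq mult.commute intro: le_less_trans)
    qed
  qed simp
  \<comment> \<open>Integrating M exp(l s) gains the factor M / l, which is then the contraction
    constant 1/2.\<close>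
  define l where "l = 2 * M"
  have l: "0 < l" using M by (simp add: l_def)
  \<comment> \<open>Clamping time to \<open>{0..T}\<close> extends the Picard map to bounded
    continuous functions on the whole line, a complete space available as a type.\<close>
  define c where "c = (\<lambda>t::real. max 0 (min T t))"
  have c_in: "c t \<in> {0..T}" for t using T by (auto simp: c_def)
  have c_id: "c t = t" if "t \<in> {0..T}" for t using that by (auto simp: c_def)
  have c_cont: "continuous_on UNIV c" unfolding c_def by (intro continuous_intros)
  define G where "G = (\<lambda>y :: real \<Rightarrow>\<^sub>C 'a. \<lambda>s. F (exp (l * s) *\<^sub>R y s))"
  have G_cont: "continuous_on A (G y)" for A y
    unfolding G_def by (rule continuous_on_compose2[OF contF[of UNIV]]) (auto intro!: continuous_intros)
  have G_int: "G y integrable_on {a..b}" for y a b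
    by (intro integrable_continuous_real G_cont)
  define P where "P = (\<lambda>y t. exp (- l * t) *\<^sub>R (x0 + integral {0..t} (G y)))"
  have P_cont: "continuous_on {0..T} (P y)" for y
    unfolding P_def by (intro continuous_intros indefinite_integral_continuous_1 G_int)
  have Pc: "(\<lambda>t. P y (c t)) \<in> bcontfun" for y
    unfolding bcontfun_def
  proof (intro CollectI conjI)
    show "continuous_on UNIV (\<lambda>t. P y (c t))"
      by (rule continuous_on_compose2[OF P_cont c_cont]) (use c_in in auto)
    have "bounded (P y ` {0..T})"
      by (intro compact_imp_bounded compact_continuous_image P_cont compact_Icc)
    then show "bounded (range (\<lambda>t. P y (c t)))"
      by (rule bounded_subset) (use c_in in auto)
  qed
  define \<Phi> where "\<Phi> = (\<lambda>y. Bcontfun (\<lambda>t. P y (c t)))"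
  have \<Phi>: "apply_bcontfun (\<Phi> y) t = P y (c t)" for y t
    unfolding \<Phi>_def by (simp add: Bcontfun_inverse[OF Pc])
  have contr: "dist (\<Phi> y) (\<Phi> z) \<le> 1/2 * dist y z" for y z
  proof (rule dist_bound)
    fix t
    define s where "s = c t"
    have s: "0 \<le> s" using c_in[of t] by (simp add: s_def)
    have exp_int: "((\<lambda>s. M * dist y z * exp (l * s)) has_integral
        M * dist y z * (exp (l * s) / l) - M * dist y z * (exp (l * 0) / l)) {0..s}"
      using l by (intro fundamental_theorem_of_calculus s)
        (auto intro!: derivative_eq_intros simp flip: has_real_derivative_iff_has_vector_derivative)
    have "norm (integral {0..s} (G y) - integral {0..s} (G z)) = norm (integral {0..s} (\<lambda>s. G y s - G z s))"
      by (simp add: integral_diff G_int)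
    also have "\<dots> \<le> integral {0..s} (\<lambda>s. M * dist y z * exp (l * s))"
    proof (rule integral_norm_bound_integral)
      fix r
      have "norm (G y r - G z r) \<le> M * norm (exp (l * r) *\<^sub>R y r - exp (l * r) *\<^sub>R z r)"
        unfolding G_def by (rule lipM)
      also have "\<dots> = M * (exp (l * r) * dist (y r) (z r))"
        by (simp add: dist_norm flip: scaleR_diff_right)
      also have "\<dots> \<le> M * (exp (l * r) * dist y z)"
        using M by (intro mult_left_mono dist_bounded) auto
      finally show "norm (G y r - G z r) \<le> M * dist y z * exp (l * r)" by (simp add: mult_ac)
    qed (auto intro!: integrable_diff G_int has_integral_integrable[OF exp_int])
    also have "\<dots> = M * dist y z / l * (exp (l * s) - 1)"
      using l unfolding integral_unique[OF exp_int] by (simp add: field_simps)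
    also have "\<dots> \<le> M * dist y z / l * exp (l * s)"
      using M l by (intro mult_left_mono) auto
    also have "\<dots> = 1/2 * dist y z * exp (l * s)"
      using M by (simp add: l_def)
    finally have *: "norm (integral {0..s} (G y) - integral {0..s} (G z)) \<le> 1/2 * dist y z * exp (l * s)" .
    have "dist (\<Phi> y t) (\<Phi> z t) = norm (exp (- l * s) *\<^sub>R (integral {0..s} (G y) - integral {0..s} (G z)))"
      by (simp add: \<Phi> P_def dist_norm s_def scaleR_diff_right scaleR_add_right)
    also have "\<dots> \<le> exp (- l * s) * (1/2 * dist y z * exp (l * s))"
      using mult_left_mono[OF *, of "exp (- l * s)"] by simp
    also have "\<dots> = 1/2 * dist y z" by (simp add: exp_minus)
    finally show "dist (\<Phi> y t) (\<Phi> z t) \<le> 1/2 * dist y z" .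
  qed
  obtain y where y: "\<Phi> y = y"
    using banach_fix_type[of "1/2" \<Phi>] contr by auto
  define x where "x = (\<lambda>t. exp (l * t) *\<^sub>R y t)"
  have x_eq: "x t = x0 + integral {0..t} (\<lambda>s. F (x s))" if "t \<in> {0..T}" for t
  proof -
    have "y t = P y t" using \<Phi>[of y t] by (simp add: y c_id[OF that])
    then show ?thesis
      by (simp add: x_def P_def G_def exp_minus)
  qed
  have Fx_cont: "continuous_on {0..T} (\<lambda>s. F (x s))"
    using G_cont[of "{0..T}" y] by (simp add: G_def x_def)
  show ?thesis
  proof (rule that)
    show "x 0 = x0" using x_eq[of 0] T by simp
    fix t assume t: "t \<in> {0..T}"
    have "((\<lambda>t. x0 + integral {0..t} (\<lambda>s. F (x s))) has_vector_derivative 0 + F (x t)) (at t within {0..T})"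
      by (intro has_vector_derivative_add has_vector_derivative_const
          integral_has_vector_derivative Fx_cont t)
    then show "(x has_vector_derivative F (x t)) (at t within {0..T})"
      using x_eq t by (auto intro: has_vector_derivative_transform)
  qed
qed

section \<open>The Galerkin system\<close>

text \<open>The temperature is treated as the vertical vector field \<open>\<theta> e\<^sub>3\<close>, so that the convection
  estimates for vector fields apply to it.\<close>

definition emb :: "sfield \<Rightarrow> vfield" where
  "emb \<theta> k = (\<chi> i. if i = 3 then \<theta> k else 0)"

lemma buoy_eq: "buoy \<theta> k = leray k (emb \<theta> k)"
  by (simp add: buoy_def emb_def)

lemma emb_simps [simp]: "norm (emb \<theta> k) = cmod (\<theta> k)" "emb \<theta> k = 0 \<longleftrightarrow> \<theta> k = 0"
  by (simp_all add: emb_def norm_vec_def L2_set_def sum_3 vec_eq_iff)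

lemma emb_inner_conv_term: "emb \<theta> k \<bullet> conv_term u (emb \<theta>) k l = \<theta> k \<bullet> adv_term u \<theta> k l"
  by (simp add: emb_def conv_term_def adv_term_def inner_vec_def sum_3)

lemma conv_term_emb_nth: "conv_term u (emb \<theta>) k l $ 3 = adv_term u \<theta> k l"
  by (simp add: emb_def conv_term_def adv_term_def)

lemma cmod_adv_term: "cmod (adv_term u \<theta> k l) = norm (conv_term u (emb \<theta>) k l)"
  by (simp add: adv_term_def conv_term_def norm_smult_complex_vec norm_mult)

lemma linear_leray: "linear (leray k)"
  by (rule linearI) (simp_all add: leray_def vec_eq_iff algebra_simps add_divide_distrib scaleR_conv_of_real[where 'a = complex])

lemma leray_simps [simp]: "leray k 0 = 0" "leray k (a + b) = leray k a + leray k b"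
    "leray k (a - b) = leray k a - leray k b" "leray k (r *\<^sub>R a) = r *\<^sub>R leray k a"
    "leray k (- a) = - leray k a"
  using linear_leray[of k] by (simp_all add: linear_0 linear_add linear_diff linear_cmul linear_neg)

lemma cdot_cvec: "cdot (cvec x) y = complex_of_real (x \<bullet> y)"
  by (simp add: cdot_def cvec_def inner_vec_def)

lemma cdot_leray: "k \<noteq> 0 \<Longrightarrow> cdot (leray k w) (kvec k) = 0"
  using kabs_pos[of k] by (simp add: leray_def cdot_cvec kabs_def power2_norm_eq_inner)

lemma leray_solenoidal [simp]: "cdot w (kvec k) = 0 \<Longrightarrow> leray k w = w"
  by (simp add: leray_def)

text \<open>What \<open>leray\<close> removes is a multiple of \<open>k\<close>, hence orthogonal to
  divergence-free fields: the pressure does no work.\<close>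

lemma inner_leray: "cdot v (kvec k) = 0 \<Longrightarrow> v \<bullet> leray k w = v \<bullet> w"
proof -
  assume a: "cdot v (kvec k) = 0"
  have "(\<Sum>i\<in>UNIV. cnj (v $ i) * cvec (kvec k) $ i) = cnj (cdot v (kvec k))"
    by (simp add: cdot_def cvec_def)
  then show ?thesis
    using a by (simp add: leray_def inner_diff_right inner_smult_complex_vec)
qed

lemma leray_uminus: "leray (- k) w = leray k w"
  by (simp add: leray_def cdot_def cvec_def kvec_def vec_eq_iff sum_negf)

lemma vcnj_leray: "vcnj (leray k w) = leray k (vcnj w)"
proof -
  have "vcnj (cvec x) = cvec x" for x by (simp add: vcnj_def cvec_def vec_eq_iff)
  then show ?thesis by (simp add: leray_def)
qed

lemma linear_vcnj: "linear vcnj" and linear_cdot: "linear (\<lambda>w. cdot w x)"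
  by (auto intro!: linearI)

lemma conv_term_uminus:
  assumes "\<And>k. u (- k) = vcnj (u k)" "\<And>k. v (- k) = vcnj (v k)"
  shows "conv_term u v (- k) (- l) = vcnj (conv_term u v k l)"
proof -
  have "u (- k - - l) = vcnj (u (k - l))" using assms(1)[of "k - l"] by (simp add: algebra_simps)
  then show ?thesis by (simp add: conv_term_def assms)
qed

lemma adv_term_uminus:
  assumes "\<And>k. u (- k) = vcnj (u k)" "\<And>k. \<theta> (- k) = cnj (\<theta> k)"
  shows "adv_term u \<theta> (- k) (- l) = cnj (adv_term u \<theta> k l)"
proof -
  have "u (- k - - l) = vcnj (u (k - l))" using assms(1)[of "k - l"] by (simp add: algebra_simps)
  then show ?thesis by (simp add: adv_term_def assms)
qed

text \<open>The radial cut-off makes the Galerkin vector field globally Lipschitz. It multiplies the unknowns by a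
  positive scalar, which keeps the cancellations, so the energy bound shows that it is never active.\<close>

definition radial :: "real \<Rightarrow> 'a::real_normed_vector \<Rightarrow> 'a" where
  "radial R x = (if norm x \<le> R then x else (R / norm x) *\<^sub>R x)"

lemma norm_radial_le: "0 \<le> R \<Longrightarrow> norm (radial R x) \<le> R"
  by (simp add: radial_def)

lemma radial_scaled:
  assumes "0 < R"
  obtains c where "0 < c" "c \<le> 1" "radial R x = c *\<^sub>R x"
proof (cases "norm x \<le> R")
  case True
  then show ?thesis using that[of 1] by (simp add: radial_def)
next
  case False
  then have "0 < norm x" "R / norm x \<le> 1" using assms by (auto simp: divide_le_eq)
  then show ?thesis using that[of "R / norm x"] assms False by (simp add: radial_def)
qed

text \<open>The constant 2 holds in every normed space; this generality matters because the cut-off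
  is applied in a space with a supremum norm.\<close>

lemma radial_lipschitz:
  assumes R: "0 \<le> R"
  shows "norm (radial R x - radial R y) \<le> 2 * norm (x - y)"
proof -
  have main: "norm (radial R x - radial R y) \<le> 2 * norm (x - y)" if xy: "norm x \<le> norm y" for x y :: 'a
  proof -
    have tri: "norm y - norm x \<le> norm (x - y)"
      by (metis norm_minus_commute norm_triangle_ineq2)
    consider "norm y \<le> R" | "norm x \<le> R" "R < norm y" | "R < norm x" by linarith
    then show ?thesis
    proof cases
      case 1
      then show ?thesis using xy by (simp add: radial_def)
    next
      case 2
      then have y: "0 < norm y" using R by linarith
      have "y - (R / norm y) *\<^sub>R y = ((norm y - R) / norm y) *\<^sub>R y"
        using y by (simp add: diff_divide_distrib scaleR_left_diff_distrib)
      then have "norm (y - (R / norm y) *\<^sub>R y) = norm y - R"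
        using y 2 by simp
      moreover have "norm (x - (R / norm y) *\<^sub>R y) \<le> norm (x - y) + norm (y - (R / norm y) *\<^sub>R y)"
        using norm_triangle_ineq[of "x - y" "y - (R / norm y) *\<^sub>R y"] by simp
      ultimately have "norm (x - (R / norm y) *\<^sub>R y) \<le> norm (x - y) + (norm y - R)" by simp
      then have "norm (x - (R / norm y) *\<^sub>R y) \<le> 2 * norm (x - y)" using 2 tri by linarith
      then show ?thesis using 2 by (simp add: radial_def)
    next
      case 3
      then have x: "0 < norm x" and y: "0 < norm y" using R xy by linarith+
      have "(R / norm x) *\<^sub>R x - (R / norm y) *\<^sub>R y
          = (R / norm y) *\<^sub>R (x - y) + (R / norm x - R / norm y) *\<^sub>R x"
        by (simp add: algebra_simps)
      then have "norm ((R / norm x) *\<^sub>R x - (R / norm y) *\<^sub>R y)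
          \<le> (R / norm y) * norm (x - y) + \<bar>R / norm x - R / norm y\<bar> * norm x"
        using R y by (metis abs_of_nonneg divide_nonneg_pos norm_scaleR norm_triangle_ineq)
      also have "R / norm y * norm (x - y) \<le> 1 * norm (x - y)"
        using 3 xy R by (intro mult_right_mono) (auto simp: divide_le_eq)
      also have "\<bar>R / norm x - R / norm y\<bar> * norm x \<le> norm (x - y)"
      proof -
        have "R / norm y \<le> R / norm x" using x y R xy by (intro divide_left_mono mult_pos_pos)
        then have "\<bar>R / norm x - R / norm y\<bar> * norm x = (R / norm y) * (norm y - norm x)"
        proof -
          assume "R / norm y \<le> R / norm x"
          then have "\<bar>R / norm x - R / norm y\<bar> * norm x = R / norm x * norm x - R / norm y * norm x"
            by (simp add: algebra_simps)
          then show ?thesis using x y by (simp add: algebra_simps)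
        qed
        also have "\<dots> \<le> 1 * (norm y - norm x)"
          using 3 xy R by (intro mult_right_mono) (auto simp: divide_le_eq)
        finally show ?thesis using tri by simp
      qed
      finally show ?thesis using 3 xy by (simp add: radial_def)
    qed
  qed
  show ?thesis
    using main[of x y] main[of y x] by (cases "norm x \<le> norm y") (auto simp: norm_minus_commute)
qed

text \<open>Boundedness is included because it is what keeps products Lipschitz. After the cut-off
  the quadratic Galerkin field is thus Lipschitz by composition.\<close>

definition lipb :: "('a::real_normed_vector \<Rightarrow> 'b::real_normed_vector) \<Rightarrow> bool" where
  "lipb f \<longleftrightarrow> (\<exists>L B. (\<forall>x. norm (f x) \<le> B) \<and> (\<forall>x y. norm (f x - f y) \<le> L * norm (x - y)))"

section \<open>Closure properties of bounded Lipschitz maps\<close>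

lemma lipb_bilinear:
  assumes p: "bounded_bilinear p" and f: "lipb f" and g: "lipb g"
  shows "lipb (\<lambda>x. p (f x) (g x))"
proof -
  interpret bounded_bilinear p by (rule p)
  obtain C where C: "0 \<le> C" "\<And>a b. norm (p a b) \<le> norm a * norm b * C"
    using nonneg_bounded by blast
  obtain L1 B1 where f: "\<And>x. norm (f x) \<le> B1" "\<And>x y. norm (f x - f y) \<le> L1 * norm (x - y)"
    using f by (auto simp: lipb_def)
  obtain L2 B2 where g: "\<And>x. norm (g x) \<le> B2" "\<And>x y. norm (g x - g y) \<le> L2 * norm (x - y)"
    using g by (auto simp: lipb_def)
  have B: "0 \<le> B1" "0 \<le> B2" using f(1) g(1) norm_ge_zero order_trans by blast+
  have "norm (p (f x) (g x)) \<le> B1 * B2 * C" for x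
    by (rule order_trans[OF C(2)]) (use f g B C in \<open>intro mult_right_mono mult_mono; auto\<close>)
  moreover have "norm (p (f x) (g x) - p (f y) (g y)) \<le> (L1 * B2 * C + B1 * L2 * C) * norm (x - y)" for x y
  proof -
    have "p (f x) (g x) - p (f y) (g y) = p (f x - f y) (g x) + p (f y) (g x - g y)"
      by (simp add: diff_left diff_right)
    then have "norm (p (f x) (g x) - p (f y) (g y)) \<le> norm (f x - f y) * norm (g x) * C + norm (f y) * norm (g x - g y) * C"
      using norm_triangle_le add_mono C(2) by metis
    also have "\<dots> \<le> (L1 * norm (x - y)) * B2 * C + B1 * (L2 * norm (x - y)) * C"
    proof (intro add_mono mult_right_mono mult_mono f g C B)
      show "0 \<le> L1 * norm (x - y)" using f(2)[of x y] norm_ge_zero order_trans by blast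
    qed auto
    finally show ?thesis by (simp add: algebra_simps)
  qed
  ultimately show ?thesis unfolding lipb_def by blast
qed

lemma lipb_linear:
  assumes "bounded_linear h" "lipb f"
  shows "lipb (\<lambda>x. h (f x))"
proof -
  interpret bounded_linear h by fact
  obtain C where C: "0 \<le> C" "\<And>a. norm (h a) \<le> norm a * C"
    using nonneg_bounded by blast
  obtain L B where f: "\<And>x. norm (f x) \<le> B" "\<And>x y. norm (f x - f y) \<le> L * norm (x - y)"
    using assms(2) by (auto simp: lipb_def)
  have "norm (h (f x)) \<le> B * C" for x
    by (rule order_trans[OF C(2) mult_right_mono[OF f(1) C(1)]])
  moreover have "norm (h (f x) - h (f y)) \<le> L * C * norm (x - y)" for x y
    using order_trans[OF C(2)[of "f x - f y"] mult_right_mono[OF f(2) C(1)]] by (simp add: diff mult_ac)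
  ultimately show ?thesis unfolding lipb_def by blast
qed

lemma lipb_const: "lipb (\<lambda>x. c)"
  unfolding lipb_def by (rule exI[of _ 0]) auto

lemma lipb_add:
  assumes "lipb f" "lipb g"
  shows "lipb (\<lambda>x. f x + g x)"
proof -
  obtain L1 B1 where f: "\<And>x. norm (f x) \<le> B1" "\<And>x y. norm (f x - f y) \<le> L1 * norm (x - y)"
    using assms(1) by (auto simp: lipb_def)
  obtain L2 B2 where g: "\<And>x. norm (g x) \<le> B2" "\<And>x y. norm (g x - g y) \<le> L2 * norm (x - y)"
    using assms(2) by (auto simp: lipb_def)
  have "norm (f x + g x) \<le> B1 + B2" for x
    by (rule norm_triangle_le[OF add_mono[OF f(1) g(1)]])
  moreover have "norm (f x + g x - (f y + g y)) \<le> (L1 + L2) * norm (x - y)" for x y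
    using norm_triangle_le[OF add_mono[OF f(2)[of x y] g(2)[of x y]]] by (simp add: algebra_simps)
  ultimately show ?thesis unfolding lipb_def by blast
qed

lemma lipb_minus: "lipb f \<Longrightarrow> lipb (\<lambda>x. - f x)"
  by (rule lipb_linear[OF bounded_linear_minus[OF bounded_linear_ident]])

lemma lipb_diff: "lipb f \<Longrightarrow> lipb g \<Longrightarrow> lipb (\<lambda>x. f x - g x)"
  using lipb_add[OF _ lipb_minus, of f g] by simp

lemma lipb_sum:
  "(\<And>i. i \<in> I \<Longrightarrow> lipb (f i)) \<Longrightarrow> lipb (\<lambda>x. \<Sum>i\<in>I. f i x)"
  by (induction I rule: infinite_finite_induct) (auto intro: lipb_const lipb_add)

lemma lipb_radial:
  assumes "0 \<le> R"
  shows "lipb (radial R :: 'a \<Rightarrow> 'a::real_normed_vector)"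
  unfolding lipb_def using norm_radial_le[OF assms] radial_lipschitz[OF assms] by blast

lemma continuous_on_discrete_type: "continuous_on A (f :: 'a discrete \<Rightarrow> 'b::topological_space)"
proof -
  have "continuous_on UNIV f"
    by (simp add: continuous_on_open_vimage Discrete_Topology.open_discrete)
  then show ?thesis by (rule continuous_on_subset) simp
qed

text \<open>Bounded functions on the discrete type form a Banach space containing the truncated fields for all
  truncations at once.\<close>

instance bcontfun :: (metric_space, banach) banach ..

lemma bounded_linear_apply_bcontfun: "bounded_linear (\<lambda>w. apply_bcontfun w x)"
  by (rule bounded_linear_intro[of _ 1]) (auto simp: norm_bounded)

text \<open>The projection acts on the dissipation as well. This is harmless for solenoidal
  \<open>v\<close>, and it makes the value divergence free at nonzero modes for arbitrary arguments,
  before the solution is known to be solenoidal.\<close>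

definition velocity_rhs :: "real \<Rightarrow> real \<Rightarrow> real \<Rightarrow> wv set \<Rightarrow> vfield \<Rightarrow> sfield \<Rightarrow> wv \<Rightarrow> complex ^ 3" where
  "velocity_rhs \<nu> \<alpha> \<beta> K v \<theta> k = leray k (emb \<theta> k - (\<Sum>l\<in>K. conv_term (LamV (- 2 * \<alpha>) v) v k l)
      - (\<nu> * kabs k powr (2 * \<beta>)) *\<^sub>R v k)"

definition temperature_rhs :: "real \<Rightarrow> wv set \<Rightarrow> vfield \<Rightarrow> sfield \<Rightarrow> wv \<Rightarrow> complex" where
  "temperature_rhs \<alpha> K v \<theta> k = - (\<Sum>l\<in>K. adv_term (LamV (- 2 * \<alpha>) v) \<theta> k l)"

definition galerkin :: "real \<Rightarrow> real \<Rightarrow> real \<Rightarrow> real \<Rightarrow> wv set \<Rightarrow> (real \<Rightarrow> vfield) \<Rightarrow> (real \<Rightarrow> sfield) \<Rightarrow> bool" where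
  "galerkin \<nu> \<alpha> \<beta> T K v \<theta> \<longleftrightarrow>
    (\<forall>t\<in>{0..T}. solenoidal (v t) \<and> (\<forall>k. \<theta> t (- k) = cnj (\<theta> t k)) \<and> (\<forall>k. k \<notin> K \<longrightarrow> v t k = 0 \<and> \<theta> t k = 0)) \<and>
    (\<forall>t\<in>{0..T}. \<forall>k\<in>K.
      ((\<lambda>s. v s k) has_vector_derivative velocity_rhs \<nu> \<alpha> \<beta> K (v t) (\<theta> t) k) (at t within {0..T}) \<and>
      ((\<lambda>s. \<theta> s k) has_vector_derivative temperature_rhs \<alpha> K (v t) (\<theta> t) k) (at t within {0..T}))"

lemma inner_velocity_rhs:
  assumes "solenoidal v"
  shows "v k \<bullet> velocity_rhs \<nu> \<alpha> \<beta> K v \<theta> k = v k \<bullet> emb \<theta> k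
      - v k \<bullet> (\<Sum>l\<in>K. conv_term (LamV (- 2 * \<alpha>) v) v k l) - \<nu> * kabs k powr (2 * \<beta>) * (norm (v k))\<^sup>2"
  unfolding velocity_rhs_def inner_leray[OF solenoidalD(3)[OF assms]]
  by (simp add: inner_diff_right power2_norm_eq_inner)

lemma inner_temperature_rhs:
  "\<theta> k \<bullet> temperature_rhs \<alpha> K v \<theta> k = - (emb \<theta> k \<bullet> (\<Sum>l\<in>K. conv_term (LamV (- 2 * \<alpha>) v) (emb \<theta>) k l))"
  by (simp add: temperature_rhs_def inner_sum_right emb_inner_conv_term)

lemma vector_derivative_zero_constant:
  fixes f :: "real \<Rightarrow> 'a::real_normed_vector"
  assumes "\<And>t. t \<in> {0..T} \<Longrightarrow> (f has_vector_derivative 0) (at t within {0..T})" "t \<in> {0..T}"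
  shows "f t = f 0"
proof -
  have "\<exists>c. \<forall>t\<in>{0..T}. f t = c"
    using assms(1) by (intro has_derivative_zero_constant) (auto simp: has_vector_derivative_def)
  then show ?thesis using assms(2) by auto
qed

lemma has_vector_derivative_norm_power2:
  fixes f :: "real \<Rightarrow> 'a::real_inner"
  assumes "(f has_vector_derivative f') (at t within A)"
  shows "((\<lambda>t. (norm (f t))\<^sup>2) has_real_derivative 2 * (f t \<bullet> f')) (at t within A)"
proof -
  have "((\<lambda>t. f t \<bullet> f t) has_derivative (\<lambda>h. f t \<bullet> (h *\<^sub>R f') + (h *\<^sub>R f') \<bullet> f t)) (at t within A)"
    using assms unfolding has_vector_derivative_def by (intro has_derivative_inner)
  moreover have "(\<lambda>h. f t \<bullet> (h *\<^sub>R f') + (h *\<^sub>R f') \<bullet> f t) = (*) (2 * (f t \<bullet> f'))"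
    by (auto simp: inner_commute algebra_simps)
  ultimately show ?thesis
    by (simp add: has_field_derivative_def power2_norm_eq_inner)
qed

section \<open>Lipschitz bounds, symmetry and energy balance of the truncated system\<close>

lemma lipb_conv_term:
  fixes v :: "'a::real_normed_vector \<Rightarrow> vfield"
  assumes "\<And>k. lipb (\<lambda>w. v w k)"
  shows "lipb (\<lambda>w. conv_term (LamV s (v w)) (v w) k l)"
proof -
  have "bilinear (\<lambda>a b. (\<i> * cdot a (kvec l)) *s (b :: complex ^ 3))"
    unfolding bilinear_def by (auto intro!: linearI simp: vec_eq_iff algebra_simps scaleR_conv_of_real[where 'a = complex])
  then show ?thesis
    unfolding conv_term_def LamV_def
    by (intro lipb_bilinear[where p = "\<lambda>a b. (\<i> * cdot a (kvec l)) *s b"] assms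
        lipb_linear[OF bounded_linear_scaleR_right])
       (simp add: bilinear_conv_bounded_bilinear)
qed

lemma lipb_adv_term:
  fixes v :: "'a::real_normed_vector \<Rightarrow> vfield"
  assumes "\<And>k. lipb (\<lambda>w. v w k)" "\<And>k. lipb (\<lambda>w. \<theta> w k)"
  shows "lipb (\<lambda>w. adv_term (LamV s (v w)) (\<theta> w) k l)"
proof -
  have "bilinear (\<lambda>a b. \<i> * cdot a (kvec l) * (b :: complex))"
    unfolding bilinear_def by (auto intro!: linearI simp: algebra_simps scaleR_conv_of_real[where 'a = complex])
  then show ?thesis
    unfolding adv_term_def LamV_def
    by (intro lipb_bilinear[where p = "\<lambda>a b. \<i> * cdot a (kvec l) * b"] assms
        lipb_linear[OF bounded_linear_scaleR_right])
       (simp add: bilinear_conv_bounded_bilinear)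
qed

lemma lipb_velocity_rhs:
  fixes v :: "'a::real_normed_vector \<Rightarrow> vfield"
  assumes "\<And>k. lipb (\<lambda>w. v w k)" "\<And>k. lipb (\<lambda>w. \<theta> w k)"
  shows "lipb (\<lambda>w. velocity_rhs \<nu> \<alpha> \<beta> K (v w) (\<theta> w) k)"
proof -
  have "linear (\<lambda>z. (\<chi> i. if i = 3 then z else 0) :: complex ^ 3)"
    by (rule linearI) (auto simp: vec_eq_iff)
  then have "bounded_linear (\<lambda>z. (\<chi> i. if i = 3 then z else 0) :: complex ^ 3)"
    by (simp add: linear_conv_bounded_linear)
  then have "lipb (\<lambda>w. emb (\<theta> w) k)"
    unfolding emb_def by (rule lipb_linear) (rule assms)
  moreover have "bounded_linear (leray k)"
    using linear_leray by (simp add: linear_conv_bounded_linear)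
  ultimately show ?thesis
    unfolding velocity_rhs_def
    by (intro lipb_linear[of "leray k"] lipb_diff lipb_sum lipb_conv_term assms
        lipb_linear[OF bounded_linear_scaleR_right])
qed

lemma lipb_temperature_rhs:
  fixes v :: "'a::real_normed_vector \<Rightarrow> vfield"
  assumes "\<And>k. lipb (\<lambda>w. v w k)" "\<And>k. lipb (\<lambda>w. \<theta> w k)"
  shows "lipb (\<lambda>w. temperature_rhs \<alpha> K (v w) (\<theta> w) k)"
  unfolding temperature_rhs_def by (intro lipb_minus lipb_sum lipb_adv_term assms)

lemma velocity_rhs_uminus:
  assumes "\<And>k. v (- k) = vcnj (v k)" "\<And>k. \<theta> (- k) = cnj (\<theta> k)" "\<And>k. - k \<in> K \<longleftrightarrow> k \<in> K"
  shows "velocity_rhs \<nu> \<alpha> \<beta> K v \<theta> (- k) = vcnj (velocity_rhs \<nu> \<alpha> \<beta> K v \<theta> k)"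
proof -
  let ?u = "LamV (- 2 * \<alpha>) v"
  have bij: "bij_betw uminus K K"
    using assms(3) by (intro bij_betw_byWitness[of _ uminus]) auto
  have "(\<Sum>l\<in>K. conv_term ?u v (- k) l) = (\<Sum>l\<in>K. conv_term ?u v (- k) (- l))"
    by (rule sum.reindex_bij_betw[OF bij, symmetric])
  also have "\<dots> = (\<Sum>l\<in>K. vcnj (conv_term ?u v k l))"
    by (intro sum.cong refl conv_term_uminus) (simp_all add: LamV_def assms)
  finally have "(\<Sum>l\<in>K. conv_term ?u v (- k) l) = vcnj (\<Sum>l\<in>K. conv_term ?u v k l)"
    by (simp add: vcnj_sum)
  moreover have "emb \<theta> (- k) = vcnj (emb \<theta> k)"
    by (simp add: emb_def vcnj_def assms vec_eq_iff)
  ultimately show ?thesis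
    by (simp add: velocity_rhs_def leray_uminus vcnj_leray assms)
qed

lemma temperature_rhs_uminus:
  assumes "\<And>k. v (- k) = vcnj (v k)" "\<And>k. \<theta> (- k) = cnj (\<theta> k)" "\<And>k. - k \<in> K \<longleftrightarrow> k \<in> K"
  shows "temperature_rhs \<alpha> K v \<theta> (- k) = cnj (temperature_rhs \<alpha> K v \<theta> k)"
proof -
  let ?u = "LamV (- 2 * \<alpha>) v"
  have bij: "bij_betw uminus K K"
    using assms(3) by (intro bij_betw_byWitness[of _ uminus]) auto
  have "(\<Sum>l\<in>K. adv_term ?u \<theta> (- k) l) = (\<Sum>l\<in>K. adv_term ?u \<theta> (- k) (- l))"
    by (rule sum.reindex_bij_betw[OF bij, symmetric])
  also have "\<dots> = (\<Sum>l\<in>K. cnj (adv_term ?u \<theta> k l))"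
    by (intro sum.cong refl adv_term_uminus) (simp_all add: LamV_def assms)
  finally show ?thesis by (simp add: temperature_rhs_def)
qed

lemma energy_identity:
  assumes K: "finite K"     and dv: "\<And>k. k \<in> K \<Longrightarrow> ((\<lambda>s. v s k) has_vector_derivative v' k) (at t within {0..T})"
    and d\<theta>: "\<And>k. k \<in> K \<Longrightarrow> ((\<lambda>s. \<theta> s k) has_vector_derivative \<theta>' k) (at t within {0..T})"
  shows "((\<lambda>s. \<Sum>k\<in>K. (norm (v s k))\<^sup>2 + (cmod (\<theta> s k))\<^sup>2) has_real_derivative
      (\<Sum>k\<in>K. 2 * (v t k \<bullet> v' k) + 2 * (\<theta> t k \<bullet> \<theta>' k))) (at t within {0..T})"
  using K
  by (intro DERIV_sum DERIV_add has_vector_derivative_norm_power2 dv d\<theta>)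

text \<open>With weight 1 the commutator is zero, so both convection sums drop out and only buoyancy
  and dissipation do work.\<close>

lemma energy_balance:
  assumes z: "solenoidal z"
  shows "(\<Sum>k\<in>K. z k \<bullet> velocity_rhs \<nu> \<alpha> \<beta> K z w k + w k \<bullet> temperature_rhs \<alpha> K z w k)
    = (\<Sum>k\<in>K. z k \<bullet> emb w k - \<nu> * kabs k powr (2 * \<beta>) * (norm (z k))\<^sup>2)"
proof -
  let ?u = "LamV (- 2 * \<alpha>) z"
  have "(\<Sum>k\<in>K. z k \<bullet> (\<Sum>l\<in>K. conv_term ?u z k l)) = 0" "(\<Sum>k\<in>K. emb w k \<bullet> (\<Sum>l\<in>K. conv_term ?u (emb w) k l)) = 0"
    using tri_one[OF solenoidal_LamV[OF z], of K] by (simp_all add: tri_def)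
  moreover have "(\<Sum>k\<in>K. z k \<bullet> velocity_rhs \<nu> \<alpha> \<beta> K z w k + w k \<bullet> temperature_rhs \<alpha> K z w k)
    = (\<Sum>k\<in>K. z k \<bullet> emb w k - \<nu> * kabs k powr (2 * \<beta>) * (norm (z k))\<^sup>2)
      - (\<Sum>k\<in>K. z k \<bullet> (\<Sum>l\<in>K. conv_term ?u z k l)) - (\<Sum>k\<in>K. emb w k \<bullet> (\<Sum>l\<in>K. conv_term ?u (emb w) k l))"
    unfolding inner_velocity_rhs[OF z] inner_temperature_rhs sum_subtractf[symmetric]
    by (intro sum.cong refl) simp
  ultimately show ?thesis by simp
qed

text \<open>The cut-off system is solved among all bounded coefficient families. Support, reality
  and divergence-freeness are then linear invariants of the flow, and the energy bound removes the
  cut-off.\<close>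

theorem galerkin_exists:
  fixes a :: vfield and b :: sfield
  assumes \<nu>: "0 \<le> \<nu>" and T: "0 \<le> T" and K: "finite K" "0 \<notin> K" "\<And>k. - k \<in> K \<longleftrightarrow> k \<in> K"
    and a: "solenoidal a" "\<And>k. k \<notin> K \<Longrightarrow> a k = 0"
    and b: "\<And>k. b (- k) = cnj (b k)" "\<And>k. k \<notin> K \<Longrightarrow> b k = 0"
  obtains v \<theta> where "galerkin \<nu> \<alpha> \<beta> T K v \<theta>" "\<And>k. v 0 k = a k" "\<And>k. \<theta> 0 k = b k"
proof -
  define Y0 where "Y0 = (\<Sum>k\<in>K. (norm (a k))\<^sup>2 + (cmod (b k))\<^sup>2)"
  \<comment> \<open>The square root of the energy bound \<open>Y0 * exp T\<close> proved below; the
    summand 1 keeps \<open>R\<close> positive.\<close>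
  define R where "R = sqrt (Y0 * exp T) + 1"
  have Y0: "0 \<le> Y0" unfolding Y0_def by (intro sum_nonneg) auto
  then have R: "0 < R" by (simp add: R_def add_nonneg_pos)
  \<comment> \<open>Averaging with the conjugate at \<open>- k\<close> forces the reality condition
    for every \<open>w\<close>. The field then preserves that condition regardless of its argument,
    as \<open>const\<close> requires.\<close>
  define rv where "rv = (\<lambda>w :: wv discrete \<Rightarrow>\<^sub>C ((complex ^ 3) \<times> complex). \<lambda>k.
    (1/2) *\<^sub>R (fst (apply_bcontfun (radial R w) (discrete k)) + vcnj (fst (apply_bcontfun (radial R w) (discrete (- k))))))"
  define rt where "rt = (\<lambda>w :: wv discrete \<Rightarrow>\<^sub>C ((complex ^ 3) \<times> complex). \<lambda>k.
    (1/2) *\<^sub>R (snd (apply_bcontfun (radial R w) (discrete k)) + cnj (snd (apply_bcontfun (radial R w) (discrete (- k))))))"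
  have lip_radial: "lipb (\<lambda>w :: wv discrete \<Rightarrow>\<^sub>C ((complex ^ 3) \<times> complex). apply_bcontfun (radial R w) (discrete k))" for k
    using R by (intro lipb_linear[OF bounded_linear_apply_bcontfun] lipb_radial) simp
  have "bounded_linear vcnj"
    using linear_vcnj by (simp add: linear_conv_bounded_linear)
  then have lip_rv: "lipb (\<lambda>w. rv w k)" for k
    unfolding rv_def
    by (intro lipb_linear[OF bounded_linear_scaleR_right] lipb_add lipb_linear[OF bounded_linear_fst]
        lipb_linear[of vcnj] lip_radial)
  have lip_rt: "lipb (\<lambda>w. rt w k)" for k
    unfolding rt_def
    by (intro lipb_linear[OF bounded_linear_scaleR_right] lipb_add lipb_linear[OF bounded_linear_snd]
        lipb_linear[OF bounded_linear_cnj] lip_radial)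
  have rv_real: "rv w (- k) = vcnj (rv w k)" and rt_real: "rt w (- k) = cnj (rt w k)" for w k
    by (simp_all add: rv_def rt_def add.commute)
  define V where "V = (\<lambda>w. velocity_rhs \<nu> \<alpha> \<beta> K (rv w) (rt w))"
  define H where "H = (\<lambda>w. temperature_rhs \<alpha> K (rv w) (rt w))"
  define F0 where "F0 = (\<lambda>w k. if k \<in> K then (V w k, H w k) else 0)"
  have "range (F0 w) \<subseteq> F0 w ` K \<union> {0}" for w by (auto simp: F0_def)
  then have "finite (range (F0 w))" for w by (rule finite_subset) (simp add: K)
  then have "finite (range (\<lambda>k. F0 w (of_discrete k)))" for w
    by (rule rev_finite_subset) auto
  then have F0_bcontfun: "(\<lambda>k. F0 w (of_discrete k)) \<in> bcontfun" for w
    unfolding bcontfun_def by (auto intro!: continuous_on_discrete_type finite_imp_bounded)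
  define F where "F = (\<lambda>w. Bcontfun (\<lambda>k. F0 w (of_discrete k)))"
  have F: "apply_bcontfun (F w) k = F0 w (of_discrete k)" for w k
    by (simp add: F_def Bcontfun_inverse[OF F0_bcontfun])
  have lipF0: "\<exists>L. \<forall>w z. norm (F0 w k - F0 z k) \<le> L * norm (w - z)" for k
  proof -
    obtain L1 where "\<And>w z. norm (V w k - V z k) \<le> L1 * norm (w - z)"
      using lipb_velocity_rhs[of rv rt, OF lip_rv lip_rt] unfolding V_def lipb_def by metis
    moreover obtain L2 where "\<And>w z. norm (H w k - H z k) \<le> L2 * norm (w - z)"
      using lipb_temperature_rhs[of rv rt, OF lip_rv lip_rt] unfolding H_def lipb_def by metis
    moreover have "norm (F0 w k - F0 z k) \<le> norm (V w k - V z k) + norm (H w k - H z k)" for w z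
      using norm_Pair_le[of "V w k - V z k" "H w k - H z k"] by (simp add: F0_def)
    ultimately have "norm (F0 w k - F0 z k) \<le> (L1 + L2) * norm (w - z)" for w z
      unfolding distrib_right by (meson add_mono order_trans)
    then show ?thesis by (intro exI[of _ "L1 + L2"]) simp
  qed
  then obtain L where L: "\<And>k w z. norm (F0 w k - F0 z k) \<le> L k * norm (w - z)" by metis
  have lipF: "norm (F w - F z) \<le> (\<Sum>k\<in>K. \<bar>L k\<bar>) * norm (w - z)" for w z
  proof (rule norm_bound)
    fix d :: "wv discrete"
    define k where "k = of_discrete d"
    show "norm (apply_bcontfun (F w - F z) d) \<le> (\<Sum>k\<in>K. \<bar>L k\<bar>) * norm (w - z)"
    proof (cases "k \<in> K")
      case True
      have "norm (F0 w k - F0 z k) \<le> L k * norm (w - z)" by (rule L)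
      also have "\<dots> \<le> (\<Sum>k\<in>K. \<bar>L k\<bar>) * norm (w - z)"
        using member_le_sum[OF True _ K(1), of "\<lambda>k. \<bar>L k\<bar>"] by (intro mult_right_mono) auto
      finally show ?thesis by (simp add: F k_def)
    qed (simp add: discrete_inverse F F0_def sum_nonneg k_def)
  qed
  define A0 where "A0 = (\<lambda>k. (a k, b k))"
  have "range A0 \<subseteq> A0 ` K \<union> {0}" using a(2) b(2) by (auto simp: A0_def zero_prod_def)
  then have "finite (range A0)" by (rule finite_subset) (simp add: K)
  then have "finite (range (\<lambda>k. A0 (of_discrete k)))"
    by (rule rev_finite_subset) auto
  then have A0_bcontfun: "(\<lambda>k. A0 (of_discrete k)) \<in> bcontfun"
    unfolding bcontfun_def by (auto intro!: continuous_on_discrete_type finite_imp_bounded)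
  obtain x where x0: "x 0 = Bcontfun (\<lambda>k. A0 (of_discrete k))"
    and x: "\<And>t. t \<in> {0..T} \<Longrightarrow> (x has_vector_derivative F (x t)) (at t within {0..T})"
    by (rule lipschitz_ode[OF lipF T, of "Bcontfun (\<lambda>k. A0 (of_discrete k))"]) blast
  \<comment> \<open>Each structural property says that a bounded linear map vanishes on the
    solution. The map kills every value of the field \<open>F\<close>, so it keeps its initial
    value.\<close>
  have const: "h (x t) = h (x 0)" if h: "bounded_linear h" and hF: "\<And>w. h (F w) = 0" and t: "t \<in> {0..T}" for h t
  proof (rule vector_derivative_zero_constant[OF _ t])
    fix s assume "s \<in> {0..T}"
    then show "((\<lambda>s. h (x s)) has_vector_derivative 0) (at s within {0..T})"
      using bounded_linear.has_vector_derivative[OF h x] hF by fastforce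
  qed
  define v where "v = (\<lambda>t k. fst (apply_bcontfun (x t) (discrete k)))"
  define \<theta> where "\<theta> = (\<lambda>t k. snd (apply_bcontfun (x t) (discrete k)))"
  have "apply_bcontfun (x 0) (discrete k) = A0 k" for k
    unfolding x0 by (simp add: Bcontfun_inverse[OF A0_bcontfun] discrete_inverse)
  then have init: "v 0 k = a k" "\<theta> 0 k = b k" for k
    by (simp_all add: v_def \<theta>_def A0_def)
  have bl_fst: "bounded_linear (\<lambda>w. fst (apply_bcontfun w (discrete k)))" and bl_snd: "bounded_linear (\<lambda>w. snd (apply_bcontfun w (discrete k)))"
    for k :: wv
    by (rule bounded_linear_compose[OF _ bounded_linear_apply_bcontfun] bounded_linear_fst bounded_linear_snd)+
  have off: "v t k = 0 \<and> \<theta> t k = 0" if t: "t \<in> {0..T}" and "k \<notin> K" for t k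
    using const[OF bl_fst _ t, of k] const[OF bl_snd _ t, of k] that init[of k] a(2) b(2)
    by (simp add: discrete_inverse F F0_def v_def \<theta>_def)
  have div: "cdot (v t k) (kvec k) = 0" if t: "t \<in> {0..T}" for t k
  proof -
    have bl: "bounded_linear (\<lambda>w. cdot w (kvec k))"
      using linear_cdot by (simp add: linear_conv_bounded_linear)
    have bl': "bounded_linear (\<lambda>w. cdot (fst (apply_bcontfun w (discrete k))) (kvec k))"
      by (rule bounded_linear_compose[OF bl bl_fst[of k]])
    have z: "cdot (fst (apply_bcontfun (F w) (discrete k))) (kvec k) = 0" for w
    proof (cases "k \<in> K")
      case True
      then have "k \<noteq> 0" using K by auto
      then show ?thesis using True cdot_leray[OF \<open>k \<noteq> 0\<close>]
        by (simp only: F discrete_inverse[OF UNIV_I] F0_def if_True fst_conv V_def velocity_rhs_def)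
    qed (simp add: F F0_def discrete_inverse)
    have "cdot (v t k) (kvec k) = cdot (v 0 k) (kvec k)"
      unfolding v_def using const[OF bl' z t] .
    then show ?thesis using init a(1) by (simp add: solenoidal_def)
  qed
  have v_real: "v t (- k) = vcnj (v t k)" if t: "t \<in> {0..T}" for t k
  proof -
    have "bounded_linear (\<lambda>w. vcnj (fst (apply_bcontfun w (discrete k))))"
      by (rule bounded_linear_compose[OF \<open>bounded_linear vcnj\<close> bl_fst[of k]])
    then have bl': "bounded_linear (\<lambda>w. fst (apply_bcontfun w (discrete (- k))) - vcnj (fst (apply_bcontfun w (discrete k))))"
      by (intro bounded_linear_sub bl_fst)
    have z: "fst (apply_bcontfun (F w) (discrete (- k))) - vcnj (fst (apply_bcontfun (F w) (discrete k))) = 0" for w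
      using K(3) velocity_rhs_uminus[of "rv w" "rt w" K, OF rv_real rt_real]
      by (simp add: discrete_inverse F F0_def V_def)
    have "v t (- k) - vcnj (v t k) = v 0 (- k) - vcnj (v 0 k)"
      unfolding v_def using const[OF bl' z t] .
    then show ?thesis using init a(1) by (simp add: solenoidal_def)
  qed
  have \<theta>_real: "\<theta> t (- k) = cnj (\<theta> t k)" if t: "t \<in> {0..T}" for t k
  proof -
    have "bounded_linear (\<lambda>w. cnj (snd (apply_bcontfun w (discrete k))))"
      by (rule bounded_linear_compose[OF bounded_linear_cnj bl_snd[of k]])
    then have bl': "bounded_linear (\<lambda>w. snd (apply_bcontfun w (discrete (- k))) - cnj (snd (apply_bcontfun w (discrete k))))"
      by (intro bounded_linear_sub bl_snd)
    have z: "snd (apply_bcontfun (F w) (discrete (- k))) - cnj (snd (apply_bcontfun (F w) (discrete k))) = 0" for w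
      using K(3) temperature_rhs_uminus[of "rv w" "rt w" K, OF rv_real rt_real]
      by (simp add: discrete_inverse F F0_def H_def)
    have "\<theta> t (- k) - cnj (\<theta> t k) = \<theta> 0 (- k) - cnj (\<theta> 0 k)"
      unfolding \<theta>_def using const[OF bl' z t] .
    then show ?thesis using init b(1) by simp
  qed
  have sol: "solenoidal (v t)" if t: "t \<in> {0..T}" for t
    using off[OF t, of 0] K(2) v_real[OF t] div[OF t] by (simp add: solenoidal_def)
  \<comment> \<open>Once reality is known, the averaging acts trivially, and what remains of the
    cut-off is one positive factor common to all modes of both unknowns.\<close>
  have scaled: "\<exists>c. 0 < c \<and> c \<le> 1 \<and> (\<forall>k. rv (x t) k = c *\<^sub>R v t k) \<and> (\<forall>k. rt (x t) k = c *\<^sub>R \<theta> t k)"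
    if t: "t \<in> {0..T}" for t
  proof -
    obtain c where c: "0 < c" "c \<le> 1" "radial R (x t) = c *\<^sub>R x t"
      using radial_scaled[OF R] by blast
    have "rv (x t) k = (1/2) *\<^sub>R (c *\<^sub>R v t k + vcnj (c *\<^sub>R v t (- k)))"
      "rt (x t) k = (1/2) *\<^sub>R (c *\<^sub>R \<theta> t k + cnj (c *\<^sub>R \<theta> t (- k)))" for k
      by (simp_all add: rv_def rt_def c v_def \<theta>_def)
    then have "rv (x t) k = c *\<^sub>R v t k" "rt (x t) k = c *\<^sub>R \<theta> t k" for k
      by (simp_all only: v_real[OF t] \<theta>_real[OF t] vcnj_simps complex_cnj_scaleR complex_cnj_cnj scaleR_half_double)
    then show ?thesis using c by (intro exI[of _ c]) simp
  qed
  have dv: "((\<lambda>s. v s k) has_vector_derivative V (x t) k) (at t within {0..T})"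
    and d\<theta>: "((\<lambda>s. \<theta> s k) has_vector_derivative H (x t) k) (at t within {0..T})"
    if t: "t \<in> {0..T}" and k: "k \<in> K" for t k
    using bounded_linear.has_vector_derivative[OF bl_fst[of k] x[OF t]]
      bounded_linear.has_vector_derivative[OF bl_snd[of k] x[OF t]] k
    by (simp_all add: v_def \<theta>_def F F0_def discrete_inverse)
  define Y where "Y = (\<lambda>t. \<Sum>k\<in>K. (norm (v t k))\<^sup>2 + (cmod (\<theta> t k))\<^sup>2)"
  have Y_nonneg: "0 \<le> Y t" for t unfolding Y_def by (intro sum_nonneg) auto
  have Y_bound: "Y t \<le> Y0 * exp T" if t: "t \<in> {0..T}" for t
  proof -
    let ?Y' = "\<lambda>t. \<Sum>k\<in>K. 2 * (v t k \<bullet> V (x t) k) + 2 * (\<theta> t k \<bullet> H (x t) k)"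
    have "Y t + integral {0..t} (\<lambda>_. 0) \<le> (Y 0 + integral {0..T} (\<lambda>_. 0)) * exp (integral {0..T} (\<lambda>_. 1))"
    proof (rule gronwall[where f' = ?Y', OF _ _ _ _ _ _ _ _ _ t])
      fix s assume s: "s \<in> {0..T}"
      show "(Y has_real_derivative ?Y' s) (at s within {0..T})"
        unfolding Y_def by (rule energy_identity[OF K(1) dv[OF s] d\<theta>[OF s]])
      obtain c where c: "0 < c" "c \<le> 1" "\<And>k. rv (x s) k = c *\<^sub>R v s k" "\<And>k. rt (x s) k = c *\<^sub>R \<theta> s k"
        using scaled[OF s] by blast
      let ?z = "rv (x s)" and ?w = "rt (x s)"
      have z: "solenoidal ?z"
        using sol[OF s] by (simp add: solenoidal_def c)
      \<comment> \<open>The balance is available for the scaled fields at which \<open>V\<close> and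
        \<open>H\<close> are evaluated. Multiplying by \<open>c\<close> transfers it to the
        solution, and \<open>c > 0\<close> is cancelled at the end.\<close>
      have "c * (v s k \<bullet> V (x s) k + \<theta> s k \<bullet> H (x s) k) = ?z k \<bullet> V (x s) k + ?w k \<bullet> H (x s) k" for k
        by (simp add: c distrib_left)
      then have "c * (\<Sum>k\<in>K. v s k \<bullet> V (x s) k + \<theta> s k \<bullet> H (x s) k) =
          (\<Sum>k\<in>K. ?z k \<bullet> emb ?w k - \<nu> * kabs k powr (2 * \<beta>) * (norm (?z k))\<^sup>2)"
        unfolding sum_distrib_left by (simp only: V_def H_def energy_balance[OF z])
      moreover have le: "?z k \<bullet> emb ?w k \<le> c * (((norm (v s k))\<^sup>2 + (cmod (\<theta> s k))\<^sup>2) / 2)" for k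
      proof -
        have "?z k \<bullet> emb ?w k \<le> norm (?z k) * norm (emb ?w k)" by (rule norm_cauchy_schwarz)
        also have "\<dots> = c * (c * (norm (v s k) * cmod (\<theta> s k)))" using c by simp
        also have "\<dots> \<le> c * (1 * (norm (v s k) * cmod (\<theta> s k)))"
          using c by (intro mult_left_mono mult_right_mono) auto
        also have "c * (1 * (norm (v s k) * cmod (\<theta> s k))) \<le> c * (((norm (v s k))\<^sup>2 + (cmod (\<theta> s k))\<^sup>2) / 2)"
          using c sum_squares_bound[of "norm (v s k)" "cmod (\<theta> s k)"] by (intro mult_left_mono) auto
        finally show ?thesis .
      qed
      moreover have "?z k \<bullet> emb ?w k - \<nu> * kabs k powr (2 * \<beta>) * (norm (?z k))\<^sup>2 \<le> c * (((norm (v s k))\<^sup>2 + (cmod (\<theta> s k))\<^sup>2) / 2)" for k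
      proof -
        have "0 \<le> \<nu> * kabs k powr (2 * \<beta>) * (norm (?z k))\<^sup>2" using \<nu> by simp
        then show ?thesis using le[of k] by linarith
      qed
      ultimately have "c * (\<Sum>k\<in>K. v s k \<bullet> V (x s) k + \<theta> s k \<bullet> H (x s) k) \<le> (\<Sum>k\<in>K. c * (((norm (v s k))\<^sup>2 + (cmod (\<theta> s k))\<^sup>2) / 2))"
        by (simp only: sum_mono)
      also have "\<dots> = c * (Y s / 2)" by (simp only: Y_def sum_distrib_left[symmetric] sum_divide_distrib[symmetric])
      finally have "c * (?Y' s) \<le> c * Y s"
        by (simp only: distrib_left[symmetric] sum_distrib_left[symmetric])
      then show "?Y' s + 0 \<le> 1 * Y s + 0" using c by simp
    qed (auto simp: Y_nonneg)
    then show ?thesis using T by (simp add: Y_def Y0_def init)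
  qed
  \<comment> \<open>The supremum norm is dominated by the root of the l^2 energy, so the cut-off was
    never active.\<close>
  have "norm (x t) \<le> R" if t: "t \<in> {0..T}" for t
  proof (rule norm_bound)
    fix d :: "wv discrete"
    define k where "k = of_discrete d"
    have "norm (apply_bcontfun (x t) d) = sqrt ((norm (v t k))\<^sup>2 + (cmod (\<theta> t k))\<^sup>2)"
      by (simp add: v_def \<theta>_def norm_prod_def k_def of_discrete_inverse)
    also have "\<dots> \<le> sqrt (Y t)"
    proof (cases "k \<in> K")
      case True
      then show ?thesis unfolding Y_def
        by (intro real_sqrt_le_mono member_le_sum[of k K "\<lambda>k. (norm (v t k))\<^sup>2 + (cmod (\<theta> t k))\<^sup>2"] K(1)) auto
    next
      case False
      then show ?thesis using off[OF t] Y_nonneg by simp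
    qed
    also have "\<dots> \<le> sqrt (Y0 * exp T)" by (intro real_sqrt_le_mono Y_bound t)
    finally show "norm (apply_bcontfun (x t) d) \<le> R" by (simp add: R_def)
  qed
  then have id: "rv (x t) = v t" "rt (x t) = \<theta> t" if t: "t \<in> {0..T}" for t
    using that v_real[OF t] \<theta>_real[OF t]
    by (auto simp: rv_def rt_def radial_def v_def \<theta>_def fun_eq_iff)
  have "galerkin \<nu> \<alpha> \<beta> T K v \<theta>"
    unfolding galerkin_def
    using sol \<theta>_real off dv d\<theta> by (auto simp: V_def H_def id)
  then show ?thesis using that init by blast
qed

section \<open>Growth rates of the weighted norms\<close>

lemma young_le:
  fixes x y \<epsilon> :: real
  assumes "0 < \<epsilon>"
  shows "2 * (x * y) \<le> \<epsilon> * x\<^sup>2 + y\<^sup>2 / \<epsilon>"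
proof -
  have "0 \<le> (\<epsilon> * x - y)\<^sup>2 / \<epsilon>" using assms by simp
  also have "\<dots> = \<epsilon> * x\<^sup>2 + y\<^sup>2 / \<epsilon> - 2 * (x * y)"
    using assms by (simp add: power2_eq_square field_simps)
  finally show ?thesis by simp
qed

lemma nrm_cong: "(\<And>k. k \<in> K \<Longrightarrow> \<mu> k = \<mu>' k) \<Longrightarrow> nrm K \<mu> v = nrm K \<mu>' v"
  unfolding nrm_def by (rule L2_set_cong) auto

lemma nrm_mono:
  "(\<And>k. k \<in> K \<Longrightarrow> 0 \<le> \<mu> k \<and> \<mu> k \<le> \<mu>' k) \<Longrightarrow> nrm K \<mu> v \<le> nrm K \<mu>' v"
  unfolding nrm_def by (rule L2_set_mono) (auto intro: mult_right_mono)

definition buoyancy_work :: "wv set \<Rightarrow> (wv \<Rightarrow> real) \<Rightarrow> vfield \<Rightarrow> sfield \<Rightarrow> real" where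
  "buoyancy_work K \<mu> v \<theta> = (\<Sum>k\<in>K. (\<mu> k)\<^sup>2 * (v k \<bullet> emb \<theta> k))"

text \<open>Dissipation lends \<open>\<beta>\<close> derivatives to \<open>v\<close>, so the
  temperature is needed \<open>\<beta>\<close> orders below the weight. This ties order
  \<open>r\<close> for \<open>v\<close> to order \<open>r - \<beta>\<close> for
  \<open>\<theta>\<close>.\<close>

lemma buoyancy_work_le:
  assumes "0 \<notin> K"
  shows "buoyancy_work K \<mu> v \<theta> \<le> nrm K (\<lambda>k. \<mu> k * kabs k powr \<beta>) v * nrm K (\<lambda>k. \<mu> k * kabs k powr (- \<beta>)) (emb \<theta>)"
proof -
  have "buoyancy_work K \<mu> v \<theta> \<le> (\<Sum>k\<in>K. (\<mu> k * kabs k powr \<beta> * norm (v k)) * (\<mu> k * kabs k powr (- \<beta>) * norm (emb \<theta> k)))"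
    unfolding buoyancy_work_def
  proof (rule sum_mono)
    fix k assume "k \<in> K"
    then have "0 < kabs k" using assms kabs_pos by metis
    then have "kabs k powr \<beta> * kabs k powr (- \<beta>) = 1" by (simp flip: powr_add)
    moreover have "(\<mu> k * kabs k powr \<beta> * norm (v k)) * (\<mu> k * kabs k powr (- \<beta>) * norm (emb \<theta> k))
        = (kabs k powr \<beta> * kabs k powr (- \<beta>)) * ((\<mu> k)\<^sup>2 * (norm (v k) * norm (emb \<theta> k)))"
      by (simp only: power2_eq_square mult_ac)
    ultimately have "(\<mu> k * kabs k powr \<beta> * norm (v k)) * (\<mu> k * kabs k powr (- \<beta>) * norm (emb \<theta> k))
        = (\<mu> k)\<^sup>2 * (norm (v k) * norm (emb \<theta> k))"
      by (simp only: mult_1)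
    then show "(\<mu> k)\<^sup>2 * (v k \<bullet> emb \<theta> k) \<le> (\<mu> k * kabs k powr \<beta> * norm (v k)) * (\<mu> k * kabs k powr (- \<beta>) * norm (emb \<theta> k))"
      by (simp only: mult_left_mono norm_cauchy_schwarz zero_le_power2)
  qed
  also have "\<dots> \<le> nrm K (\<lambda>k. \<mu> k * kabs k powr \<beta>) v * nrm K (\<lambda>k. \<mu> k * kabs k powr (- \<beta>)) (emb \<theta>)"
    unfolding nrm_def by (rule sum_mult_le_L2_set)
  finally show ?thesis .
qed

lemma weighted_velocity_rhs:
  assumes "solenoidal v"
  shows "(\<Sum>k\<in>K. (\<mu> k)\<^sup>2 * (v k \<bullet> velocity_rhs \<nu> \<alpha> \<beta> K v \<theta> k)) =
    buoyancy_work K \<mu> v \<theta> - tri K \<mu> (LamV (- 2 * \<alpha>) v) v - \<nu> * (nrm K (\<lambda>k. \<mu> k * kabs k powr \<beta>) v)\<^sup>2"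
  unfolding inner_velocity_rhs[OF assms] nrm_power2 buoyancy_work_def tri_def sum_distrib_left
    sum_subtractf[symmetric]
  by (intro sum.cong refl) (simp add: power_mult_distrib powr_square algebra_simps)

lemma weighted_temperature_rhs:
  "(\<Sum>k\<in>K. (\<mu> k)\<^sup>2 * (\<theta> k \<bullet> temperature_rhs \<alpha> K v \<theta> k)) = - tri K \<mu> (LamV (- 2 * \<alpha>) v) (emb \<theta>)"
  unfolding inner_temperature_rhs tri_def by (simp add: sum_negf)

lemma velocity_rhs_le:
  assumes "\<alpha> + \<beta> = 5/4" "0 < \<beta>" "\<beta> < 5/4" "0 \<le> p" and \<nu>: "0 < \<nu>"
  obtains C where "0 < C" "\<And>K \<mu> v \<theta>. \<lbrakk>finite K; 0 \<notin> K; admissible p \<mu>; solenoidal v; \<And>k. k \<notin> K \<Longrightarrow> v k = 0\<rbrakk> \<Longrightarrow>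
    2 * (\<Sum>k\<in>K. (\<mu> k)\<^sup>2 * (v k \<bullet> velocity_rhs \<nu> \<alpha> \<beta> K v \<theta> k)) + \<nu> * (nrm K (\<lambda>k. \<mu> k * kabs k powr \<beta>) v)\<^sup>2
    \<le> C * (nrm K (\<lambda>k. \<mu> k * kabs k powr (- \<beta>)) (emb \<theta>))\<^sup>2
      + C * (nrm K (\<lambda>k. kabs k powr \<beta>) v)\<^sup>2 * (nrm K \<mu> v)\<^sup>2"
proof -
  obtain C1 where C1: "0 < C1" "\<And>K \<mu> v. \<lbrakk>finite K; 0 \<notin> K; admissible p \<mu>; solenoidal v; \<And>k. k \<notin> K \<Longrightarrow> v k = 0\<rbrakk> \<Longrightarrow>
    \<bar>tri K \<mu> (LamV (- 2 * \<alpha>) v) v\<bar> \<le>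
      C1 * nrm K (\<lambda>k. kabs k powr \<beta>) v * nrm K (\<lambda>k. \<mu> k * kabs k powr \<beta>) v * nrm K \<mu> v"
    using tri_velocity_le[OF assms(1-4)] by blast
  \<comment> \<open>Doubling the rate yields dissipation with factor \<open>2 * \<nu>\<close>. Two
    Young inequalities spend \<open>\<nu> / 2\<close> each, with remainders \<open>2 / \<nu>\<close>
    from buoyancy and \<open>2 / \<nu>\<close> times the square of \<open>C1\<close> from
    convection; a full \<open>\<nu>\<close> is retained.\<close>
  define C where "C = (2 + 2 * C1\<^sup>2) / \<nu>"
  show ?thesis
  proof (rule that[of C])
    show "0 < C" using \<nu> by (simp add: C_def add_pos_nonneg)
    fix K :: "wv set" and \<mu> :: "wv \<Rightarrow> real" and v :: vfield and \<theta> :: sfield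
    assume K: "finite K" "0 \<notin> K" and adm: "admissible p \<mu>" and sol: "solenoidal v" and v: "\<And>k. k \<notin> K \<Longrightarrow> v k = 0"
    define d where "d = nrm K (\<lambda>k. \<mu> k * kabs k powr \<beta>) v"
    define b where "b = nrm K (\<lambda>k. \<mu> k * kabs k powr (- \<beta>)) (emb \<theta>)"
    define a where "a = nrm K (\<lambda>k. kabs k powr \<beta>) v"
    define f where "f = nrm K \<mu> v"
    have 1: "buoyancy_work K \<mu> v \<theta> \<le> d * b"
      unfolding d_def b_def by (rule buoyancy_work_le[OF K(2)])
    have 2: "- tri K \<mu> (LamV (- 2 * \<alpha>) v) v \<le> C1 * a * d * f"
    proof -
      have "\<bar>tri K \<mu> (LamV (- 2 * \<alpha>) v) v\<bar> \<le> C1 * a * d * f"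
        unfolding a_def d_def f_def by (rule C1(2)[OF K adm sol]) (rule v)
      then show "- tri K \<mu> (LamV (- 2 * \<alpha>) v) v \<le> C1 * a * d * f" by linarith
    qed
    have 3: "2 * (d * b) \<le> (\<nu> / 2) * d\<^sup>2 + b\<^sup>2 / (\<nu> / 2)"
      by (rule young_le) (use \<nu> in simp)
    have 4: "2 * (d * (C1 * a * f)) \<le> (\<nu> / 2) * d\<^sup>2 + (C1 * a * f)\<^sup>2 / (\<nu> / 2)"
      by (rule young_le) (use \<nu> in simp)
    have 5: "b\<^sup>2 / (\<nu> / 2) \<le> C * b\<^sup>2"
      using \<nu> by (simp add: C_def divide_right_mono mult_right_mono mult.commute[of "b\<^sup>2"])
    have "(C1 * a * f)\<^sup>2 / (\<nu> / 2) = (2 * C1\<^sup>2 / \<nu>) * (a\<^sup>2 * f\<^sup>2)"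
      by (simp add: power_mult_distrib)
    also have "\<dots> \<le> C * (a\<^sup>2 * f\<^sup>2)"
      using \<nu> by (intro mult_right_mono) (auto simp: C_def divide_right_mono)
    finally have 6: "(C1 * a * f)\<^sup>2 / (\<nu> / 2) \<le> C * a\<^sup>2 * f\<^sup>2" by simp
    have "2 * (buoyancy_work K \<mu> v \<theta> - tri K \<mu> (LamV (- 2 * \<alpha>) v) v - \<nu> * d\<^sup>2) + \<nu> * d\<^sup>2
      \<le> 2 * (d * b) + 2 * (d * (C1 * a * f)) - \<nu> * d\<^sup>2"
      using 1 2 by (simp add: mult_ac)
    also have "\<dots> \<le> b\<^sup>2 / (\<nu> / 2) + (C1 * a * f)\<^sup>2 / (\<nu> / 2)"
      using 3 4 by (simp add: field_simps)
    also have "\<dots> \<le> C * b\<^sup>2 + C * a\<^sup>2 * f\<^sup>2" using 5 6 by linarith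
    finally show "2 * (\<Sum>k\<in>K. (\<mu> k)\<^sup>2 * (v k \<bullet> velocity_rhs \<nu> \<alpha> \<beta> K v \<theta> k)) + \<nu> * (nrm K (\<lambda>k. \<mu> k * kabs k powr \<beta>) v)\<^sup>2
      \<le> C * (nrm K (\<lambda>k. \<mu> k * kabs k powr (- \<beta>)) (emb \<theta>))\<^sup>2 + C * (nrm K (\<lambda>k. kabs k powr \<beta>) v)\<^sup>2 * (nrm K \<mu> v)\<^sup>2"
      unfolding weighted_velocity_rhs[OF sol] a_def b_def d_def f_def .
  qed
qed

text \<open>The l^1 Fourier norm of the gradient of the advecting velocity, with
  \<open>u = LamV (- 2 * \<alpha>) v\<close> expressed through \<open>v\<close>.\<close>

definition wiener :: "real \<Rightarrow> wv set \<Rightarrow> vfield \<Rightarrow> real" where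
  "wiener \<alpha> K v = (\<Sum>k\<in>K. kabs k powr (1 - 2 * \<alpha>) * norm (v k))"

lemma wiener_nonneg [simp]: "0 \<le> wiener \<alpha> K v"
  by (simp add: wiener_def sum_nonneg)

lemma temperature_rhs_le:
  assumes "\<alpha> + \<beta> = 5/4" "0 \<le> p"
  obtains C where "0 < C" "\<And>K \<mu> v \<theta>. \<lbrakk>finite K; 0 \<notin> K; admissible p \<mu>; solenoidal v; \<And>k. k \<notin> K \<Longrightarrow> v k = 0\<rbrakk> \<Longrightarrow>
    2 * (\<Sum>k\<in>K. (\<mu> k)\<^sup>2 * (\<theta> k \<bullet> temperature_rhs \<alpha> K v \<theta> k)) \<le>
      C * wiener \<alpha> K v * (nrm K \<mu> (emb \<theta>))\<^sup>2
      + C * nrm K (\<lambda>k. \<mu> k * kabs k powr (2 * \<beta>)) v * nrm K (\<lambda>k. 1) (emb \<theta>) * nrm K \<mu> (emb \<theta>)"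
proof -
  obtain C where C: "0 < C" "\<And>K \<mu> u v. \<lbrakk>finite K; 0 \<notin> K; admissible p \<mu>; solenoidal u; \<And>k. k \<notin> K \<Longrightarrow> u k = 0\<rbrakk> \<Longrightarrow>
    \<bar>tri K \<mu> u v\<bar> \<le> C * ((\<Sum>j\<in>K. kabs j * norm (u j)) * (nrm K \<mu> v)\<^sup>2
      + nrm K (\<lambda>k. \<mu> k * kabs k powr (5/2)) u * nrm K (\<lambda>k. 1) v * nrm K \<mu> v)"
    using tri_transport_le[OF assms(2)] by blast
  have e: "5/2 + - 2 * \<alpha> = 2 * \<beta>" using assms by simp
  show ?thesis
  proof (rule that[of "2 * C"])
    show "0 < 2 * C" using C by simp
    fix K :: "wv set" and \<mu> :: "wv \<Rightarrow> real" and v :: vfield and \<theta> :: sfield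
    assume K: "finite K" "0 \<notin> K" and adm: "admissible p \<mu>" and sol: "solenoidal v" and v: "\<And>k. k \<notin> K \<Longrightarrow> v k = 0"
    let ?u = "LamV (- 2 * \<alpha>) v"
    have u: "\<And>k. k \<notin> K \<Longrightarrow> ?u k = 0" by (simp add: LamV_def v)
    have "(\<Sum>j\<in>K. kabs j * norm (?u j)) = wiener \<alpha> K v"
      unfolding wiener_def
    proof (rule sum.cong[OF refl])
      fix k assume "k \<in> K"
      then have "0 < kabs k" using K kabs_pos by metis
      then have "kabs k * kabs k powr (- 2 * \<alpha>) = kabs k powr (1 - 2 * \<alpha>)"
        using powr_add[of "kabs k" 1 "- 2 * \<alpha>"] by simp
      then show "kabs k * norm (?u k) = kabs k powr (1 - 2 * \<alpha>) * norm (v k)"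
        by (simp add: LamV_def flip: mult.assoc)
    qed
    moreover have "nrm K (\<lambda>k. \<mu> k * kabs k powr (5/2)) ?u = nrm K (\<lambda>k. \<mu> k * kabs k powr (2 * \<beta>)) v"
      using nrm_LamV[of K \<mu> "5/2" "- 2 * \<alpha>" v] unfolding e .
    moreover have "\<bar>tri K \<mu> ?u (emb \<theta>)\<bar> \<le> C * ((\<Sum>j\<in>K. kabs j * norm (?u j)) * (nrm K \<mu> (emb \<theta>))\<^sup>2
      + nrm K (\<lambda>k. \<mu> k * kabs k powr (5/2)) ?u * nrm K (\<lambda>k. 1) (emb \<theta>) * nrm K \<mu> (emb \<theta>))"
      by (rule C(2)[OF K adm solenoidal_LamV[OF sol] u])
    ultimately have "- tri K \<mu> ?u (emb \<theta>) \<le> C * (wiener \<alpha> K v * (nrm K \<mu> (emb \<theta>))\<^sup>2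
      + nrm K (\<lambda>k. \<mu> k * kabs k powr (2 * \<beta>)) v * nrm K (\<lambda>k. 1) (emb \<theta>) * nrm K \<mu> (emb \<theta>))"
      by (simp only:)
    then show "2 * (\<Sum>k\<in>K. (\<mu> k)\<^sup>2 * (\<theta> k \<bullet> temperature_rhs \<alpha> K v \<theta> k)) \<le>
      2 * C * wiener \<alpha> K v * (nrm K \<mu> (emb \<theta>))\<^sup>2
      + 2 * C * nrm K (\<lambda>k. \<mu> k * kabs k powr (2 * \<beta>)) v * nrm K (\<lambda>k. 1) (emb \<theta>) * nrm K \<mu> (emb \<theta>)"
      unfolding weighted_temperature_rhs by (simp add: algebra_simps)
  qed
qed

section \<open>Control of the l^1 gradient norm\<close>

lemma wiener_part_le:
  assumes "finite F" "0 \<notin> F" "F \<subseteq> K" "finite K" "(\<Sum>k\<in>F. kabs k powr (2 * q)) \<le> B"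
  shows "(\<Sum>k\<in>F. kabs k powr (q + s) * norm (v k)) \<le> sqrt B * nrm K (\<lambda>k. kabs k powr s) v"
proof -
  have "(\<Sum>k\<in>F. kabs k powr (q + s) * norm (v k)) = (\<Sum>k\<in>F. kabs k powr q * (kabs k powr s * norm (v k)))"
    by (simp add: powr_add mult_ac)
  also have "\<dots> \<le> L2_set (\<lambda>k. kabs k powr q) F * L2_set (\<lambda>k. kabs k powr s * norm (v k)) F"
    by (rule sum_mult_le_L2_set)
  also have "\<dots> \<le> sqrt B * nrm K (\<lambda>k. kabs k powr s) v"
  proof (intro mult_mono)
    show "L2_set (\<lambda>k. kabs k powr q) F \<le> sqrt B"
      unfolding L2_set_def powr_square by (rule real_sqrt_le_mono) (rule assms)
    show "L2_set (\<lambda>k. kabs k powr s * norm (v k)) F \<le> nrm K (\<lambda>k. kabs k powr s) v"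
      unfolding nrm_def L2_set_def using assms by (intro real_sqrt_le_mono sum_mono2) auto
    have "0 \<le> B" using assms(5) by (rule order_trans[rotated]) (simp add: sum_nonneg)
    then show "0 \<le> sqrt B" by simp
  qed (simp add: L2_set_nonneg)
  finally show ?thesis .
qed

lemma wiener_le:
  assumes "\<alpha> + \<beta> = 5/4" "2 * \<beta> < r"
  obtains C where "0 < C" "\<And>K v. \<lbrakk>finite K; 0 \<notin> K\<rbrakk> \<Longrightarrow> wiener \<alpha> K v \<le> C * nrm K (\<lambda>k. kabs k powr r) v"
proof -
  \<comment> \<open>Since \<open>1 - 2 * \<alpha> = 2 * \<beta> - 3/2\<close>, the exponent
    \<open>2 * q\<close> equals \<open>2 * (2 * \<beta> - r) - 3\<close>, which lies below
    -3.\<close>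
  define q where "q = 1 - 2 * \<alpha> - r"
  obtain B where B: "0 < B" "\<And>F. \<lbrakk>finite F; 0 \<notin> F\<rbrakk> \<Longrightarrow> (\<Sum>k\<in>F. kabs k powr (2 * q)) \<le> B"
    by (rule lattice_sum_bounded[of "2 * q"]) (use assms in \<open>auto simp: q_def\<close>)
  show ?thesis
  proof (rule that[of "sqrt B"])
    fix K :: "wv set" and v :: vfield assume K: "finite K" "0 \<notin> K"
    show "wiener \<alpha> K v \<le> sqrt B * nrm K (\<lambda>k. kabs k powr r) v"
      using wiener_part_le[OF K order_refl K(1) B(2)[OF K], of r v] by (simp add: wiener_def q_def)
  qed (use B in simp)
qed

text \<open>A Brezis--Gallouet type inequality: the critical norm controls the low frequencies up to a
  logarithm, and the cut-off is placed where the subcritical norm makes the high frequencies small.\<close>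

lemma wiener_log_le:
  assumes "\<alpha> + \<beta> = 5/4" "2 * \<beta> < r"
  obtains C where "0 < C" "\<And>K v X. \<lbrakk>finite K; 0 \<notin> K; (nrm K (\<lambda>k. kabs k powr r) v)\<^sup>2 \<le> X\<rbrakk> \<Longrightarrow>
    wiener \<alpha> K v \<le> C * ((1 + ln (1 + X)) * (1 + (nrm K (\<lambda>k. kabs k powr (2 * \<beta>)) v)\<^sup>2))"
proof -
  \<comment> \<open>Half the gap between \<open>2 * \<beta>\<close> and \<open>r\<close>. One half
    makes the high-frequency sum converge, as \<open>2 * q = - 3 - 2 * \<delta>\<close>; the other
    half yields the decay \<open>R powr (- \<delta>)\<close>.\<close>
  define \<delta> where "\<delta> = (r - 2 * \<beta>) / 2"
  have \<delta>: "0 < \<delta>" using assms by (simp add: \<delta>_def)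
  define q where "q = 1 - 2 * \<alpha> - r + \<delta>"
  obtain B where B: "0 < B" "\<And>F. \<lbrakk>finite F; 0 \<notin> F\<rbrakk> \<Longrightarrow> (\<Sum>k\<in>F. kabs k powr (2 * q)) \<le> B"
    by (rule lattice_sum_bounded[of "2 * q"]) (use assms in \<open>auto simp: q_def \<delta>_def field_simps\<close>)
  obtain A where A: "0 < A" "\<And>F R. \<lbrakk>finite F; \<And>k. k \<in> F \<Longrightarrow> k \<noteq> 0 \<and> kabs k \<le> R; 1 \<le> R\<rbrakk>
    \<Longrightarrow> (\<Sum>k\<in>F. kabs k powr (-3)) \<le> A * (1 + ln R)"
    using lattice_sum_log by blast
  define C where "C = 1 + A + A / (2 * \<delta>) + sqrt B"
  show ?thesis
  proof (rule that[of C])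
    show "0 < C" unfolding C_def using A B \<delta> by (simp add: add_pos_nonneg)
    fix K :: "wv set" and v :: vfield and X
    assume K: "finite K" "0 \<notin> K" and X: "(nrm K (\<lambda>k. kabs k powr r) v)\<^sup>2 \<le> X"
    define y where "y = nrm K (\<lambda>k. kabs k powr (2 * \<beta>)) v"
    define Z where "Z = ln (1 + X)"
    have X0: "0 \<le> X" using X by (rule order_trans[rotated]) simp
    have Z0: "0 \<le> Z" using X0 by (simp add: Z_def)
    \<comment> \<open>Chosen so that \<open>R powr \<delta> = sqrt (1 + X)\<close> compensates the
      norm of order \<open>r\<close>, while \<open>ln R\<close> is a constant multiple of
      \<open>ln (1 + X)\<close>.\<close>
    define R where "R = (1 + X) powr (1 / (2 * \<delta>))"
    have R: "1 \<le> R" unfolding R_def using X0 \<delta> by (intro ge_one_powr_ge_zero) auto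
    have lnR: "ln R = Z / (2 * \<delta>)" using X0 by (simp add: R_def Z_def ln_powr)
    have "R powr \<delta> = (1 + X) powr (1/2)" using \<delta> by (simp add: R_def powr_powr)
    then have R\<delta>: "R powr \<delta> = sqrt (1 + X)" using X0 by (simp add: powr_half_sqrt)
    let ?L = "{k \<in> K. kabs k \<le> R}" and ?H = "{k \<in> K. \<not> kabs k \<le> R}"
    have "wiener \<alpha> K v = (\<Sum>k\<in>?L. kabs k powr (1 - 2 * \<alpha>) * norm (v k)) + (\<Sum>k\<in>?H. kabs k powr (1 - 2 * \<alpha>) * norm (v k))"
      unfolding wiener_def using K by (subst sum.union_disjoint[symmetric]) (auto intro: sum.cong)
    moreover have "(\<Sum>k\<in>?L. kabs k powr (1 - 2 * \<alpha>) * norm (v k)) \<le> sqrt (A * (1 + ln R)) * y"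
    proof -
      have "(\<Sum>k\<in>?L. kabs k powr (2 * (-3/2))) \<le> A * (1 + ln R)"
      proof -
        have e: "2 * (-3/2) = (-3::real)" by simp
        show "(\<Sum>k\<in>?L. kabs k powr (2 * (-3/2))) \<le> A * (1 + ln R)"
          unfolding e by (rule A(2)) (use K R in auto)
      qed
      then have "(\<Sum>k\<in>?L. kabs k powr (- 3/2 + 2 * \<beta>) * norm (v k)) \<le> sqrt (A * (1 + ln R)) * y"
        unfolding y_def by (intro wiener_part_le) (use K in auto)
      moreover have "- 3/2 + 2 * \<beta> = 1 - 2 * \<alpha>" using assms by simp
      ultimately show ?thesis by (simp only:)
    qed
    moreover have "(\<Sum>k\<in>?H. kabs k powr (1 - 2 * \<alpha>) * norm (v k)) \<le> sqrt B"
    proof -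
      have "(\<Sum>k\<in>?H. kabs k powr (1 - 2 * \<alpha>) * norm (v k)) \<le> (\<Sum>k\<in>?H. R powr (- \<delta>) * (kabs k powr (q + r) * norm (v k)))"
      proof (rule sum_mono)
        fix k assume "k \<in> ?H"
        then have k: "R \<le> kabs k" by auto
        have "kabs k powr (1 - 2 * \<alpha>) = kabs k powr (- \<delta>) * kabs k powr (q + r)"
          by (simp add: q_def flip: powr_add)
        also have "\<dots> \<le> R powr (- \<delta>) * kabs k powr (q + r)"
          using k R \<delta> by (intro mult_right_mono powr_mono2') auto
        finally show "kabs k powr (1 - 2 * \<alpha>) * norm (v k) \<le> R powr (- \<delta>) * (kabs k powr (q + r) * norm (v k))"
          by (simp add: mult_right_mono flip: mult.assoc)
      qed
      also have "\<dots> = R powr (- \<delta>) * (\<Sum>k\<in>?H. kabs k powr (q + r) * norm (v k))"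
        by (simp add: sum_distrib_left)
      also have "\<dots> \<le> R powr (- \<delta>) * (sqrt B * nrm K (\<lambda>k. kabs k powr r) v)"
        using K by (intro mult_left_mono wiener_part_le B) auto
      also have "\<dots> \<le> R powr (- \<delta>) * (sqrt B * R powr \<delta>)"
      proof (intro mult_left_mono)
        show "nrm K (\<lambda>k. kabs k powr r) v \<le> R powr \<delta>"
          unfolding R\<delta> using X by (intro real_le_rsqrt) simp
      qed (use B in auto)
      also have "\<dots> = sqrt B" using R by (simp add: powr_minus)
      finally show ?thesis .
    qed
    ultimately have "wiener \<alpha> K v \<le> sqrt (A * (1 + ln R)) * y + sqrt B" by linarith
    also have "\<dots> \<le> (1 + A + A / (2 * \<delta>)) * (1 + Z) * (1 + y\<^sup>2) + sqrt B * ((1 + Z) * (1 + y\<^sup>2))"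
    proof (intro add_mono mult_mono)
      have AR: "0 \<le> A * (1 + ln R)" using A R by simp
      have "sqrt x \<le> 1 + x" if "0 \<le> x" for x :: real
        using that by (intro real_le_lsqrt) (auto simp: power2_eq_square algebra_simps)
      then have "sqrt (A * (1 + ln R)) \<le> 1 + A * (1 + ln R)" using AR by blast
      also have "\<dots> = 1 + A + A / (2 * \<delta>) * Z" by (simp add: lnR algebra_simps)
      also have "\<dots> \<le> (1 + A + A / (2 * \<delta>)) * (1 + Z)"
      proof -
        have "1 + A + b * Z \<le> (1 + A + b) * (1 + Z)" if "0 \<le> b" for b
          using that A(1) Z0 mult_nonneg_nonneg[of A Z] by (simp add: algebra_simps)
        from this[of "A / (2 * \<delta>)"] show "1 + A + A / (2 * \<delta>) * Z \<le> (1 + A + A / (2 * \<delta>)) * (1 + Z)"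
          using A(1) \<delta> by (auto simp: divide_nonneg_pos simp del: times_divide_eq_left)
      qed
      finally show "sqrt (A * (1 + ln R)) \<le> (1 + A + A / (2 * \<delta>)) * (1 + Z)" .
      have "0 \<le> (y - 1)\<^sup>2" by simp
      then have "2 * y \<le> 1 + y\<^sup>2" by (simp add: power2_eq_square algebra_simps)
      then show "y \<le> 1 + y\<^sup>2" using zero_le_power2[of y] by linarith
      show "0 \<le> (1 + A + A / (2 * \<delta>)) * (1 + Z)" using A \<delta> Z0 by simp
      have "1 * 1 \<le> (1 + Z) * (1 + y\<^sup>2)" using Z0 by (intro mult_mono) auto
      then show "sqrt B \<le> sqrt B * ((1 + Z) * (1 + y\<^sup>2))"
        using B mult_left_mono[of 1 "(1 + Z) * (1 + y\<^sup>2)" "sqrt B"] by simp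
    qed (simp add: y_def)
    also have "\<dots> = C * ((1 + Z) * (1 + y\<^sup>2))"
      by (simp only: C_def mult.assoc distrib_right[of "1 + A + A / (2 * \<delta>)" "sqrt B"])
    finally show "wiener \<alpha> K v \<le> C * ((1 + ln (1 + X)) * (1 + (nrm K (\<lambda>k. kabs k powr (2 * \<beta>)) v)\<^sup>2))"
      by (simp add: Z_def y_def)
  qed
qed

text \<open>The transport estimate at order \<open>r - \<beta>\<close> asks for \<open>v\<close> at
  order \<open>r - \<beta> + 2 * \<beta>\<close>, precisely the order of the dissipation, which
  absorbs it. What remains is linear in the weighted quantity, and its coefficient involves only
  norms without \<open>R\<close>.\<close>

lemma growth_rate_le:
  assumes ab: "\<alpha> + \<beta> = 5/4" "0 < \<beta>" "\<beta> < 5/4" and r: "\<beta> \<le> r" and \<nu>: "0 < \<nu>"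
  obtains C where "0 < C" "\<And>K R v \<theta>. \<lbrakk>finite K; 0 \<notin> K; 1 \<le> R; solenoidal v; \<And>k. k \<notin> K \<Longrightarrow> v k = 0\<rbrakk> \<Longrightarrow>
    2 * (\<Sum>k\<in>K. (wgt r R k)\<^sup>2 * (v k \<bullet> velocity_rhs \<nu> \<alpha> \<beta> K v \<theta> k))
    + 2 * (\<Sum>k\<in>K. (wgt (r - \<beta>) R k)\<^sup>2 * (\<theta> k \<bullet> temperature_rhs \<alpha> K v \<theta> k))
    + \<nu> / 2 * (nrm K (wgt (r + \<beta>) R) v)\<^sup>2
    \<le> C * (1 + (nrm K (\<lambda>k. kabs k powr \<beta>) v)\<^sup>2 + wiener \<alpha> K v + (nrm K (\<lambda>k. 1) (emb \<theta>))\<^sup>2)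
      * ((nrm K (wgt r R) v)\<^sup>2 + (nrm K (wgt (r - \<beta>) R) (emb \<theta>))\<^sup>2)"
proof -
  have p: "0 \<le> r + 1" "0 \<le> r - \<beta> + 1" using r ab by auto
  obtain C1 where C1: "0 < C1" "\<And>K \<mu> v \<theta>. \<lbrakk>finite K; 0 \<notin> K; admissible (r + 1) \<mu>; solenoidal v; \<And>k. k \<notin> K \<Longrightarrow> v k = 0\<rbrakk> \<Longrightarrow>
    2 * (\<Sum>k\<in>K. (\<mu> k)\<^sup>2 * (v k \<bullet> velocity_rhs \<nu> \<alpha> \<beta> K v \<theta> k)) + \<nu> * (nrm K (\<lambda>k. \<mu> k * kabs k powr \<beta>) v)\<^sup>2
    \<le> C1 * (nrm K (\<lambda>k. \<mu> k * kabs k powr (- \<beta>)) (emb \<theta>))\<^sup>2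
      + C1 * (nrm K (\<lambda>k. kabs k powr \<beta>) v)\<^sup>2 * (nrm K \<mu> v)\<^sup>2"
    using velocity_rhs_le[OF ab p(1) \<nu>] by blast
  obtain C2 where C2: "0 < C2" "\<And>K \<mu> v \<theta>. \<lbrakk>finite K; 0 \<notin> K; admissible (r - \<beta> + 1) \<mu>; solenoidal v; \<And>k. k \<notin> K \<Longrightarrow> v k = 0\<rbrakk> \<Longrightarrow>
    2 * (\<Sum>k\<in>K. (\<mu> k)\<^sup>2 * (\<theta> k \<bullet> temperature_rhs \<alpha> K v \<theta> k)) \<le>
      C2 * wiener \<alpha> K v * (nrm K \<mu> (emb \<theta>))\<^sup>2
      + C2 * nrm K (\<lambda>k. \<mu> k * kabs k powr (2 * \<beta>)) v * nrm K (\<lambda>k. 1) (emb \<theta>) * nrm K \<mu> (emb \<theta>)"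
    using temperature_rhs_le[OF ab(1) p(2)] by blast
  \<comment> \<open>The last summand is the remainder of Young's inequality that spends
    \<open>\<nu> / 2\<close> on the coupling term, written as 2 times \<open>d\<close> times
    \<open>C2 * h * g / 2\<close>.\<close>
  define C where "C = C1 + C2 + C2\<^sup>2 / (2 * \<nu>)"
  have C: "C1 \<le> C" "C2 \<le> C" "C2\<^sup>2 / (2 * \<nu>) \<le> C" "0 < C"
    using C1(1) C2(1) \<nu> by (auto simp: C_def add_pos_nonneg)
  show ?thesis
  proof (rule that[of C])
    show "0 < C" by fact
    fix K :: "wv set" and R :: real and v :: vfield and \<theta> :: sfield
    assume K: "finite K" "0 \<notin> K" and R: "1 \<le> R" and sol: "solenoidal v" and v: "\<And>k. k \<notin> K \<Longrightarrow> v k = 0"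
    define a where "a = nrm K (\<lambda>k. kabs k powr \<beta>) v"
    define h where "h = nrm K (\<lambda>k. 1) (emb \<theta>)"
    define f where "f = nrm K (wgt r R) v"
    define g where "g = nrm K (wgt (r - \<beta>) R) (emb \<theta>)"
    define d where "d = nrm K (wgt (r + \<beta>) R) v"
    let ?L = "wiener \<alpha> K v"
    have "admissible (r + 1) (wgt r R)" "admissible (r - \<beta> + 1) (wgt (r - \<beta>) R)"
      using r R ab by (auto intro: admissible_wgt)
    note adm = this
    have e: "(\<lambda>k. wgt r R k * kabs k powr \<beta>) = wgt (r + \<beta>) R" "(\<lambda>k. wgt r R k * kabs k powr (- \<beta>)) = wgt (r - \<beta>) R"
      "(\<lambda>k. wgt (r - \<beta>) R k * kabs k powr (2 * \<beta>)) = wgt (r + \<beta>) R"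
      by (simp_all add: wgt_mult_powr add.commute)
    have 1: "2 * (\<Sum>k\<in>K. (wgt r R k)\<^sup>2 * (v k \<bullet> velocity_rhs \<nu> \<alpha> \<beta> K v \<theta> k)) + \<nu> * d\<^sup>2 \<le> C1 * g\<^sup>2 + C1 * a\<^sup>2 * f\<^sup>2"
      using C1(2)[where \<theta> = \<theta>, OF K adm(1) sol] v unfolding e a_def d_def f_def g_def by simp
    have 2: "2 * (\<Sum>k\<in>K. (wgt (r - \<beta>) R k)\<^sup>2 * (\<theta> k \<bullet> temperature_rhs \<alpha> K v \<theta> k)) \<le> C2 * ?L * g\<^sup>2 + C2 * d * h * g"
      using C2(2)[where \<theta> = \<theta>, OF K adm(2) sol] v unfolding e d_def g_def h_def by simp
    have "2 * (d * (C2 * h * g / 2)) \<le> (\<nu> / 2) * d\<^sup>2 + (C2 * h * g / 2)\<^sup>2 / (\<nu> / 2)"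
      by (rule young_le) (use \<nu> in simp)
    also have "(C2 * h * g / 2)\<^sup>2 / (\<nu> / 2) = C2\<^sup>2 / (2 * \<nu>) * (h\<^sup>2 * g\<^sup>2)"
      using \<nu> by (simp add: power2_eq_square field_simps)
    finally have 3: "C2 * d * h * g \<le> (\<nu> / 2) * d\<^sup>2 + C2\<^sup>2 / (2 * \<nu>) * (h\<^sup>2 * g\<^sup>2)" by (simp add: mult_ac)
    have "C1 * g\<^sup>2 + C1 * a\<^sup>2 * f\<^sup>2 + C2 * ?L * g\<^sup>2 + C2\<^sup>2 / (2 * \<nu>) * (h\<^sup>2 * g\<^sup>2)
        \<le> C * g\<^sup>2 + C * a\<^sup>2 * f\<^sup>2 + C * ?L * g\<^sup>2 + C * (h\<^sup>2 * g\<^sup>2)"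
      by (intro add_mono mult_right_mono C) auto
    also have "\<dots> \<le> C * (1 + a\<^sup>2 + ?L + h\<^sup>2) * (f\<^sup>2 + g\<^sup>2)"
    proof -
      have "0 \<le> C * (f\<^sup>2 + (a\<^sup>2 * g\<^sup>2 + ?L * f\<^sup>2 + h\<^sup>2 * f\<^sup>2))" using C(4) by simp
      then show ?thesis by (simp add: algebra_simps)
    qed
    finally show "2 * (\<Sum>k\<in>K. (wgt r R k)\<^sup>2 * (v k \<bullet> velocity_rhs \<nu> \<alpha> \<beta> K v \<theta> k))
    + 2 * (\<Sum>k\<in>K. (wgt (r - \<beta>) R k)\<^sup>2 * (\<theta> k \<bullet> temperature_rhs \<alpha> K v \<theta> k))
    + \<nu> / 2 * (nrm K (wgt (r + \<beta>) R) v)\<^sup>2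
    \<le> C * (1 + (nrm K (\<lambda>k. kabs k powr \<beta>) v)\<^sup>2 + wiener \<alpha> K v + (nrm K (\<lambda>k. 1) (emb \<theta>))\<^sup>2)
      * ((nrm K (wgt r R) v)\<^sup>2 + (nrm K (wgt (r - \<beta>) R) (emb \<theta>))\<^sup>2)"
      using 1 2 3 unfolding a_def[symmetric] h_def[symmetric] f_def[symmetric] g_def[symmetric] d_def[symmetric]
      by linarith
  qed
qed

section \<open>A priori bounds\<close>

lemma galerkinD:
  assumes "galerkin \<nu> \<alpha> \<beta> T K v \<theta>" "t \<in> {0..T}"
  shows "solenoidal (v t)" "\<theta> t (- k) = cnj (\<theta> t k)" "k \<notin> K \<Longrightarrow> v t k = 0" "k \<notin> K \<Longrightarrow> \<theta> t k = 0"
    "k \<in> K \<Longrightarrow> ((\<lambda>s. v s k) has_vector_derivative velocity_rhs \<nu> \<alpha> \<beta> K (v t) (\<theta> t) k) (at t within {0..T})"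
    "k \<in> K \<Longrightarrow> ((\<lambda>s. \<theta> s k) has_vector_derivative temperature_rhs \<alpha> K (v t) (\<theta> t) k) (at t within {0..T})"
  using assms by (auto simp: galerkin_def)

lemma galerkin_continuous:
  assumes G: "galerkin \<nu> \<alpha> \<beta> T K v \<theta>"
  shows "continuous_on {0..T} (\<lambda>s. v s k)" "continuous_on {0..T} (\<lambda>s. \<theta> s k)"
proof -
  show "continuous_on {0..T} (\<lambda>s. v s k)"
  proof (cases "k \<in> K")
    case True
    then show ?thesis
      using galerkinD(5)[OF G] has_vector_derivative_continuous continuous_on_eq_continuous_within by metis
  next
    case False
    then have "continuous_on {0..T} (\<lambda>s. v s k) \<longleftrightarrow> continuous_on {0..T} (\<lambda>s. 0 :: complex ^ 3)"
      by (intro continuous_on_cong galerkinD(3)[OF G]) auto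
    then show ?thesis by simp
  qed
  show "continuous_on {0..T} (\<lambda>s. \<theta> s k)"
  proof (cases "k \<in> K")
    case True
    then show ?thesis
      using galerkinD(6)[OF G] has_vector_derivative_continuous continuous_on_eq_continuous_within by metis
  next
    case False
    then have "continuous_on {0..T} (\<lambda>s. \<theta> s k) \<longleftrightarrow> continuous_on {0..T} (\<lambda>s. 0 :: complex)"
      by (intro continuous_on_cong galerkinD(4)[OF G]) auto
    then show ?thesis by simp
  qed
qed

lemma galerkin_continuous_nrm:
  assumes G: "galerkin \<nu> \<alpha> \<beta> T K v \<theta>"
  shows "continuous_on {0..T} (\<lambda>s. nrm K \<mu> (v s))"
  unfolding nrm_def L2_set_def by (intro continuous_intros galerkin_continuous[OF G])

lemma galerkin_deriv:
  assumes G: "galerkin \<nu> \<alpha> \<beta> T K v \<theta>" and t: "t \<in> {0..T}"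
  shows "((\<lambda>s. (nrm K \<mu> (v s))\<^sup>2) has_real_derivative
      2 * (\<Sum>k\<in>K. (\<mu> k)\<^sup>2 * (v t k \<bullet> velocity_rhs \<nu> \<alpha> \<beta> K (v t) (\<theta> t) k))) (at t within {0..T})"
    and "((\<lambda>s. (nrm K \<mu> (emb (\<theta> s)))\<^sup>2) has_real_derivative
      2 * (\<Sum>k\<in>K. (\<mu> k)\<^sup>2 * (\<theta> t k \<bullet> temperature_rhs \<alpha> K (v t) (\<theta> t) k))) (at t within {0..T})"
proof -
  have "((\<lambda>s. \<Sum>k\<in>K. (\<mu> k)\<^sup>2 * (norm (v s k))\<^sup>2) has_real_derivative
      (\<Sum>k\<in>K. (\<mu> k)\<^sup>2 * (2 * (v t k \<bullet> velocity_rhs \<nu> \<alpha> \<beta> K (v t) (\<theta> t) k)))) (at t within {0..T})"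
    by (intro DERIV_sum DERIV_cmult has_vector_derivative_norm_power2 galerkinD(5)[OF G t])
  then show "((\<lambda>s. (nrm K \<mu> (v s))\<^sup>2) has_real_derivative
      2 * (\<Sum>k\<in>K. (\<mu> k)\<^sup>2 * (v t k \<bullet> velocity_rhs \<nu> \<alpha> \<beta> K (v t) (\<theta> t) k))) (at t within {0..T})"
    by (simp add: nrm_power2 sum_distrib_left mult_ac)
  have "((\<lambda>s. \<Sum>k\<in>K. (\<mu> k)\<^sup>2 * (norm (\<theta> s k))\<^sup>2) has_real_derivative
      (\<Sum>k\<in>K. (\<mu> k)\<^sup>2 * (2 * (\<theta> t k \<bullet> temperature_rhs \<alpha> K (v t) (\<theta> t) k)))) (at t within {0..T})"
    by (intro DERIV_sum DERIV_cmult has_vector_derivative_norm_power2 galerkinD(6)[OF G t])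
  then show "((\<lambda>s. (nrm K \<mu> (emb (\<theta> s)))\<^sup>2) has_real_derivative
      2 * (\<Sum>k\<in>K. (\<mu> k)\<^sup>2 * (\<theta> t k \<bullet> temperature_rhs \<alpha> K (v t) (\<theta> t) k))) (at t within {0..T})"
    by (simp add: nrm_power2 sum_distrib_left mult_ac)
qed

lemma galerkin_temperature_conserved:
  assumes G: "galerkin \<nu> \<alpha> \<beta> T K v \<theta>" and t: "t \<in> {0..T}"
  shows "(nrm K (\<lambda>k. 1) (emb (\<theta> t)))\<^sup>2 = (nrm K (\<lambda>k. 1) (emb (\<theta> 0)))\<^sup>2"
proof (rule vector_derivative_zero_constant[OF _ t])
  fix s assume s: "s \<in> {0..T}"
  show "((\<lambda>s. (nrm K (\<lambda>k. 1) (emb (\<theta> s)))\<^sup>2) has_vector_derivative 0) (at s within {0..T})"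
    using galerkin_deriv(2)[OF G s, of "\<lambda>k. 1"]
    unfolding weighted_temperature_rhs tri_one[OF solenoidal_LamV[OF galerkinD(1)[OF G s]]]
    by (simp add: has_real_derivative_iff_has_vector_derivative)
qed

lemma nrm_powr_mono:
  assumes "0 \<notin> K" "s \<le> q"
  shows "nrm K (\<lambda>k. kabs k powr s) v \<le> nrm K (\<lambda>k. kabs k powr q) v"
proof (rule nrm_mono)
  fix k assume "k \<in> K"
  then have "1 \<le> kabs k" using assms kabs_ge_1 by metis
  then show "0 \<le> kabs k powr s \<and> kabs k powr s \<le> kabs k powr q"
    using assms by (simp add: powr_mono)
qed

lemma nrm_one: "0 \<notin> K \<Longrightarrow> nrm K (\<lambda>k. 1) v = nrm K (\<lambda>k. kabs k powr 0) v"
  by (rule nrm_cong) (auto simp: kabs_eq_0_iff)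

text \<open>The growth coefficient in \<open>gronwall\<close> is 0 here: the L^2 norm of
  \<open>\<theta>\<close> is constant and the dissipation absorbs the velocity factor of the
  buoyancy, so the bound is linear in \<open>T\<close>.\<close>

lemma galerkin_energy:
  assumes G: "galerkin \<nu> \<alpha> \<beta> T K v \<theta>" and K: "finite K" "0 \<notin> K" and \<nu>: "0 < \<nu>" and \<beta>: "0 \<le> \<beta>"
    and T: "0 \<le> T"
    and M: "(nrm K (\<lambda>k. 1) (v 0))\<^sup>2 \<le> M" "(nrm K (\<lambda>k. 1) (emb (\<theta> 0)))\<^sup>2 \<le> M"
  shows "integral {0..T} (\<lambda>s. (nrm K (\<lambda>k. kabs k powr \<beta>) (v s))\<^sup>2) \<le> (M + T * (M / \<nu>)) / \<nu>"
proof -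
  let ?a = "\<lambda>s. nrm K (\<lambda>k. kabs k powr \<beta>) (v s)"
  let ?F = "\<lambda>s. 2 * (\<Sum>k\<in>K. 1\<^sup>2 * (v s k \<bullet> velocity_rhs \<nu> \<alpha> \<beta> K (v s) (\<theta> s) k))"
  have M0: "0 \<le> M" using M(1) by (rule order_trans[rotated]) simp
  have Tin: "T \<in> {0..T}" using T by simp
  have "(nrm K (\<lambda>k. 1) (v T))\<^sup>2 + integral {0..T} (\<lambda>s. \<nu> * (?a s)\<^sup>2)
      \<le> ((nrm K (\<lambda>k. 1) (v 0))\<^sup>2 + integral {0..T} (\<lambda>s. M / \<nu>)) * exp (integral {0..T} (\<lambda>s. 0))"
  proof (rule gronwall[where f = "\<lambda>s. (nrm K (\<lambda>k. 1) (v s))\<^sup>2" and f' = ?F, OF _ _ _ _ _ _ _ _ _ Tin])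
    fix s assume s: "s \<in> {0..T}"
    show "((\<lambda>s. (nrm K (\<lambda>k. 1) (v s))\<^sup>2) has_real_derivative ?F s) (at s within {0..T})"
      by (rule galerkin_deriv(1)[OF G s])
    have sol: "solenoidal (v s)" by (rule galerkinD(1)[OF G s])
    have "nrm K (\<lambda>k. 1 * kabs k powr (- \<beta>)) (emb (\<theta> s)) \<le> nrm K (\<lambda>k. 1) (emb (\<theta> s))"
      using nrm_powr_mono[OF K(2), of "- \<beta>" 0 "emb (\<theta> s)"] \<beta> by (simp add: nrm_one[OF K(2)])
    then have "buoyancy_work K (\<lambda>k. 1) (v s) (\<theta> s) \<le> ?a s * nrm K (\<lambda>k. 1) (emb (\<theta> s))"
      using buoyancy_work_le[OF K(2), of "\<lambda>k. 1" "v s" "\<theta> s" \<beta>] mult_left_mono[of _ _ "?a s"]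
      by (fastforce intro: order_trans)
    moreover have "2 * (?a s * nrm K (\<lambda>k. 1) (emb (\<theta> s))) \<le> \<nu> * (?a s)\<^sup>2 + (nrm K (\<lambda>k. 1) (emb (\<theta> s)))\<^sup>2 / \<nu>"
      by (rule young_le[OF \<nu>])
    moreover have "(nrm K (\<lambda>k. 1) (emb (\<theta> s)))\<^sup>2 / \<nu> \<le> M / \<nu>"
      using galerkin_temperature_conserved[OF G s] M(2) \<nu> by (simp add: divide_right_mono)
    ultimately show "?F s + \<nu> * (?a s)\<^sup>2 \<le> 0 * (nrm K (\<lambda>k. 1) (v s))\<^sup>2 + M / \<nu>"
      unfolding weighted_velocity_rhs[OF sol] tri_one[OF solenoidal_LamV[OF sol]] by simp
  qed (use \<nu> M0 in \<open>auto intro!: continuous_intros galerkin_continuous_nrm[OF G]\<close>)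
  then have "(nrm K (\<lambda>k. 1) (v T))\<^sup>2 + integral {0..T} (\<lambda>s. \<nu> * (?a s)\<^sup>2) \<le> (nrm K (\<lambda>k. 1) (v 0))\<^sup>2 + T * (M / \<nu>)"
    using T by simp
  then have "integral {0..T} (\<lambda>s. \<nu> * (?a s)\<^sup>2) \<le> M + T * (M / \<nu>)"
    using M(1) zero_le_power2[of "nrm K (\<lambda>k. 1) (v T)"] by linarith
  then show ?thesis using \<nu> by (simp add: pos_le_divide_eq mult.commute)
qed

text \<open>\<open>C\<close> is chosen before \<open>K\<close> and \<open>R\<close> and sees the
  data only through \<open>M\<close>. The bound for \<open>R = 1\<close> is closed first and makes
  the coefficient of the linear inequality constant; the conclusion is then proportional to the
  initial value for every \<open>R\<close>.\<close>

theorem galerkin_apriori: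
  assumes ab: "\<alpha> + \<beta> = 5/4" "1/2 < \<beta>" "\<beta> < 5/4" and r: "2 * \<beta> < r" and \<nu>: "0 < \<nu>" and T: "0 \<le> T" and M: "0 \<le> M"
  obtains C where "0 < C" "\<And>K v \<theta> R t. \<lbrakk>finite K; 0 \<notin> K; galerkin \<nu> \<alpha> \<beta> T K v \<theta>;
      (nrm K (wgt r 1) (v 0))\<^sup>2 + (nrm K (wgt (r - \<beta>) 1) (emb (\<theta> 0)))\<^sup>2 \<le> M; 1 \<le> R; t \<in> {0..T}\<rbrakk> \<Longrightarrow>
    (nrm K (wgt r R) (v t))\<^sup>2 + (nrm K (wgt (r - \<beta>) R) (emb (\<theta> t)))\<^sup>2
      + integral {0..t} (\<lambda>s. (nrm K (wgt (r + \<beta>) R) (v s))\<^sup>2)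
    \<le> C * ((nrm K (wgt r R) (v 0))\<^sup>2 + (nrm K (wgt (r - \<beta>) R) (emb (\<theta> 0)))\<^sup>2)"
proof -
  have \<beta>: "0 < \<beta>" "\<beta> \<le> r" "0 \<le> \<beta> + 1" using ab r by auto
  obtain C1 where C1: "0 < C1" "\<And>K \<mu> v \<theta>. \<lbrakk>finite K; 0 \<notin> K; admissible (\<beta> + 1) \<mu>; solenoidal v; \<And>k. k \<notin> K \<Longrightarrow> v k = 0\<rbrakk> \<Longrightarrow>
    2 * (\<Sum>k\<in>K. (\<mu> k)\<^sup>2 * (v k \<bullet> velocity_rhs \<nu> \<alpha> \<beta> K v \<theta> k)) + \<nu> * (nrm K (\<lambda>k. \<mu> k * kabs k powr \<beta>) v)\<^sup>2
    \<le> C1 * (nrm K (\<lambda>k. \<mu> k * kabs k powr (- \<beta>)) (emb \<theta>))\<^sup>2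
      + C1 * (nrm K (\<lambda>k. kabs k powr \<beta>) v)\<^sup>2 * (nrm K \<mu> v)\<^sup>2"
    using velocity_rhs_le[OF ab(1) \<beta>(1) ab(3) \<beta>(3) \<nu>] by blast
  obtain C2 where C2: "0 < C2" "\<And>K R v \<theta>. \<lbrakk>finite K; 0 \<notin> K; 1 \<le> R; solenoidal v; \<And>k. k \<notin> K \<Longrightarrow> v k = 0\<rbrakk> \<Longrightarrow>
    2 * (\<Sum>k\<in>K. (wgt r R k)\<^sup>2 * (v k \<bullet> velocity_rhs \<nu> \<alpha> \<beta> K v \<theta> k))
    + 2 * (\<Sum>k\<in>K. (wgt (r - \<beta>) R k)\<^sup>2 * (\<theta> k \<bullet> temperature_rhs \<alpha> K v \<theta> k))
    + \<nu> / 2 * (nrm K (wgt (r + \<beta>) R) v)\<^sup>2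
    \<le> C2 * (1 + (nrm K (\<lambda>k. kabs k powr \<beta>) v)\<^sup>2 + wiener \<alpha> K v + (nrm K (\<lambda>k. 1) (emb \<theta>))\<^sup>2)
      * ((nrm K (wgt r R) v)\<^sup>2 + (nrm K (wgt (r - \<beta>) R) (emb \<theta>))\<^sup>2)"
    using growth_rate_le[OF ab(1) \<beta>(1) ab(3) \<beta>(2) \<nu>] by blast
  obtain C3 where C3: "0 < C3" "\<And>K v. \<lbrakk>finite K; 0 \<notin> K\<rbrakk> \<Longrightarrow> wiener \<alpha> K v \<le> C3 * nrm K (\<lambda>k. kabs k powr r) v"
    using wiener_le[OF ab(1) r] by blast
  obtain C4 where C4: "0 < C4" "\<And>K v X. \<lbrakk>finite K; 0 \<notin> K; (nrm K (\<lambda>k. kabs k powr r) v)\<^sup>2 \<le> X\<rbrakk> \<Longrightarrow>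
    wiener \<alpha> K v \<le> C4 * ((1 + ln (1 + X)) * (1 + (nrm K (\<lambda>k. kabs k powr (2 * \<beta>)) v)\<^sup>2))"
    using wiener_log_le[OF ab(1) r] by blast
  \<comment> \<open>\<open>A1\<close> bounds the time integral of the squared order
    \<open>\<beta>\<close> norm of \<open>v\<close>; \<open>A2\<close> bounds that squared norm
    pointwise and \<open>\<nu>\<close> times the integral of the squared order
    \<open>2 * \<beta>\<close> norm. \<open>A3\<close> is the rate for the logarithm,
    \<open>A4\<close> bounds \<open>1 + ln (1 + X 1 s)\<close>, and \<open>A5\<close> is the final
    linear rate. In \<open>C\<close>, the 2/\<nu> comes from the retained dissipation factor
    \<open>\<nu> / 2\<close>.\<close>
  define A1 where "A1 = (M + T * (M / \<nu>)) / \<nu>"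
  define A2 where "A2 = (M + C1 * M * T) * exp (C1 * A1)"
  define A3 where "A3 = C2 * (1 + A2 + M + C4)"
  define A4 where "A4 = (1 + ln (1 + M)) * exp (A3 * (T + A2 / \<nu>))"
  define A5 where "A5 = C2 * (1 + A2 + C3 * exp A4 + M)"
  define C where "C = (1 + 2 / \<nu>) * exp (A5 * T)"
  have A: "0 \<le> A1" "0 \<le> A2" "0 \<le> A3" "0 \<le> A5"
    using M T \<nu> C1(1) C2(1) C3(1) C4(1) by (auto simp: A1_def A2_def A3_def A5_def)
  show ?thesis
  proof (rule that[of C])
    show "0 < C" using \<nu> by (simp add: C_def add_pos_pos)
    fix K v \<theta> and R t :: real
    assume K: "finite K" "0 \<notin> K" and G: "galerkin \<nu> \<alpha> \<beta> T K v \<theta>"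
      and init: "(nrm K (wgt r 1) (v 0))\<^sup>2 + (nrm K (wgt (r - \<beta>) 1) (emb (\<theta> 0)))\<^sup>2 \<le> M"
      and R: "1 \<le> R" and t: "t \<in> {0..T}"
    let ?a = "\<lambda>s. nrm K (\<lambda>k. kabs k powr \<beta>) (v s)"
    let ?y = "\<lambda>s. nrm K (\<lambda>k. kabs k powr (2 * \<beta>)) (v s)"
    let ?h = "\<lambda>s. nrm K (\<lambda>k. 1) (emb (\<theta> s))"
    let ?V = "\<lambda>s. \<lambda>k. velocity_rhs \<nu> \<alpha> \<beta> K (v s) (\<theta> s) k"
    let ?H = "\<lambda>s. \<lambda>k. temperature_rhs \<alpha> K (v s) (\<theta> s) k"
    define X where "X = (\<lambda>R s. (nrm K (wgt r R) (v s))\<^sup>2 + (nrm K (wgt (r - \<beta>) R) (emb (\<theta> s)))\<^sup>2)"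
    define X' where "X' = (\<lambda>R s. 2 * (\<Sum>k\<in>K. (wgt r R k)\<^sup>2 * (v s k \<bullet> ?V s k))
      + 2 * (\<Sum>k\<in>K. (wgt (r - \<beta>) R k)\<^sup>2 * (\<theta> s k \<bullet> ?H s k)))"
    have dX: "(X R has_real_derivative X' R s) (at s within {0..T})" if "s \<in> {0..T}" for R s
      unfolding X_def X'_def by (intro DERIV_add galerkin_deriv[OF G that])
    have X0: "0 \<le> X R s" for R s by (simp add: X_def)
    have supp: "\<And>k. k \<notin> K \<Longrightarrow> v s k = 0" if "s \<in> {0..T}" for s
      by (rule galerkinD(3)[OF G that])
    have w1: "nrm K (wgt q 1) w = nrm K (\<lambda>k. kabs k powr q) w" for q w
      by (rule nrm_cong) (use K wgt_one in metis)
    have init_le: "(nrm K (\<lambda>k. kabs k powr q) (v 0))\<^sup>2 \<le> M" if "q \<le> r" for q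
    proof -
      have "(nrm K (\<lambda>k. kabs k powr q) (v 0))\<^sup>2 \<le> (nrm K (\<lambda>k. kabs k powr r) (v 0))\<^sup>2"
        by (intro power_mono nrm_powr_mono K that nrm_nonneg)
      then show ?thesis using init unfolding w1 by (smt (verit) zero_le_power2)
    qed
    have init_\<theta>: "(?h 0)\<^sup>2 \<le> M"
    proof -
      have "(?h 0)\<^sup>2 \<le> (nrm K (\<lambda>k. kabs k powr (r - \<beta>)) (emb (\<theta> 0)))\<^sup>2"
        unfolding nrm_one[OF K(2)] using \<beta> by (intro power_mono nrm_powr_mono K nrm_nonneg) auto
      then show ?thesis using init unfolding w1 by (smt (verit) zero_le_power2)
    qed
    have h: "(?h s)\<^sup>2 \<le> M" if "s \<in> {0..T}" for s
      using galerkin_temperature_conserved[OF G that] init_\<theta> by simp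
    have I1: "integral {0..T} (\<lambda>s. (?a s)\<^sup>2) \<le> A1"
      unfolding A1_def
      by (rule galerkin_energy[OF G K \<nu> _ T]) (use \<beta> r init_le[of 0] init_\<theta> in \<open>auto simp: nrm_one[OF K(2)]\<close>)
    \<comment> \<open>At weight \<open>kabs k powr \<beta>\<close> the forcing is the conserved L^2
      norm of \<open>\<theta>\<close>, and the growth coefficient is the quantity whose integral
      \<open>I1\<close> controls.\<close>
    have I2: "(?a t)\<^sup>2 + integral {0..t} (\<lambda>s. \<nu> * (?y s)\<^sup>2) \<le> A2" if t: "t \<in> {0..T}" for t
    proof -
      let ?F = "\<lambda>s. 2 * (\<Sum>k\<in>K. (wgt \<beta> 1 k)\<^sup>2 * (v s k \<bullet> ?V s k))"
      have "(nrm K (wgt \<beta> 1) (v t))\<^sup>2 + integral {0..t} (\<lambda>s. \<nu> * (?y s)\<^sup>2)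
        \<le> ((nrm K (wgt \<beta> 1) (v 0))\<^sup>2 + integral {0..T} (\<lambda>s. C1 * M)) * exp (integral {0..T} (\<lambda>s. C1 * (?a s)\<^sup>2))"
      proof (rule gronwall[where f = "\<lambda>s. (nrm K (wgt \<beta> 1) (v s))\<^sup>2" and f' = ?F, OF _ _ _ _ _ _ _ _ _ t])
        fix s assume s: "s \<in> {0..T}"
        show "((\<lambda>s. (nrm K (wgt \<beta> 1) (v s))\<^sup>2) has_real_derivative ?F s) (at s within {0..T})"
          by (rule galerkin_deriv(1)[OF G s])
        have adm: "admissible (\<beta> + 1) (wgt \<beta> 1)" using \<beta> by (intro admissible_wgt) auto
        have e: "(\<lambda>k. wgt \<beta> 1 k * kabs k powr \<beta>) = wgt (2 * \<beta>) 1" by (simp add: wgt_mult_powr)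
        have "?F s + \<nu> * (nrm K (wgt (2 * \<beta>) 1) (v s))\<^sup>2
            \<le> C1 * (nrm K (\<lambda>k. wgt \<beta> 1 k * kabs k powr (- \<beta>)) (emb (\<theta> s)))\<^sup>2
              + C1 * (?a s)\<^sup>2 * (nrm K (wgt \<beta> 1) (v s))\<^sup>2"
          using C1(2)[where \<theta> = "\<theta> s", OF K adm galerkinD(1)[OF G s]] supp[OF s] unfolding e by simp
        also have "nrm K (\<lambda>k. wgt \<beta> 1 k * kabs k powr (- \<beta>)) (emb (\<theta> s)) = ?h s"
          unfolding wgt_mult_powr using w1[of 0 "emb (\<theta> s)"] by (simp add: nrm_one[OF K(2)])
        also have "C1 * (?h s)\<^sup>2 \<le> C1 * M" using C1(1) h[OF s] by simp
        finally show "?F s + \<nu> * (?y s)\<^sup>2 \<le> C1 * (?a s)\<^sup>2 * (nrm K (wgt \<beta> 1) (v s))\<^sup>2 + C1 * M"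
          by (simp add: w1)
      qed (use \<nu> M C1 in \<open>auto intro!: continuous_intros galerkin_continuous_nrm[OF G]\<close>)
      also have "\<dots> \<le> (M + C1 * M * T) * exp (C1 * A1)"
      proof (intro mult_mono add_mono)
        show "(nrm K (wgt \<beta> 1) (v 0))\<^sup>2 \<le> M" unfolding w1 by (rule init_le) (rule \<beta>)
        show "exp (integral {0..T} (\<lambda>s. C1 * (?a s)\<^sup>2)) \<le> exp (C1 * A1)" using C1 I1 by simp
      qed (use T M C1 in auto)
      finally show ?thesis by (simp add: w1 A2_def)
    qed
    have "0 \<le> integral {0..t} (\<lambda>s. \<nu> * (?y s)\<^sup>2)" if "t \<in> {0..T}" for t
      using \<nu> that by (intro Henstock_Kurzweil_Integration.integral_nonneg integrable_continuous_real
        continuous_on_subset[of "{0..T}" _ "{0..t}"] continuous_intros galerkin_continuous_nrm[OF G]) auto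
    then have a_le: "(?a s)\<^sup>2 \<le> A2" if "s \<in> {0..T}" for s using I2[OF that] that by fastforce
    have I3: "integral {0..T} (\<lambda>s. (?y s)\<^sup>2) \<le> A2 / \<nu>"
    proof -
      have "T \<in> {0..T}" using T by simp
      then have "integral {0..T} (\<lambda>s. \<nu> * (?y s)\<^sup>2) \<le> A2"
        using I2[of T] zero_le_power2[of "?a T"] by linarith
      then show "integral {0..T} (\<lambda>s. (?y s)\<^sup>2) \<le> A2 / \<nu>"
        using \<nu> by (simp add: pos_le_divide_eq mult.commute)
    qed
    have rate: "X' R s + \<nu> / 2 * (nrm K (wgt (r + \<beta>) R) (v s))\<^sup>2 \<le> C2 * (1 + A2 + wiener \<alpha> K (v s) + M) * X R s"
      if R: "1 \<le> R" and s: "s \<in> {0..T}" for R s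
    proof -
      have "X' R s + \<nu> / 2 * (nrm K (wgt (r + \<beta>) R) (v s))\<^sup>2 \<le> C2 * (1 + (?a s)\<^sup>2 + wiener \<alpha> K (v s) + (?h s)\<^sup>2) * X R s"
        using C2(2)[where \<theta> = "\<theta> s", OF K R galerkinD(1)[OF G s]] supp[OF s] unfolding X_def X'_def by simp
      also have "\<dots> \<le> C2 * (1 + A2 + wiener \<alpha> K (v s) + M) * X R s"
        using a_le[OF s] h[OF s] C2(1) X0 by (intro mult_right_mono mult_left_mono) auto
      finally show ?thesis .
    qed
    have X_le: "X 1 s \<le> exp A4" if s: "s \<in> {0..T}" for s
    proof -
      \<comment> \<open>The logarithmic bound gives X' at most a constant times (1 + ln(1 + X)) (1 +
        y^2) X, with y the order \<open>2 * \<beta>\<close> norm. Division by 1 + X makes this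
        linear in \<open>?Z\<close>, with a coefficient integrable by \<open>I3\<close>; the summand
        1 lets \<open>?Z \<ge> 1\<close> absorb the constants.\<close>
      let ?Z = "\<lambda>s. 1 + ln (1 + X 1 s)"
      have "?Z s + integral {0..s} (\<lambda>s. 0) \<le> (?Z 0 + integral {0..T} (\<lambda>s. 0)) * exp (integral {0..T} (\<lambda>s. A3 * (1 + (?y s)\<^sup>2)))"
      proof (rule gronwall[where f = ?Z and f' = "\<lambda>s. X' 1 s / (1 + X 1 s)", OF _ _ _ _ _ _ _ _ _ s])
        fix s assume s: "s \<in> {0..T}"
        have p: "0 < 1 + X 1 s" using X0[of 1 s] by simp
        show "(?Z has_real_derivative X' 1 s / (1 + X 1 s)) (at s within {0..T})"
          using p by (auto intro!: derivative_eq_intros dX[OF s])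
        have Z1: "1 \<le> ?Z s" using X0[of 1 s] by simp
        show "0 \<le> ?Z s" using Z1 by simp
        have W: "wiener \<alpha> K (v s) \<le> C4 * (?Z s * (1 + (?y s)\<^sup>2))"
          by (rule C4(2)[OF K]) (simp add: X_def w1)
        have "1 * 1 \<le> ?Z s * (1 + (?y s)\<^sup>2)" using Z1 by (intro mult_mono) auto
        then have "(1 + A2 + M) * 1 \<le> (1 + A2 + M) * (?Z s * (1 + (?y s)\<^sup>2))"
          using A M by (intro mult_left_mono) auto
        then have "C2 * (1 + A2 + wiener \<alpha> K (v s) + M) \<le> C2 * ((1 + A2 + M + C4) * (?Z s * (1 + (?y s)\<^sup>2)))"
          using W C2(1) by (intro mult_left_mono) (auto simp: algebra_simps)
        also have "\<dots> = A3 * (1 + (?y s)\<^sup>2) * ?Z s" by (simp add: A3_def)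
        finally have 1: "C2 * (1 + A2 + wiener \<alpha> K (v s) + M) \<le> A3 * (1 + (?y s)\<^sup>2) * ?Z s" .
        have "X' 1 s \<le> C2 * (1 + A2 + wiener \<alpha> K (v s) + M) * X 1 s"
          using rate[of 1 s] s \<nu> zero_le_power2[of "nrm K (wgt (r + \<beta>) 1) (v s)"]
          by (smt (verit) mult_nonneg_nonneg divide_nonneg_pos)
        also have "\<dots> \<le> A3 * (1 + (?y s)\<^sup>2) * ?Z s * X 1 s"
          by (rule mult_right_mono[OF 1 X0])
        also have "\<dots> \<le> A3 * (1 + (?y s)\<^sup>2) * ?Z s * (1 + X 1 s)"
        proof (rule mult_left_mono)
          show "0 \<le> A3 * (1 + (?y s)\<^sup>2) * ?Z s"
            by (rule mult_nonneg_nonneg[OF mult_nonneg_nonneg[OF A(3)] order_trans[OF zero_le_one Z1]]) simp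
        qed simp
        finally show "X' 1 s / (1 + X 1 s) + 0 \<le> A3 * (1 + (?y s)\<^sup>2) * ?Z s + 0"
          using p by (simp add: pos_divide_le_eq)
      qed (use A in \<open>auto intro!: continuous_intros galerkin_continuous_nrm[OF G]\<close>)
      also have "\<dots> \<le> A4"
        unfolding A4_def
      proof (intro mult_mono)
        show "?Z 0 + integral {0..T} (\<lambda>s. 0) \<le> 1 + ln (1 + M)"
        proof -
          have "X 1 0 \<le> M" using init by (simp only: X_def)
          then have "ln (1 + X 1 0) \<le> ln (1 + M)" using X0[of 1 0] M by (subst ln_le_cancel_iff) auto
          then show "?Z 0 + integral {0..T} (\<lambda>s. 0) \<le> 1 + ln (1 + M)" by simp
        qed
        have "integral {0..T} (\<lambda>s. 1 + (?y s)\<^sup>2) = T + integral {0..T} (\<lambda>s. (?y s)\<^sup>2)"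
          using T by (subst integral_add) (auto intro!: integrable_continuous_real continuous_intros galerkin_continuous_nrm[OF G])
        then show "exp (integral {0..T} (\<lambda>s. A3 * (1 + (?y s)\<^sup>2))) \<le> exp (A3 * (T + A2 / \<nu>))"
          using I3 A by (simp add: mult_left_mono)
      qed (use M in auto)
      finally have "ln (1 + X 1 s) \<le> A4" by simp
      then have "1 + X 1 s \<le> exp A4" using X0[of 1 s] by (simp add: ln_le_cancel_iff[symmetric] del: ln_le_cancel_iff)
      then show ?thesis by simp
    qed
    have W_le: "wiener \<alpha> K (v s) \<le> C3 * exp A4" if s: "s \<in> {0..T}" for s
    proof -
      have "(nrm K (\<lambda>k. kabs k powr r) (v s))\<^sup>2 \<le> exp A4"
        using X_le[OF s] by (simp add: X_def w1) (smt (verit) zero_le_power2)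
      also have "exp A4 \<le> (exp A4)\<^sup>2"
      proof -
        have "1 \<le> exp A4" using M by (simp add: A4_def)
        then show ?thesis using mult_left_mono[of 1 "exp A4" "exp A4"] by (simp add: power2_eq_square)
      qed
      finally have "nrm K (\<lambda>k. kabs k powr r) (v s) \<le> exp A4"
        by (rule power2_le_imp_le) simp
      then have "C3 * nrm K (\<lambda>k. kabs k powr r) (v s) \<le> C3 * exp A4"
        using C3(1) by (intro mult_left_mono) auto
      then show ?thesis using C3(2)[OF K, of "v s"] by linarith
    qed
    \<comment> \<open>With the l^1 gradient norm bounded by \<open>W_le\<close>, the rate is the
      constant \<open>A5\<close>, and Gronwall applies to each \<open>R\<close> separately.\<close>
    have "X R t + integral {0..t} (\<lambda>s. \<nu> / 2 * (nrm K (wgt (r + \<beta>) R) (v s))\<^sup>2)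
      \<le> (X R 0 + integral {0..T} (\<lambda>s. 0)) * exp (integral {0..T} (\<lambda>s. A5))"
    proof (rule gronwall[where f' = "X' R", OF dX _ _ _ _ X0 _ _ _ t])
      fix s assume s: "s \<in> {0..T}"
      have "C2 * (1 + A2 + wiener \<alpha> K (v s) + M) * X R s \<le> A5 * X R s"
        unfolding A5_def using W_le[OF s] C2(1) X0 by (intro mult_right_mono mult_left_mono) auto
      then show "X' R s + \<nu> / 2 * (nrm K (wgt (r + \<beta>) R) (v s))\<^sup>2 \<le> A5 * X R s + 0"
        using rate[OF R s] by linarith
    qed (use \<nu> A in \<open>auto intro!: continuous_intros galerkin_continuous_nrm[OF G]\<close>)
    then have I: "X R t + \<nu> / 2 * integral {0..t} (\<lambda>s. (nrm K (wgt (r + \<beta>) R) (v s))\<^sup>2) \<le> X R 0 * exp (A5 * T)"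
      using T by (simp add: mult.commute)
    define J where "J = integral {0..t} (\<lambda>s. (nrm K (wgt (r + \<beta>) R) (v s))\<^sup>2)"
    have J0: "0 \<le> J" unfolding J_def
      using t by (intro Henstock_Kurzweil_Integration.integral_nonneg integrable_continuous_real
        continuous_on_subset[of "{0..T}" _ "{0..t}"] continuous_intros galerkin_continuous_nrm[OF G]) auto
    define E where "E = X R 0 * exp (A5 * T)"
    have "0 \<le> \<nu> / 2 * J" using \<nu> J0 by simp
    then have "X R t \<le> E" "\<nu> / 2 * J \<le> E"
      using I X0[of R t] unfolding J_def[symmetric] E_def[symmetric] by linarith+
    moreover from this(2) have "J \<le> 2 / \<nu> * E" using \<nu> by (simp add: field_simps)
    ultimately have "X R t + J \<le> E + 2 / \<nu> * E" by linarith
    also have "\<dots> = C * X R 0" by (simp add: C_def E_def algebra_simps)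
    finally show "(nrm K (wgt r R) (v t))\<^sup>2 + (nrm K (wgt (r - \<beta>) R) (emb (\<theta> t)))\<^sup>2
      + integral {0..t} (\<lambda>s. (nrm K (wgt (r + \<beta>) R) (v s))\<^sup>2)
      \<le> C * ((nrm K (wgt r R) (v 0))\<^sup>2 + (nrm K (wgt (r - \<beta>) R) (emb (\<theta> 0)))\<^sup>2)"
      by (simp only: J_def X_def)
  qed
qed

section \<open>Passage to the limit\<close>

definition sobolev2 :: "real \<Rightarrow> (wv \<Rightarrow> 'a::real_normed_vector) \<Rightarrow> ennreal" where
  "sobolev2 s f = (\<Sum>\<^sub>\<infinity>k\<in>{k. k \<noteq> 0}. ennreal ((norm (f k))\<^sup>2 * kabs k powr (2 * s)))"

lemma snorm2_eq: "snorm2 s f = sobolev2 s f" and vnorm2_eq: "vnorm2 s w = sobolev2 s w"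
  by (simp_all add: snorm2_def vnorm2_def sobolev2_def)

lemma sobolev2_eq_SUP:
  "sobolev2 s f = (SUP F\<in>{F. finite F \<and> F \<subseteq> {k. k \<noteq> 0}}. ennreal (\<Sum>k\<in>F. (norm (f k))\<^sup>2 * kabs k powr (2 * s)))"
  unfolding sobolev2_def by (subst nonneg_infsum_complete) (auto simp: sum_ennreal)

lemma sobolev2_leI:
  assumes "\<And>F. \<lbrakk>finite F; 0 \<notin> F\<rbrakk> \<Longrightarrow> (\<Sum>k\<in>F. (norm (f k))\<^sup>2 * kabs k powr (2 * s)) \<le> C"
  shows "sobolev2 s f \<le> ennreal C"
  unfolding sobolev2_eq_SUP using assms by (intro SUP_least ennreal_leI) auto

lemma sobolev2_finiteD:
  assumes "sobolev2 s f < \<infinity>"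
  obtains C where "0 \<le> C" "\<And>F. \<lbrakk>finite F; 0 \<notin> F\<rbrakk> \<Longrightarrow> (\<Sum>k\<in>F. (norm (f k))\<^sup>2 * kabs k powr (2 * s)) \<le> C"
proof -
  obtain C where C: "0 \<le> C" "sobolev2 s f = ennreal C"
    using assms by (cases "sobolev2 s f") auto
  show ?thesis
  proof (rule that[OF C(1)])
    fix F :: "wv set" assume F: "finite F" "0 \<notin> F"
    then have "ennreal (\<Sum>k\<in>F. (norm (f k))\<^sup>2 * kabs k powr (2 * s)) \<le> ennreal C"
      unfolding C(2)[symmetric] sobolev2_eq_SUP by (intro SUP_upper) auto
    then show "(\<Sum>k\<in>F. (norm (f k))\<^sup>2 * kabs k powr (2 * s)) \<le> C"
      using C(1) by simp
  qed
qed

text \<open>The supremum is taken along an increasing sequence, the form in which monotone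
  convergence can be applied to time integrals.\<close>

lemma sobolev2_eq_SUP_modes:
  "sobolev2 s f = (SUP n::nat. ennreal (\<Sum>k\<in>modes (real n). (norm (f k))\<^sup>2 * kabs k powr (2 * s)))"
proof (rule antisym)
  show "sobolev2 s f \<le> (SUP n::nat. ennreal (\<Sum>k\<in>modes (real n). (norm (f k))\<^sup>2 * kabs k powr (2 * s)))"
    unfolding sobolev2_eq_SUP
  proof (rule SUP_least)
    fix F :: "wv set" assume "F \<in> {F. finite F \<and> F \<subseteq> {k. k \<noteq> 0}}"
    then obtain n :: nat where "F \<subseteq> modes (real n)" using finite_subset_modes[of F] by auto
    then have "(\<Sum>k\<in>F. (norm (f k))\<^sup>2 * kabs k powr (2 * s)) \<le> (\<Sum>k\<in>modes (real n). (norm (f k))\<^sup>2 * kabs k powr (2 * s))"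
      by (intro sum_mono2) auto
    then show "ennreal (\<Sum>k\<in>F. (norm (f k))\<^sup>2 * kabs k powr (2 * s))
        \<le> (SUP n::nat. ennreal (\<Sum>k\<in>modes (real n). (norm (f k))\<^sup>2 * kabs k powr (2 * s)))"
      by (intro SUP_upper2[of n]) (auto intro: ennreal_leI)
  qed
  show "(SUP n::nat. ennreal (\<Sum>k\<in>modes (real n). (norm (f k))\<^sup>2 * kabs k powr (2 * s))) \<le> sobolev2 s f"
    unfolding sobolev2_eq_SUP
  proof (intro SUP_least SUP_upper CollectI conjI)
    show "modes (real n) \<subseteq> {k. k \<noteq> 0}" for n by (auto simp: modes_def)
  qed simp
qed

text \<open>A finite set \<open>F0\<close> carries all but \<open>\<epsilon> / 2\<close> of the
  total. Off \<open>F0\<close> the ramp is at most 1; on \<open>F0\<close>, which lies in a ball of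
  radius \<open>n\<close>, it is at most \<open>n / R\<close>.\<close>

lemma weighted_tail_small:
  fixes e :: "wv \<Rightarrow> real"
  assumes e: "\<And>k. 0 \<le> e k" and M: "\<And>F. \<lbrakk>finite F; 0 \<notin> F\<rbrakk> \<Longrightarrow> sum e F \<le> M" and \<epsilon>: "0 < \<epsilon>"
  obtains R where "1 \<le> R" "\<And>F. \<lbrakk>finite F; 0 \<notin> F\<rbrakk> \<Longrightarrow> (\<Sum>k\<in>F. e k * (min 1 (kabs k / R))\<^sup>2) \<le> \<epsilon>"
proof -
  let ?A = "{sum e F |F. finite F \<and> 0 \<notin> F}"
  have bdd: "bdd_above ?A" using M by (auto intro!: bdd_aboveI[of _ M])
  have "sum e {} \<in> ?A" by blast
  then have ne: "?A \<noteq> {}" by blast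
  have "Sup ?A - \<epsilon> / 2 < Sup ?A" using \<epsilon> by simp
  then obtain F0 where F0: "finite F0" "0 \<notin> F0" "Sup ?A - \<epsilon> / 2 < sum e F0"
    using less_cSup_iff[OF ne bdd] by auto
  obtain n :: nat where n: "F0 \<subseteq> modes (real n)" using finite_subset_modes[OF F0(1,2)] .
  have M0: "0 \<le> M" using M[of "{}"] by simp
  \<comment> \<open>Large enough that \<open>M * (real n / R) \<le> \<epsilon> / 2\<close>; the
    summand 1 ensures \<open>1 \<le> R\<close>.\<close>
  define R where "R = 1 + real n * (1 + 2 * M / \<epsilon>)"
  have R: "1 \<le> R" "0 < R" using M0 \<epsilon> by (auto simp: R_def add_pos_nonneg)
  show ?thesis
  proof (rule that[OF R(1)])
    fix F :: "wv set" assume F: "finite F" "0 \<notin> F"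
    let ?\<phi> = "\<lambda>k. (min 1 (kabs k / R))\<^sup>2"
    have \<phi>1: "?\<phi> k \<le> 1" for k using R by (simp add: power_le_one)
    have "(\<Sum>k\<in>F. e k * ?\<phi> k) = (\<Sum>k\<in>F \<inter> F0. e k * ?\<phi> k) + (\<Sum>k\<in>F - F0. e k * ?\<phi> k)"
      using F sum.Int_Diff by blast
    also have "(\<Sum>k\<in>F - F0. e k * ?\<phi> k) \<le> sum e (F - F0)"
      using e \<phi>1 by (intro sum_mono) (simp add: mult_left_le)
    also have "sum e (F - F0) \<le> \<epsilon> / 2"
    proof -
      have "sum e (F - F0) + sum e F0 = sum e ((F - F0) \<union> F0)"
        using F F0 by (intro sum.union_disjoint[symmetric]) auto
      also have "\<dots> \<le> Sup ?A" using F F0 by (intro cSup_upper bdd) auto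
      finally show ?thesis using F0(3) by linarith
    qed
    also have "(\<Sum>k\<in>F \<inter> F0. e k * ?\<phi> k) \<le> (\<Sum>k\<in>F \<inter> F0. e k * (real n / R))"
    proof (intro sum_mono mult_left_mono e)
      fix k assume "k \<in> F \<inter> F0"
      then have "kabs k \<le> real n" using n by (auto simp: modes_def)
      then have "min 1 (kabs k / R) \<le> real n / R" using R by (simp add: divide_right_mono min.coboundedI2)
      moreover have "?\<phi> k \<le> min 1 (kabs k / R)"
        unfolding power2_eq_square by (rule mult_left_le) (use R in auto)
      ultimately show "?\<phi> k \<le> real n / R" by linarith
    qed
    also have "\<dots> = sum e (F \<inter> F0) * (real n / R)" by (simp only: sum_distrib_right)
    also have "\<dots> \<le> M * (real n / R)" using M[of "F \<inter> F0"] F R by (intro mult_right_mono) auto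
    also have "\<dots> \<le> \<epsilon> / 2"
    proof -
      have "2 * M * real n \<le> \<epsilon> * R"
        using \<epsilon> M0 by (simp add: R_def algebra_simps)
      then show ?thesis using R by (simp add: field_simps)
    qed
    finally show "(\<Sum>k\<in>F. e k * ?\<phi> k) \<le> \<epsilon>" by simp
  qed
qed

lemma norm_leray_le:
  assumes "k \<noteq> 0"
  shows "norm (leray k w) \<le> norm w"
proof -
  have "(norm (leray k w))\<^sup>2 = leray k w \<bullet> w"
    using inner_leray[OF cdot_leray[OF assms, of w], of w] by (simp add: power2_norm_eq_inner)
  also have "\<dots> \<le> norm (leray k w) * norm w" by (rule norm_cauchy_schwarz)
  finally show ?thesis by (cases "norm (leray k w) = 0") (auto simp: power2_eq_square mult_le_cancel_left)
qed

text \<open>Charging the derivative to the fixed output mode \<open>k\<close> leaves only l^2 norms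
  of \<open>u\<close> and \<open>w\<close>. When \<open>F\<close> is a tail, smallness of
  \<open>w\<close> on it makes the whole sum small.\<close>

lemma conv_term_sum_le:
  assumes u: "solenoidal u" and F: "finite F"
    and bu: "\<And>G. finite G \<Longrightarrow> (\<Sum>j\<in>G. (norm (u j))\<^sup>2) \<le> A\<^sup>2" and bw: "(\<Sum>l\<in>F. (norm (w l))\<^sup>2) \<le> B\<^sup>2"
    and AB: "0 \<le> A" "0 \<le> B"
  shows "(\<Sum>l\<in>F. norm (conv_term u w k l)) \<le> kabs k * (A * B)"
proof -
  have "(\<Sum>l\<in>F. norm (conv_term u w k l)) \<le> (\<Sum>l\<in>F. kabs k * (norm (u (k - l)) * norm (w l)))"
  proof (rule sum_mono)
    fix l
    have "norm (conv_term u w k l) \<le> norm (u (k - l)) * min (kabs k) (kabs l) * norm (w l)"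
      by (rule norm_conv_term_le[OF u])
    also have "\<dots> \<le> norm (u (k - l)) * kabs k * norm (w l)"
      by (intro mult_right_mono mult_left_mono) auto
    finally show "norm (conv_term u w k l) \<le> kabs k * (norm (u (k - l)) * norm (w l))" by (simp add: mult_ac)
  qed
  also have "\<dots> = kabs k * (\<Sum>l\<in>F. norm (u (k - l)) * norm (w l))" by (simp add: sum_distrib_left)
  also have "\<dots> \<le> kabs k * (L2_set (\<lambda>l. norm (u (k - l))) F * L2_set (\<lambda>l. norm (w l)) F)"
    by (intro mult_left_mono sum_mult_le_L2_set) simp
  also have "\<dots> \<le> kabs k * (A * B)"
  proof (intro mult_left_mono mult_mono)
    have "inj_on (\<lambda>l. k - l) F" by (simp add: inj_on_def)
    then have "(\<Sum>l\<in>F. (norm (u (k - l)))\<^sup>2) = (\<Sum>j\<in>(\<lambda>l. k - l) ` F. (norm (u j))\<^sup>2)"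
      by (simp add: sum.reindex)
    also have "\<dots> \<le> A\<^sup>2" using F by (intro bu) simp
    finally show "L2_set (\<lambda>l. norm (u (k - l))) F \<le> A"
      unfolding L2_set_def using AB by (intro real_le_lsqrt) (auto simp: sum_nonneg)
    show "L2_set (\<lambda>l. norm (w l)) F \<le> B"
      unfolding L2_set_def using AB bw by (intro real_le_lsqrt) (auto simp: sum_nonneg)
  qed (use AB in \<open>auto simp: L2_set_nonneg\<close>)
  finally show ?thesis .
qed

lemma norm_LamV_le: "0 \<le> \<alpha> \<Longrightarrow> v 0 = 0 \<Longrightarrow> norm (LamV (- 2 * \<alpha>) v k) \<le> norm (v k)"
proof (cases "k = 0")
  case False
  assume "0 \<le> \<alpha>"
  then have "kabs k powr (- 2 * \<alpha>) \<le> kabs k powr 0"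
    using kabs_ge_1[OF False] by (intro powr_mono) auto
  then show ?thesis using kabs_pos[OF False] by (simp add: LamV_def mult_left_le_one_le)
qed (simp add: LamV_def)

text \<open>Termwise convergence together with tails that are small uniformly in \<open>n\<close>.
  The same tail bound passes to \<open>d\<close> by lower semicontinuity on finite sets, which also
  gives its summability.\<close>

lemma infsum_tendsto_uniform_tail:
  fixes c :: "nat \<Rightarrow> 'i \<Rightarrow> 'a::banach"
  assumes lim: "\<And>l. (\<lambda>n. c n l) \<longlonglongrightarrow> d l" and K: "\<And>n. finite (K n)" "\<And>n l. l \<notin> K n \<Longrightarrow> c n l = 0"
    and tail: "\<And>\<epsilon>. 0 < \<epsilon> \<Longrightarrow> \<exists>F0. finite F0 \<and> (\<forall>n G. finite G \<longrightarrow> G \<inter> F0 = {} \<longrightarrow> (\<Sum>l\<in>G. norm (c n l)) \<le> \<epsilon>)"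
  shows "d summable_on UNIV" "(\<lambda>n. \<Sum>l\<in>K n. c n l) \<longlonglongrightarrow> infsum d UNIV"
proof -
  have tail_d: "(\<Sum>l\<in>G. norm (d l)) \<le> \<epsilon>"
    if "\<forall>n G. finite G \<longrightarrow> G \<inter> F0 = {} \<longrightarrow> (\<Sum>l\<in>G. norm (c n l)) \<le> \<epsilon>" "finite G" "G \<inter> F0 = {}" for F0 G \<epsilon>
  proof (rule LIMSEQ_le_const2)
    show "(\<lambda>n. \<Sum>l\<in>G. norm (c n l)) \<longlonglongrightarrow> (\<Sum>l\<in>G. norm (d l))" by (intro tendsto_intros lim)
  qed (use that in auto)
  obtain F1 where F1: "finite F1" "\<forall>n G. finite G \<longrightarrow> G \<inter> F1 = {} \<longrightarrow> (\<Sum>l\<in>G. norm (c n l)) \<le> 1"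
    using tail[of 1] by auto
  have abs_sum: "d abs_summable_on UNIV"
  proof (rule nonneg_bdd_above_summable_on)
    show "bdd_above (sum (\<lambda>l. norm (d l)) ` {F. F \<subseteq> UNIV \<and> finite F})"
    proof (rule bdd_aboveI2)
      fix F :: "'i set" assume "F \<in> {F. F \<subseteq> UNIV \<and> finite F}"
      then have F: "finite F" by simp
      have "(\<Sum>l\<in>F. norm (d l)) = (\<Sum>l\<in>F \<inter> F1. norm (d l)) + (\<Sum>l\<in>F - F1. norm (d l))"
        using F sum.Int_Diff by blast
      also have "\<dots> \<le> (\<Sum>l\<in>F1. norm (d l)) + 1"
        using F F1 by (intro add_mono sum_mono2 tail_d[OF F1(2)]) auto
      finally show "(\<Sum>l\<in>F. norm (d l)) \<le> (\<Sum>l\<in>F1. norm (d l)) + 1" .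
    qed
  qed simp
  then show sd: "d summable_on UNIV" by (rule abs_summable_summable)
  show "(\<lambda>n. \<Sum>l\<in>K n. c n l) \<longlonglongrightarrow> infsum d UNIV"
  proof (rule tendstoI)
    fix e :: real assume e: "0 < e"
    then obtain F0 where F0: "finite F0" "\<forall>n G. finite G \<longrightarrow> G \<inter> F0 = {} \<longrightarrow> (\<Sum>l\<in>G. norm (c n l)) \<le> e / 4"
      using tail[of "e / 4"] by auto
    have abs_sum': "d abs_summable_on (- F0)" using abs_sum by (rule summable_on_subset_banach) simp
    have "norm (infsum d (- F0)) \<le> (\<Sum>\<^sub>\<infinity>l\<in>- F0. norm (d l))"
      using abs_sum' by (rule norm_infsum_bound)
    also have "\<dots> \<le> e / 4"
      using abs_sum' by (intro infsum_le_finite_sums tail_d[OF F0(2)]) auto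
    finally have 1: "norm (infsum d (- F0)) \<le> e / 4" .
    have "infsum d (F0 \<union> - F0) = infsum d F0 + infsum d (- F0)"
      using F0(1) abs_summable_summable[OF abs_sum'] by (intro infsum_Un_disjoint) auto
    then have 2: "infsum d UNIV = (\<Sum>l\<in>F0. d l) + infsum d (- F0)"
      using F0(1) by (simp add: Compl_partition)
    have 3: "(\<Sum>l\<in>K n. c n l) = (\<Sum>l\<in>F0. c n l) + (\<Sum>l\<in>K n - F0. c n l)" for n
    proof -
      have "(\<Sum>l\<in>K n. c n l) = (\<Sum>l\<in>F0 \<union> (K n - F0). c n l)"
        using K F0(1) by (intro sum.mono_neutral_left) auto
      also have "\<dots> = (\<Sum>l\<in>F0. c n l) + (\<Sum>l\<in>K n - F0. c n l)"
        using K F0(1) by (intro sum.union_disjoint) auto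
      finally show ?thesis .
    qed
    have 4: "norm (\<Sum>l\<in>K n - F0. c n l) \<le> e / 4" for n
    proof -
      have "(\<Sum>l\<in>K n - F0. norm (c n l)) \<le> e / 4" using F0(2) K(1)[of n] by blast
      then show "norm (\<Sum>l\<in>K n - F0. c n l) \<le> e / 4" using norm_sum order_trans by blast
    qed
    have "(\<lambda>n. \<Sum>l\<in>F0. c n l) \<longlonglongrightarrow> (\<Sum>l\<in>F0. d l)" by (intro tendsto_intros lim)
    then have "\<forall>\<^sub>F n in sequentially. dist (\<Sum>l\<in>F0. c n l) (\<Sum>l\<in>F0. d l) < e / 4"
      using e by (intro tendstoD) auto
    then show "\<forall>\<^sub>F n in sequentially. dist (\<Sum>l\<in>K n. c n l) (infsum d UNIV) < e"
    proof eventually_elim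
      case (elim n)
      have "(\<Sum>l\<in>K n. c n l) - infsum d UNIV = ((\<Sum>l\<in>F0. c n l) - (\<Sum>l\<in>F0. d l)) + (\<Sum>l\<in>K n - F0. c n l) - infsum d (- F0)"
        unfolding 2 3 by simp
      moreover have "norm (x + y - z) \<le> norm x + norm y + norm z" for x y z :: 'a
        using norm_triangle_ineq4[of "x + y" z] norm_triangle_ineq[of x y] by linarith
      ultimately have "norm ((\<Sum>l\<in>K n. c n l) - infsum d UNIV) \<le> norm ((\<Sum>l\<in>F0. c n l) - (\<Sum>l\<in>F0. d l))
          + norm (\<Sum>l\<in>K n - F0. c n l) + norm (infsum d (- F0))"
        by (simp only:)
      then show ?case using elim 1 4[of n] e by (simp add: dist_norm)
    qed
  qed
qed

lemma sum_le_of_support: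
  fixes h :: "'a \<Rightarrow> real"
  assumes "finite K" "finite F" "\<And>j. 0 \<le> h j" "\<And>j. j \<notin> K \<Longrightarrow> h j = 0"
  shows "sum h F \<le> sum h K"
  using sum_shift_le[of K "\<lambda>x. x" F h] assms by simp

section \<open>Compactness in time, mode by mode\<close>

lemma lipschitz_by_derivative:
  fixes f :: "real \<Rightarrow> 'a::banach"
  assumes deriv: "\<And>t. t \<in> {0..T} \<Longrightarrow> (f has_vector_derivative f' t) (at t within {0..T})"
    and le: "\<And>t. t \<in> {0..T} \<Longrightarrow> norm (f' t) \<le> L" and st: "s \<in> {0..T}" "t \<in> {0..T}"
  shows "norm (f t - f s) \<le> L * \<bar>t - s\<bar>"
proof -
  have main: "norm (f b - f a) \<le> L * \<bar>b - a\<bar>" if ab: "a \<le> b" "a \<in> {0..T}" "b \<in> {0..T}" for a b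
  proof -
    have "(f' has_integral (f b - f a)) {a..b}"
      using ab by (intro fundamental_theorem_of_calculus) (auto intro: has_vector_derivative_within_subset[OF deriv])
    moreover have "0 \<le> L" using le[OF ab(2)] norm_ge_zero order_trans by blast
    ultimately have "norm (f b - f a) \<le> L * measure lborel (cbox a b)"
      using ab by (intro has_integral_bound[of L f']) (auto intro: le)
    then show ?thesis using ab by simp
  qed
  show ?thesis
    using main[of s t] main[of t s] st by (cases "s \<le> t") (auto simp: norm_minus_commute abs_minus_commute)
qed

text \<open>A diagonal argument over the countable set of modes and rational times, after which the
  Lipschitz bound extends convergence to all times. The constant \<open>L k\<close> may vary with
  the mode, since only pointwise convergence is sought.\<close>

lemma pointwise_convergent_subsequence:
  fixes f :: "nat \<Rightarrow> 'k::countable \<Rightarrow> real \<Rightarrow> 'b::{real_normed_vector, heine_borel, complete_space}"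
  assumes T: "0 < T" and bound: "\<And>n k t. t \<in> {0..T} \<Longrightarrow> norm (f n k t) \<le> M"
    and lip: "\<And>n k s t. \<lbrakk>s \<in> {0..T}; t \<in> {0..T}\<rbrakk> \<Longrightarrow> norm (f n k t - f n k s) \<le> L k * \<bar>t - s\<bar>"
  obtains \<sigma> where "strict_mono (\<sigma> :: nat \<Rightarrow> nat)" "\<And>k t. t \<in> {0..T} \<Longrightarrow> convergent (\<lambda>n. f (\<sigma> n) k t)"
proof -
  let ?S = "UNIV \<times> (\<rat> \<inter> {0..T}) :: ('k \<times> real) set"
  let ?f = "\<lambda>n (k, t). f n k t"
  have cnt: "countable ?S" by (intro countable_SIGMA countable_Int1 countable_rat) auto
  have B: "norm (?f n x) \<le> M" if "x \<in> ?S" for n x using that bound by auto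
  obtain \<sigma> where \<sigma>: "strict_mono (\<sigma> :: nat \<Rightarrow> nat)"
    and conv: "\<And>x. x \<in> ?S \<Longrightarrow> \<exists>l. (\<lambda>n. ?f (\<sigma> n) x) \<longlonglongrightarrow> l"
    by (rule function_convergent_subsequence[of ?S ?f M, OF cnt B]) blast+
  show ?thesis
  proof (rule that[OF \<sigma>])
    fix k t assume t: "t \<in> {0..T}"
    show "convergent (\<lambda>n. f (\<sigma> n) k t)"
    proof (rule Cauchy_convergent, rule metric_CauchyI)
      fix e :: real assume e: "0 < e"
      define \<delta> where "\<delta> = e / (3 * (\<bar>L k\<bar> + 1))"
      have \<delta>: "0 < \<delta>" using e by (simp add: \<delta>_def)
      \<comment> \<open>The rational time must lie within \<open>\<delta>\<close> of
        \<open>t\<close> and inside the interval even when \<open>t\<close> is an endpoint.\<close>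
      have "max 0 (t - \<delta>) < min T (t + \<delta>)" using t T \<delta> by auto
      then obtain q where q: "q \<in> \<rat>" "max 0 (t - \<delta>) < q" "q < min T (t + \<delta>)"
        using Rats_dense_in_real by blast
      then have q_in: "q \<in> {0..T}" and qt: "\<bar>t - q\<bar> < \<delta>" by auto
      have close: "norm (f n k t - f n k q) < e / 3" for n
      proof -
        have "norm (f n k t - f n k q) \<le> L k * \<bar>t - q\<bar>" by (rule lip[OF q_in t])
        also have "\<dots> \<le> (\<bar>L k\<bar> + 1) * \<bar>t - q\<bar>" by (intro mult_right_mono) auto
        also have "\<dots> < (\<bar>L k\<bar> + 1) * \<delta>" using qt by (intro mult_strict_left_mono) auto
        also have "\<dots> = e / 3" by (simp add: \<delta>_def field_simps)
        finally show ?thesis .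
      qed
      have "\<exists>l. (\<lambda>n. f (\<sigma> n) k q) \<longlonglongrightarrow> l" using conv[of "(k, q)"] q(1) q_in by simp
      then have "Cauchy (\<lambda>n. f (\<sigma> n) k q)" using LIMSEQ_imp_Cauchy by blast
      then obtain N where N: "\<And>m n. \<lbrakk>m \<ge> N; n \<ge> N\<rbrakk> \<Longrightarrow> dist (f (\<sigma> m) k q) (f (\<sigma> n) k q) < e / 3"
        using e by (metis metric_CauchyD zero_less_divide_iff zero_less_numeral)
      have "dist (f (\<sigma> m) k t) (f (\<sigma> n) k t) < e" if "m \<ge> N" "n \<ge> N" for m n
      proof -
        have "dist (f (\<sigma> m) k t) (f (\<sigma> n) k t) \<le> dist (f (\<sigma> m) k t) (f (\<sigma> m) k q)
            + dist (f (\<sigma> m) k q) (f (\<sigma> n) k q) + dist (f (\<sigma> n) k t) (f (\<sigma> n) k q)"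
          by (smt (verit) dist_commute dist_triangle)
        then show ?thesis using close[of "\<sigma> m"] close[of "\<sigma> n"] N[OF that] by (simp add: dist_norm)
      qed
      then show "\<exists>N. \<forall>m\<ge>N. \<forall>n\<ge>N. dist (f (\<sigma> m) k t) (f (\<sigma> n) k t) < e" by blast
    qed
  qed
qed

lemma norm_velocity_rhs_le:
  assumes K: "finite K" "0 \<notin> K" and \<alpha>: "0 \<le> \<alpha>" and \<nu>: "0 \<le> \<nu>" and b: "0 \<le> b" and k: "k \<in> K"
    and sol: "solenoidal v" and v: "\<And>G. finite G \<Longrightarrow> (\<Sum>j\<in>G. (norm (v j))\<^sup>2) \<le> b\<^sup>2"
    and \<theta>: "\<And>G. finite G \<Longrightarrow> (\<Sum>j\<in>G. (norm (\<theta> j))\<^sup>2) \<le> b\<^sup>2"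
  shows "norm (velocity_rhs \<nu> \<alpha> \<beta> K v \<theta> k) \<le> b + kabs k * (b * b) + \<nu> * kabs k powr (2 * \<beta>) * b"
    and "norm (temperature_rhs \<alpha> K v \<theta> k) \<le> kabs k * (b * b)"
proof -
  let ?u = "LamV (- 2 * \<alpha>) v"
  have k0: "k \<noteq> 0" using k K by auto
  have u: "(\<Sum>j\<in>G. (norm (?u j))\<^sup>2) \<le> b\<^sup>2" if "finite G" for G
    using norm_LamV_le[of \<alpha> v, OF \<alpha> solenoidalD(1)[OF sol]]
    by (intro order_trans[OF sum_mono v[OF that]] power_mono) auto
  have 1: "norm (\<Sum>l\<in>K. conv_term ?u v k l) \<le> kabs k * (b * b)"
    using conv_term_sum_le[OF solenoidal_LamV[OF sol] K(1) u v[OF K(1)] b b] norm_sum order_trans by blast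
  have 2: "norm (v k) \<le> b" "norm (emb \<theta> k) \<le> b"
    using v[of "{k}"] \<theta>[of "{k}"] b by (auto intro: power2_le_imp_le)
  have "norm (velocity_rhs \<nu> \<alpha> \<beta> K v \<theta> k) \<le> norm (emb \<theta> k - (\<Sum>l\<in>K. conv_term ?u v k l) - (\<nu> * kabs k powr (2 * \<beta>)) *\<^sub>R v k)"
    unfolding velocity_rhs_def by (rule norm_leray_le[OF k0])
  also have "\<dots> \<le> norm (emb \<theta> k) + norm (\<Sum>l\<in>K. conv_term ?u v k l) + norm ((\<nu> * kabs k powr (2 * \<beta>)) *\<^sub>R v k)"
    by (meson add_right_mono norm_triangle_ineq4 order_trans)
  also have "\<dots> \<le> b + kabs k * (b * b) + \<nu> * kabs k powr (2 * \<beta>) * b"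
    using 1 2 \<nu> by (intro add_mono) (auto simp: mult_left_mono)
  finally show "norm (velocity_rhs \<nu> \<alpha> \<beta> K v \<theta> k) \<le> b + kabs k * (b * b) + \<nu> * kabs k powr (2 * \<beta>) * b" .
  have "norm (temperature_rhs \<alpha> K v \<theta> k) \<le> (\<Sum>l\<in>K. norm (conv_term ?u (emb \<theta>) k l))"
    unfolding temperature_rhs_def norm_minus_cancel by (intro order_trans[OF norm_sum] sum_mono) (simp add: cmod_adv_term)
  also have "\<dots> \<le> kabs k * (b * b)"
    by (rule conv_term_sum_le[OF solenoidal_LamV[OF sol] K(1) u _ b b]) (use \<theta>[OF K(1)] in simp_all)
  finally show "norm (temperature_rhs \<alpha> K v \<theta> k) \<le> kabs k * (b * b)" .
qed

text \<open>\<open>e k\<close> stands for the initial energy of mode \<open>k\<close>, velocity and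
  temperature combined. The sequence is abstract, so that a subsequence is another instance and
  inherits every bound.\<close>

locale galerkin_sequence =
  fixes \<nu> \<alpha> \<beta> T r C M :: real and K :: "nat \<Rightarrow> wv set" and vs :: "nat \<Rightarrow> real \<Rightarrow> vfield"
    and ts :: "nat \<Rightarrow> real \<Rightarrow> sfield" and e :: "wv \<Rightarrow> real"
  assumes \<nu>: "0 < \<nu>" and T: "0 < T" and \<alpha>: "0 \<le> \<alpha>" and \<beta>: "0 < \<beta>" "\<beta> < r" and C: "0 < C"
    and K: "\<And>n. finite (K n)" "\<And>n. 0 \<notin> K n" "\<And>k. k \<noteq> 0 \<Longrightarrow> \<forall>\<^sub>F n in sequentially. k \<in> K n"
    and G: "\<And>n. galerkin \<nu> \<alpha> \<beta> T (K n) (vs n) (ts n)"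
    and e: "\<And>k. 0 \<le> e k" "\<And>F. \<lbrakk>finite F; 0 \<notin> F\<rbrakk> \<Longrightarrow> sum e F \<le> M"
    and bound: "\<And>n R t. \<lbrakk>1 \<le> R; t \<in> {0..T}\<rbrakk> \<Longrightarrow>
      (nrm (K n) (wgt r R) (vs n t))\<^sup>2 + (nrm (K n) (wgt (r - \<beta>) R) (emb (ts n t)))\<^sup>2
      + integral {0..t} (\<lambda>s. (nrm (K n) (wgt (r + \<beta>) R) (vs n s))\<^sup>2)
      \<le> C * (\<Sum>k\<in>K n. e k * (min 1 (kabs k / R))\<^sup>2)"
begin

definition b :: real where "b = sqrt (C * M)"

lemma M_nonneg: "0 \<le> M"
  using e(2)[of "{}"] by simp

lemma b_nonneg: "0 \<le> b" and b_power2: "b\<^sup>2 = C * M"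
  using M_nonneg C by (simp_all add: b_def)

lemma dissipation_integral_nonneg:
  "t \<in> {0..T} \<Longrightarrow> 0 \<le> integral {0..t} (\<lambda>s. (nrm (K n) \<mu> (vs n s))\<^sup>2)"
  by (intro Henstock_Kurzweil_Integration.integral_nonneg integrable_continuous_real
        continuous_on_subset[of "{0..T}" _ "{0..t}"] continuous_intros galerkin_continuous_nrm[OF G]) auto

text \<open>Used at two ends: \<open>R = 1\<close> with \<open>\<epsilon> = M\<close> gives the
  uniform Sobolev bounds, and large \<open>R\<close> with small \<open>\<epsilon>\<close> gives the
  uniform tails.\<close>

lemma weighted_sum_le:
  assumes F: "finite F" and R: "1 \<le> R" and t: "t \<in> {0..T}"
    and small: "\<And>F. \<lbrakk>finite F; 0 \<notin> F\<rbrakk> \<Longrightarrow> (\<Sum>k\<in>F. e k * (min 1 (kabs k / R))\<^sup>2) \<le> \<epsilon>"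
  shows "(\<Sum>k\<in>F. (wgt r R k)\<^sup>2 * (norm (vs n t k))\<^sup>2) \<le> C * \<epsilon>"
    and "(\<Sum>k\<in>F. (wgt (r - \<beta>) R k)\<^sup>2 * (norm (ts n t k))\<^sup>2) \<le> C * \<epsilon>"
proof -
  have "C * (\<Sum>k\<in>K n. e k * (min 1 (kabs k / R))\<^sup>2) \<le> C * \<epsilon>"
    using C small[OF K(1,2)] by simp
  then have *: "(nrm (K n) (wgt r R) (vs n t))\<^sup>2 \<le> C * \<epsilon>" "(nrm (K n) (wgt (r - \<beta>) R) (emb (ts n t)))\<^sup>2 \<le> C * \<epsilon>"
    using bound[OF R t, of n] dissipation_integral_nonneg[OF t, of n "wgt (r + \<beta>) R"]
      zero_le_power2[of "nrm (K n) (wgt r R) (vs n t)"] zero_le_power2[of "nrm (K n) (wgt (r - \<beta>) R) (emb (ts n t))"]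
    by linarith+
  have "(\<Sum>k\<in>F. (wgt r R k)\<^sup>2 * (norm (vs n t k))\<^sup>2) \<le> (\<Sum>k\<in>K n. (wgt r R k)\<^sup>2 * (norm (vs n t k))\<^sup>2)"
    using F K(1) by (intro sum_le_of_support) (auto simp: galerkinD(3)[OF G t])
  then show "(\<Sum>k\<in>F. (wgt r R k)\<^sup>2 * (norm (vs n t k))\<^sup>2) \<le> C * \<epsilon>" using * by (simp add: nrm_power2)
  have "(\<Sum>k\<in>F. (wgt (r - \<beta>) R k)\<^sup>2 * (norm (ts n t k))\<^sup>2) \<le> (\<Sum>k\<in>K n. (wgt (r - \<beta>) R k)\<^sup>2 * (norm (ts n t k))\<^sup>2)"
    using F K(1) by (intro sum_le_of_support) (auto simp: galerkinD(4)[OF G t])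
  then show "(\<Sum>k\<in>F. (wgt (r - \<beta>) R k)\<^sup>2 * (norm (ts n t k))\<^sup>2) \<le> C * \<epsilon>" using * by (simp add: nrm_power2)
qed

lemma small_one: "\<lbrakk>finite F; 0 \<notin> F\<rbrakk> \<Longrightarrow> (\<Sum>k\<in>F. e k * (min 1 (kabs k / 1))\<^sup>2) \<le> M"
proof -
  assume F: "finite F" "0 \<notin> F"
  have "(\<Sum>k\<in>F. e k * (min 1 (kabs k / 1))\<^sup>2) \<le> sum e F"
    by (intro sum_mono) (simp add: e mult_left_le power_le_one)
  then show ?thesis using e(2)[OF F] by linarith
qed

lemma wgt_power2: "1 \<le> R \<Longrightarrow> R \<le> kabs k \<Longrightarrow> (wgt s R k)\<^sup>2 = kabs k powr (2 * s)"
  by (subst wgt_eq) (auto simp: powr_square)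

lemma sobolev_sum_le:
  assumes F: "finite F" "0 \<notin> F" and t: "t \<in> {0..T}"
  shows "(\<Sum>k\<in>F. kabs k powr (2 * r) * (norm (vs n t k))\<^sup>2) \<le> b\<^sup>2"
    and "(\<Sum>k\<in>F. kabs k powr (2 * (r - \<beta>)) * (norm (ts n t k))\<^sup>2) \<le> b\<^sup>2"
proof -
  have w: "(wgt s 1 k)\<^sup>2 = kabs k powr (2 * s)" if "k \<in> F" for s k
  proof -
    have "k \<noteq> 0" using F that by auto
    then show ?thesis by (intro wgt_power2) (auto intro: kabs_ge_1)
  qed
  show "(\<Sum>k\<in>F. kabs k powr (2 * r) * (norm (vs n t k))\<^sup>2) \<le> b\<^sup>2"
    using weighted_sum_le(1)[OF F(1) order_refl t small_one, of n] w unfolding b_power2 by simp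
  show "(\<Sum>k\<in>F. kabs k powr (2 * (r - \<beta>)) * (norm (ts n t k))\<^sup>2) \<le> b\<^sup>2"
    using weighted_sum_le(2)[OF F(1) order_refl t small_one, of n] w unfolding b_power2 by simp
qed

lemma zero_mode: "t \<in> {0..T} \<Longrightarrow> vs n t 0 = 0" "t \<in> {0..T} \<Longrightarrow> ts n t 0 = 0"
  using galerkinD(3)[OF G, of t 0 n] galerkinD(4)[OF G, of t 0 n] K(2)[of n] by auto

lemma l2_sum_le:
  assumes F: "finite F" and t: "t \<in> {0..T}"
  shows "(\<Sum>k\<in>F. (norm (vs n t k))\<^sup>2) \<le> b\<^sup>2" and "(\<Sum>k\<in>F. (norm (ts n t k))\<^sup>2) \<le> b\<^sup>2"
proof -
  have w: "(norm x)\<^sup>2 \<le> kabs k powr (2 * s) * (norm x)\<^sup>2" if "k \<noteq> 0" "0 \<le> s" for s k and x :: "'x::real_normed_vector"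
    using that kabs_ge_1[OF that(1)] ge_one_powr_ge_zero[of "kabs k" "2 * s"] mult_right_mono[of 1 "kabs k powr (2 * s)" "(norm x)\<^sup>2"]
    by simp
  have "(\<Sum>k\<in>F. (norm (vs n t k))\<^sup>2) = (\<Sum>k\<in>F - {0}. (norm (vs n t k))\<^sup>2)"
    using F by (intro sum.mono_neutral_right) (auto simp: zero_mode[OF t])
  also have "\<dots> \<le> (\<Sum>k\<in>F - {0}. kabs k powr (2 * r) * (norm (vs n t k))\<^sup>2)"
    using \<beta> by (intro sum_mono w) auto
  also have "\<dots> \<le> b\<^sup>2" using F by (intro sobolev_sum_le t) auto
  finally show "(\<Sum>k\<in>F. (norm (vs n t k))\<^sup>2) \<le> b\<^sup>2" .
  have "(\<Sum>k\<in>F. (norm (ts n t k))\<^sup>2) = (\<Sum>k\<in>F - {0}. (norm (ts n t k))\<^sup>2)"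
    using F by (intro sum.mono_neutral_right) (auto simp: zero_mode[OF t])
  also have "\<dots> \<le> (\<Sum>k\<in>F - {0}. kabs k powr (2 * (r - \<beta>)) * (norm (ts n t k))\<^sup>2)"
    using \<beta> by (intro sum_mono w) auto
  also have "\<dots> \<le> b\<^sup>2" using F by (intro sobolev_sum_le t) auto
  finally show "(\<Sum>k\<in>F. (norm (ts n t k))\<^sup>2) \<le> b\<^sup>2" .
qed

text \<open>A bound for both right-hand sides at mode \<open>k\<close>, hence a Lipschitz constant
  in time and a dominating constant for the limit, independent of \<open>n\<close>.\<close>

definition L :: "wv \<Rightarrow> real" where
  "L k = b + kabs k * (b * b) + \<nu> * kabs k powr (2 * \<beta>) * b"

lemma L_nonneg: "0 \<le> L k"
  using b_nonneg \<nu> by (simp add: L_def)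

lemma rhs_le:
  assumes t: "t \<in> {0..T}" and k: "k \<in> K n"
  shows "norm (velocity_rhs \<nu> \<alpha> \<beta> (K n) (vs n t) (ts n t) k) \<le> L k"
    and "norm (temperature_rhs \<alpha> (K n) (vs n t) (ts n t) k) \<le> L k"
proof -
  show "norm (velocity_rhs \<nu> \<alpha> \<beta> (K n) (vs n t) (ts n t) k) \<le> L k"
    unfolding L_def
    by (rule norm_velocity_rhs_le(1)[OF K(1,2) \<alpha> less_imp_le[OF \<nu>] b_nonneg k galerkinD(1)[OF G t]])
       (erule l2_sum_le[OF _ t])+
  have "norm (temperature_rhs \<alpha> (K n) (vs n t) (ts n t) k) \<le> kabs k * (b * b)"
    by (rule norm_velocity_rhs_le(2)[OF K(1,2) \<alpha> less_imp_le[OF \<nu>] b_nonneg k galerkinD(1)[OF G t]])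
       (erule l2_sum_le[OF _ t])+
  moreover have "0 \<le> \<nu> * kabs k powr (2 * \<beta>) * b" using b_nonneg \<nu> by simp
  ultimately show "norm (temperature_rhs \<alpha> (K n) (vs n t) (ts n t) k) \<le> L k"
    unfolding L_def using b_nonneg by linarith
qed

lemma mode_lipschitz:
  assumes "s \<in> {0..T}" "t \<in> {0..T}"
  shows "norm (vs n t k - vs n s k) \<le> L k * \<bar>t - s\<bar>" "norm (ts n t k - ts n s k) \<le> L k * \<bar>t - s\<bar>"
proof -
  have "norm (vs n t k - vs n s k) \<le> L k * \<bar>t - s\<bar> \<and> norm (ts n t k - ts n s k) \<le> L k * \<bar>t - s\<bar>"
  proof (cases "k \<in> K n")
    case True
    then show ?thesis
      by (intro conjI lipschitz_by_derivative[OF galerkinD(5)[OF G] rhs_le(1) assms]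
          lipschitz_by_derivative[OF galerkinD(6)[OF G] rhs_le(2) assms])
  next
    case False
    then show ?thesis
      using L_nonneg[of k] by (simp add: galerkinD(3,4)[OF G assms(1)] galerkinD(3,4)[OF G assms(2)])
  qed
  then show "norm (vs n t k - vs n s k) \<le> L k * \<bar>t - s\<bar>" "norm (ts n t k - ts n s k) \<le> L k * \<bar>t - s\<bar>"
    by auto
qed

lemma mode_bound:
  assumes "t \<in> {0..T}"
  shows "norm (vs n t k) \<le> b" "norm (ts n t k) \<le> b"
  using l2_sum_le[OF _ assms, of "{k}" n] b_nonneg by (auto intro: power2_le_imp_le)

lemma convergent_subsequence:
  obtains \<sigma> where "strict_mono (\<sigma> :: nat \<Rightarrow> nat)" "\<And>k t. t \<in> {0..T} \<Longrightarrow> convergent (\<lambda>n. vs (\<sigma> n) t k)"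
    "\<And>k t. t \<in> {0..T} \<Longrightarrow> convergent (\<lambda>n. ts (\<sigma> n) t k)"
proof -
  \<comment> \<open>The two unknowns are paired so that a single extraction serves both.\<close>
  have "norm (vs n t k, ts n t k) \<le> 2 * b" if "t \<in> {0..T}" for n k t
    using norm_Pair_le[of "vs n t k" "ts n t k"] mode_bound[OF that, of n k] by linarith
  moreover have "norm ((vs n t k, ts n t k) - (vs n s k, ts n s k)) \<le> (2 * L k) * \<bar>t - s\<bar>"
    if "s \<in> {0..T}" "t \<in> {0..T}" for n k s t
    using norm_Pair_le[of "vs n t k - vs n s k" "ts n t k - ts n s k"] mode_lipschitz[OF that, of n k] by simp
  ultimately obtain \<sigma> where \<sigma>: "strict_mono (\<sigma> :: nat \<Rightarrow> nat)"
    and conv: "\<And>k t. t \<in> {0..T} \<Longrightarrow> convergent (\<lambda>n. (vs (\<sigma> n) t k, ts (\<sigma> n) t k))"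
    using pointwise_convergent_subsequence[OF T, of "\<lambda>n k t. (vs n t k, ts n t k)" "2 * b" "\<lambda>k. 2 * L k"] by blast
  show ?thesis
  proof (rule that[OF \<sigma>])
    fix k t assume "t \<in> {0..T}"
    then obtain l where l: "(\<lambda>n. (vs (\<sigma> n) t k, ts (\<sigma> n) t k)) \<longlonglongrightarrow> l"
      using conv unfolding convergent_def by blast
    show "convergent (\<lambda>n. vs (\<sigma> n) t k)" "convergent (\<lambda>n. ts (\<sigma> n) t k)"
      using tendsto_fst[OF l] tendsto_snd[OF l] unfolding convergent_def by auto
  qed
qed

end

locale galerkin_limit = galerkin_sequence +
  fixes v :: "real \<Rightarrow> vfield" and \<theta> :: "real \<Rightarrow> sfield"
  assumes lim_v: "\<And>k t. t \<in> {0..T} \<Longrightarrow> (\<lambda>n. vs n t k) \<longlonglongrightarrow> v t k"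
    and lim_\<theta>: "\<And>k t. t \<in> {0..T} \<Longrightarrow> (\<lambda>n. ts n t k) \<longlonglongrightarrow> \<theta> t k"
begin

lemma solenoidal_limit:
  assumes t: "t \<in> {0..T}"
  shows "solenoidal (v t)"
  unfolding solenoidal_def
proof (intro conjI allI)
  show "v t 0 = 0"
    using lim_v[OF t, of 0] by (simp add: zero_mode[OF t] LIMSEQ_const_iff)
  fix k
  have "bounded_linear vcnj" using linear_vcnj by (simp add: linear_conv_bounded_linear)
  from bounded_linear.tendsto[OF this lim_v[OF t, of k]]
  have "(\<lambda>n. vs n t (- k)) \<longlonglongrightarrow> vcnj (v t k)"
    by (simp add: solenoidalD(2)[OF galerkinD(1)[OF G t]])
  then show "v t (- k) = vcnj (v t k)" using lim_v[OF t, of "- k"] LIMSEQ_unique by blast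
  have "bounded_linear (\<lambda>w. cdot w (kvec k))" using linear_cdot by (simp add: linear_conv_bounded_linear)
  from bounded_linear.tendsto[OF this lim_v[OF t, of k]]
  show "cdot (v t k) (kvec k) = 0"
    by (simp add: solenoidalD(3)[OF galerkinD(1)[OF G t]] LIMSEQ_const_iff)
qed

lemma temperature_real_limit:
  assumes t: "t \<in> {0..T}"
  shows "\<theta> t 0 = 0" "\<theta> t (- k) = cnj (\<theta> t k)"
proof -
  show "\<theta> t 0 = 0"
    using lim_\<theta>[OF t, of 0] by (simp add: zero_mode[OF t] LIMSEQ_const_iff)
  have "(\<lambda>n. ts n t (- k)) \<longlonglongrightarrow> cnj (\<theta> t k)"
    using tendsto_cnj[OF lim_\<theta>[OF t, of k]] by (simp add: galerkinD(2)[OF G t])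
  then show "\<theta> t (- k) = cnj (\<theta> t k)" using lim_\<theta>[OF t, of "- k"] LIMSEQ_unique by blast
qed

lemma weighted_limit_le:
  assumes F: "finite F" and R: "1 \<le> R" and t: "t \<in> {0..T}"
    and small: "\<And>F. \<lbrakk>finite F; 0 \<notin> F\<rbrakk> \<Longrightarrow> (\<Sum>k\<in>F. e k * (min 1 (kabs k / R))\<^sup>2) \<le> \<epsilon>"
  shows "(\<Sum>k\<in>F. (wgt r R k)\<^sup>2 * (norm (v t k))\<^sup>2) \<le> C * \<epsilon>"
    and "(\<Sum>k\<in>F. (wgt (r - \<beta>) R k)\<^sup>2 * (norm (\<theta> t k))\<^sup>2) \<le> C * \<epsilon>"
proof -
  have "(\<lambda>n. \<Sum>k\<in>F. (wgt r R k)\<^sup>2 * (norm (vs n t k))\<^sup>2) \<longlonglongrightarrow> (\<Sum>k\<in>F. (wgt r R k)\<^sup>2 * (norm (v t k))\<^sup>2)"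
    by (intro tendsto_intros lim_v t)
  then show "(\<Sum>k\<in>F. (wgt r R k)\<^sup>2 * (norm (v t k))\<^sup>2) \<le> C * \<epsilon>"
    by (rule LIMSEQ_le_const2) (use weighted_sum_le(1)[OF F R t small] in blast)
  have "(\<lambda>n. \<Sum>k\<in>F. (wgt (r - \<beta>) R k)\<^sup>2 * (norm (ts n t k))\<^sup>2) \<longlonglongrightarrow> (\<Sum>k\<in>F. (wgt (r - \<beta>) R k)\<^sup>2 * (norm (\<theta> t k))\<^sup>2)"
    by (intro tendsto_intros lim_\<theta> t)
  then show "(\<Sum>k\<in>F. (wgt (r - \<beta>) R k)\<^sup>2 * (norm (\<theta> t k))\<^sup>2) \<le> C * \<epsilon>"
    by (rule LIMSEQ_le_const2) (use weighted_sum_le(2)[OF F R t small] in blast)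
qed

lemma sobolev_limit_le:
  assumes F: "finite F" "0 \<notin> F" and t: "t \<in> {0..T}"
  shows "(\<Sum>k\<in>F. (norm (v t k))\<^sup>2 * kabs k powr (2 * r)) \<le> b\<^sup>2"
    and "(\<Sum>k\<in>F. (norm (\<theta> t k))\<^sup>2 * kabs k powr (2 * (r - \<beta>))) \<le> b\<^sup>2"
proof -
  have "(\<lambda>n. \<Sum>k\<in>F. kabs k powr (2 * r) * (norm (vs n t k))\<^sup>2) \<longlonglongrightarrow> (\<Sum>k\<in>F. kabs k powr (2 * r) * (norm (v t k))\<^sup>2)"
    by (intro tendsto_intros lim_v t)
  then show "(\<Sum>k\<in>F. (norm (v t k))\<^sup>2 * kabs k powr (2 * r)) \<le> b\<^sup>2"
    unfolding mult.commute[of "(norm _)\<^sup>2"]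
    by (rule LIMSEQ_le_const2) (use sobolev_sum_le(1)[OF F t] in blast)
  have "(\<lambda>n. \<Sum>k\<in>F. kabs k powr (2 * (r - \<beta>)) * (norm (ts n t k))\<^sup>2) \<longlonglongrightarrow> (\<Sum>k\<in>F. kabs k powr (2 * (r - \<beta>)) * (norm (\<theta> t k))\<^sup>2)"
    by (intro tendsto_intros lim_\<theta> t)
  then show "(\<Sum>k\<in>F. (norm (\<theta> t k))\<^sup>2 * kabs k powr (2 * (r - \<beta>))) \<le> b\<^sup>2"
    unfolding mult.commute[of "(norm _)\<^sup>2"]
    by (rule LIMSEQ_le_const2) (use sobolev_sum_le(2)[OF F t] in blast)
qed

lemma continuous_modes:
  "continuous_on {0..T} (\<lambda>t. v t k)" "continuous_on {0..T} (\<lambda>t. \<theta> t k)"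
proof -
  have cont: "continuous_on {0..T} f"
    if lip: "\<And>s t. \<lbrakk>s \<in> {0..T}; t \<in> {0..T}\<rbrakk> \<Longrightarrow> norm (f t - f s) \<le> L k * \<bar>t - s\<bar>" for f :: "real \<Rightarrow> 'x::real_normed_vector"
    by (rule lipschitz_on_continuous_on[OF lipschitz_onI[OF _ L_nonneg]]) (use lip in \<open>simp add: dist_norm\<close>)
  show "continuous_on {0..T} (\<lambda>t. v t k)"
  proof (rule cont)
    fix s t assume st: "s \<in> {0..T}" "t \<in> {0..T}"
    have "(\<lambda>n. norm (vs n t k - vs n s k)) \<longlonglongrightarrow> norm (v t k - v s k)"
      by (intro tendsto_intros lim_v st)
    then show "norm (v t k - v s k) \<le> L k * \<bar>t - s\<bar>"
      by (rule LIMSEQ_le_const2) (use mode_lipschitz(1)[OF st] in blast)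
  qed
  show "continuous_on {0..T} (\<lambda>t. \<theta> t k)"
  proof (rule cont)
    fix s t assume st: "s \<in> {0..T}" "t \<in> {0..T}"
    have "(\<lambda>n. norm (ts n t k - ts n s k)) \<longlonglongrightarrow> norm (\<theta> t k - \<theta> s k)"
      by (intro tendsto_intros lim_\<theta> st)
    then show "norm (\<theta> t k - \<theta> s k) \<le> L k * \<bar>t - s\<bar>"
      by (rule LIMSEQ_le_const2) (use mode_lipschitz(2)[OF st] in blast)
  qed
qed

text \<open>A positive Sobolev order \<open>s\<close> of \<open>w\<close> forces its l^2 mass beyond
  radius \<open>m\<close> below \<open>b * m powr (- s)\<close>, uniformly in \<open>n\<close>; this
  supplies the tails. Keeping \<open>w\<close> general covers the velocity with \<open>s = r\<close>
  and the embedded temperature with \<open>s = r - \<beta>\<close>.\<close>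

lemma convection_limit:
  assumes t: "t \<in> {0..T}" and s: "0 < s"
    and lim: "\<And>l. (\<lambda>n. w n l) \<longlonglongrightarrow> w' l" and supp: "\<And>n l. l \<notin> K n \<Longrightarrow> w n l = 0"
    and sob: "\<And>n F. \<lbrakk>finite F; 0 \<notin> F\<rbrakk> \<Longrightarrow> (\<Sum>l\<in>F. kabs l powr (2 * s) * (norm (w n l))\<^sup>2) \<le> b\<^sup>2"
  shows "conv_term (LamV (- 2 * \<alpha>) (v t)) w' k summable_on UNIV"
    "(\<lambda>n. \<Sum>l\<in>K n. conv_term (LamV (- 2 * \<alpha>) (vs n t)) (w n) k l) \<longlonglongrightarrow> (\<Sum>\<^sub>\<infinity>l. conv_term (LamV (- 2 * \<alpha>) (v t)) w' k l)"
proof -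
  let ?u = "\<lambda>n. LamV (- 2 * \<alpha>) (vs n t)"
  have lim_u: "(\<lambda>n. ?u n j) \<longlonglongrightarrow> LamV (- 2 * \<alpha>) (v t) j" for j
    unfolding LamV_def by (intro tendsto_intros lim_v t)
  have blin: "bounded_linear (\<lambda>w. cdot w (kvec l))" for l using linear_cdot by (simp add: linear_conv_bounded_linear)
  have "(\<lambda>n. conv_term (?u n) (w n) k l) \<longlonglongrightarrow> conv_term (LamV (- 2 * \<alpha>) (v t)) w' k l" for l
    unfolding conv_term_def vector_scalar_mult_def
    by (intro tendsto_vec_lambda tendsto_intros bounded_linear.tendsto[OF blin] lim_u lim)
  moreover have "conv_term (?u n) (w n) k l = 0" if "l \<notin> K n" for n l
    by (simp add: conv_term_def supp[OF that])
  moreover have "\<exists>F0. finite F0 \<and> (\<forall>n G. finite G \<longrightarrow> G \<inter> F0 = {} \<longrightarrow> (\<Sum>l\<in>G. norm (conv_term (?u n) (w n) k l)) \<le> \<epsilon>)"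
    if \<epsilon>: "0 < \<epsilon>" for \<epsilon>
  proof -
    \<comment> \<open>The tail is at most \<open>kabs k\<close> times the square of
      \<open>b\<close>, divided by \<open>q\<close>, so this \<open>q\<close> brings it below
      \<open>\<epsilon>\<close>; the radius \<open>m\<close> then solves
      \<open>m powr s = q\<close>.\<close>
    define q where "q = kabs k * b\<^sup>2 / \<epsilon> + 1"
    have q: "1 \<le> q" using \<epsilon> by (simp add: q_def)
    define m where "m = q powr (1 / s)"
    have m: "1 \<le> m" unfolding m_def using q s by (intro ge_one_powr_ge_zero) auto
    have ms: "m powr (- s) = 1 / q" using q s by (simp add: m_def powr_powr powr_minus_divide)
    let ?F0 = "insert 0 (modes m)"
    have "(\<Sum>l\<in>G. norm (conv_term (?u n) (w n) k l)) \<le> \<epsilon>" if G: "finite G" "G \<inter> ?F0 = {}" for n G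
    proof -
      have G0: "0 \<notin> G" and Gm: "\<And>l. l \<in> G \<Longrightarrow> m < kabs l"
        using G by (force simp: modes_def)+
      have "(\<Sum>l\<in>G. norm (conv_term (?u n) (w n) k l)) \<le> kabs k * (b * (b * m powr (- s)))"
      proof (rule conv_term_sum_le[OF solenoidal_LamV[OF galerkinD(1)[OF galerkin_sequence.G[OF galerkin_sequence_axioms] t]] G(1)])
        fix H :: "wv set" assume H: "finite H"
        show "(\<Sum>j\<in>H. (norm (?u n j))\<^sup>2) \<le> b\<^sup>2"
          using norm_LamV_le[of \<alpha> "vs n t", OF \<alpha> zero_mode(1)[OF t]]
          by (intro order_trans[OF sum_mono l2_sum_le(1)[OF H t, of n]] power_mono) auto
      next
        have "(\<Sum>l\<in>G. (norm (w n l))\<^sup>2) \<le> (\<Sum>l\<in>G. m powr (- 2 * s) * (kabs l powr (2 * s) * (norm (w n l))\<^sup>2))"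
        proof (rule sum_mono)
          fix l assume "l \<in> G"
          then have "m powr (2 * s) \<le> kabs l powr (2 * s)" using Gm[of l] m s by (intro powr_mono2) auto
          then have "m powr (- 2 * s) * m powr (2 * s) \<le> m powr (- 2 * s) * kabs l powr (2 * s)"
            by (intro mult_left_mono) auto
          then have "1 \<le> m powr (- 2 * s) * kabs l powr (2 * s)" using m by (simp flip: powr_add)
          then show "(norm (w n l))\<^sup>2 \<le> m powr (- 2 * s) * (kabs l powr (2 * s) * (norm (w n l))\<^sup>2)"
            using mult_right_mono[of 1 "m powr (- 2 * s) * kabs l powr (2 * s)" "(norm (w n l))\<^sup>2"] by (simp add: mult.assoc)
        qed
        also have "\<dots> = m powr (- 2 * s) * (\<Sum>l\<in>G. kabs l powr (2 * s) * (norm (w n l))\<^sup>2)"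
          by (simp add: sum_distrib_left)
        also have "\<dots> \<le> m powr (- 2 * s) * b\<^sup>2" by (intro mult_left_mono sob G(1) G0) simp
        finally show "(\<Sum>l\<in>G. (norm (w n l))\<^sup>2) \<le> (b * m powr (- s))\<^sup>2"
          by (simp add: power_mult_distrib powr_square mult.commute)
      qed (use b_nonneg in auto)
      also have "\<dots> = kabs k * b\<^sup>2 / q" by (simp add: ms power2_eq_square)
      also have "\<dots> \<le> \<epsilon>"
      proof -
        have "kabs k * b\<^sup>2 \<le> \<epsilon> * q" using \<epsilon> by (simp add: q_def field_simps)
        then show ?thesis using q by (simp add: divide_le_eq)
      qed
      finally show ?thesis .
    qed
    then show ?thesis by (intro exI[of _ ?F0]) auto
  qed
  ultimately show "conv_term (LamV (- 2 * \<alpha>) (v t)) w' k summable_on UNIV"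
    "(\<lambda>n. \<Sum>l\<in>K n. conv_term (?u n) (w n) k l) \<longlonglongrightarrow> (\<Sum>\<^sub>\<infinity>l. conv_term (LamV (- 2 * \<alpha>) (v t)) w' k l)"
    using infsum_tendsto_uniform_tail[where c = "\<lambda>n. conv_term (?u n) (w n) k" and d = "conv_term (LamV (- 2 * \<alpha>) (v t)) w' k" and K = K]
      K(1) by blast+
qed

lemma velocity_convection_limit:
  assumes t: "t \<in> {0..T}"
  shows "conv_term (LamV (- 2 * \<alpha>) (v t)) (v t) k summable_on UNIV"
    "(\<lambda>n. \<Sum>l\<in>K n. conv_term (LamV (- 2 * \<alpha>) (vs n t)) (vs n t) k l) \<longlonglongrightarrow> (\<Sum>\<^sub>\<infinity>l. conv_term (LamV (- 2 * \<alpha>) (v t)) (v t) k l)"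
  by (rule convection_limit[OF t _ lim_v[OF t] _ sobolev_sum_le(1)[OF _ _ t]];
      use \<beta> galerkinD(3)[OF G t] in auto)+

lemma temperature_convection_limit:
  assumes t: "t \<in> {0..T}"
  shows "adv_term (LamV (- 2 * \<alpha>) (v t)) (\<theta> t) k summable_on UNIV"
    "(\<lambda>n. \<Sum>l\<in>K n. adv_term (LamV (- 2 * \<alpha>) (vs n t)) (ts n t) k l) \<longlonglongrightarrow> advect (LamV (- 2 * \<alpha>) (v t)) (\<theta> t) k"
proof -
  let ?u = "LamV (- 2 * \<alpha>) (v t)"
  have lim: "(\<lambda>n. emb (ts n t) l) \<longlonglongrightarrow> emb (\<theta> t) l" for l
    unfolding emb_def by (intro tendsto_vec_lambda) (auto intro: lim_\<theta>[OF t])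
  have blin: "bounded_linear (\<lambda>w :: complex ^ 3. w $ 3)" by (rule bounded_linear_vec_nth)
  have sob: "(\<Sum>l\<in>F. kabs l powr (2 * (r - \<beta>)) * (norm (emb (ts n t) l))\<^sup>2) \<le> b\<^sup>2" if "finite F" "0 \<notin> F" for n F
    using sobolev_sum_le(2)[OF that t] by simp
  have supp: "emb (ts n t) l = 0" if "l \<notin> K n" for n l using galerkinD(4)[OF G t that] by simp
  have s: "0 < r - \<beta>" using \<beta> by simp
  note * = convection_limit[where w = "\<lambda>n. emb (ts n t)" and w' = "emb (\<theta> t)" and k = k, OF t s lim supp sob]
  show "adv_term ?u (\<theta> t) k summable_on UNIV"
    using summable_on_bounded_linear[OF blin *(1)] by (simp add: conv_term_emb_nth)
  have "(\<Sum>\<^sub>\<infinity>l. conv_term ?u (emb (\<theta> t)) k l) $ 3 = (\<Sum>\<^sub>\<infinity>l. conv_term ?u (emb (\<theta> t)) k l $ 3)"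
    using infsum_bounded_linear_strong[OF _ blin, of "conv_term ?u (emb (\<theta> t)) k" UNIV] *(1)
    using has_sum_bounded_linear[OF blin has_sum_infsum[OF *(1)]] infsumI by metis
  then show "(\<lambda>n. \<Sum>l\<in>K n. adv_term (LamV (- 2 * \<alpha>) (vs n t)) (ts n t) k l) \<longlonglongrightarrow> advect ?u (\<theta> t) k"
    using bounded_linear.tendsto[OF blin *(2)] by (simp add: advect_def conv_term_emb_nth)
qed

end

section \<open>Strong continuity, the equations and the dissipation in the limit\<close>

lemma tendsto_zero_ennrealI:
  fixes f :: "'a \<Rightarrow> ennreal"
  assumes "\<And>\<epsilon>. 0 < \<epsilon> \<Longrightarrow> \<forall>\<^sub>F x in A. f x \<le> ennreal \<epsilon>"
  shows "(f \<longlongrightarrow> 0) A"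
proof (rule order_tendstoI)
  fix a :: ennreal assume "0 < a"
  then obtain y where y: "0 < y" "y < a" using dense by blast
  then obtain \<epsilon> where \<epsilon>: "0 \<le> \<epsilon>" "y = ennreal \<epsilon>" by (cases y) auto
  with y have "0 < \<epsilon>" by simp
  from assms[OF this] show "\<forall>\<^sub>F x in A. f x < a"
    by eventually_elim (use y \<epsilon> in auto)
qed simp

text \<open>A finite block of modes is continuous and the remaining ones are small at all times
  simultaneously.\<close>

lemma sobolev2_tendsto_zero:
  fixes f :: "real \<Rightarrow> wv \<Rightarrow> 'a::real_normed_vector"
  assumes cont: "\<And>k. continuous_on {0..T} (\<lambda>t. f t k)" and t0: "t0 \<in> {0..T}"
    and tail: "\<And>\<epsilon>. 0 < \<epsilon> \<Longrightarrow> \<exists>R. \<forall>t\<in>{0..T}. \<forall>F. finite F \<longrightarrow> (\<forall>k\<in>F. R \<le> kabs k) \<longrightarrow> (\<Sum>k\<in>F. (norm (f t k))\<^sup>2 * kabs k powr (2 * s)) \<le> \<epsilon>"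
  shows "((\<lambda>t. sobolev2 s (\<lambda>k. f t k - f t0 k)) \<longlongrightarrow> 0) (at t0 within {0..T})"
proof (rule tendsto_zero_ennrealI)
  fix \<epsilon> :: real assume \<epsilon>: "0 < \<epsilon>"
  \<comment> \<open>\<open>\<epsilon> / 8\<close> because squaring a difference costs a factor 2 and
    the tails at \<open>t\<close> and at \<open>t0\<close> both enter, which makes
    \<open>\<epsilon> / 2\<close> in all.\<close>
  obtain R where R: "\<And>t F. \<lbrakk>t \<in> {0..T}; finite F; \<forall>k\<in>F. R \<le> kabs k\<rbrakk> \<Longrightarrow> (\<Sum>k\<in>F. (norm (f t k))\<^sup>2 * kabs k powr (2 * s)) \<le> \<epsilon> / 8"
  proof -
    have "0 < \<epsilon> / 8" using \<epsilon> by simp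
    from tail[OF this] show ?thesis using that by blast
  qed
  have "((\<lambda>t. \<Sum>k\<in>modes R. (norm (f t k - f t0 k))\<^sup>2 * kabs k powr (2 * s)) \<longlongrightarrow> (\<Sum>k\<in>modes R. (norm (f t0 k - f t0 k))\<^sup>2 * kabs k powr (2 * s))) (at t0 within {0..T})"
    using cont t0 by (intro tendsto_intros) (auto simp: continuous_on_def)
  then have "\<forall>\<^sub>F t in at t0 within {0..T}. dist (\<Sum>k\<in>modes R. (norm (f t k - f t0 k))\<^sup>2 * kabs k powr (2 * s)) 0 < \<epsilon> / 2"
    using \<epsilon> by (intro tendstoD) auto
  moreover have "\<forall>\<^sub>F t in at t0 within {0..T}. t \<in> {0..T}"
    by (auto simp: eventually_at_filter)
  ultimately show "\<forall>\<^sub>F t in at t0 within {0..T}. sobolev2 s (\<lambda>k. f t k - f t0 k) \<le> ennreal \<epsilon>"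
  proof eventually_elim
    case (elim t)
    show ?case
    proof (rule sobolev2_leI)
      fix F :: "wv set" assume F: "finite F" "0 \<notin> F"
      let ?g = "\<lambda>k. (norm (f t k - f t0 k))\<^sup>2 * kabs k powr (2 * s)"
      let ?H = "F - modes R"
      have H: "finite ?H" "\<forall>k\<in>?H. R \<le> kabs k" using F by (auto simp: modes_def)
      have "sum ?g F = sum ?g (F \<inter> modes R) + sum ?g ?H" using F sum.Int_Diff by blast
      also have "sum ?g (F \<inter> modes R) \<le> sum ?g (modes R)" by (intro sum_mono2) auto
      also have "sum ?g (modes R) \<le> \<epsilon> / 2" using elim(1) by (simp add: dist_real_def)
      also have "sum ?g ?H \<le> (\<Sum>k\<in>?H. 2 * ((norm (f t k))\<^sup>2 * kabs k powr (2 * s)) + 2 * ((norm (f t0 k))\<^sup>2 * kabs k powr (2 * s)))"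
      proof (rule sum_mono)
        fix k
        have "(norm (f t k - f t0 k))\<^sup>2 \<le> (norm (f t k) + norm (f t0 k))\<^sup>2"
          by (intro power_mono norm_triangle_ineq4) simp
        also have "\<dots> \<le> 2 * (norm (f t k))\<^sup>2 + 2 * (norm (f t0 k))\<^sup>2"
          using sum_squares_bound[of "norm (f t k)" "norm (f t0 k)"] by (simp add: power2_sum)
        finally have "?g k \<le> (2 * (norm (f t k))\<^sup>2 + 2 * (norm (f t0 k))\<^sup>2) * kabs k powr (2 * s)"
          by (rule mult_right_mono) simp
        then show "?g k \<le> 2 * ((norm (f t k))\<^sup>2 * kabs k powr (2 * s)) + 2 * ((norm (f t0 k))\<^sup>2 * kabs k powr (2 * s))"
          by (simp add: algebra_simps)
      qed
      also have "\<dots> \<le> \<epsilon> / 2"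
        using R[OF elim(2) H] R[OF t0 H] by (simp add: sum.distrib flip: sum_distrib_left)
      finally show "sum ?g F \<le> \<epsilon>" by simp
    qed
  qed
qed

context galerkin_limit
begin

lemma velocity_equation:
  assumes t: "t \<in> {0..T}" and k: "k \<noteq> 0"
  shows "((\<lambda>s. buoy (\<theta> s) k - Bop (LamV (- 2 * \<alpha>) (v s)) (v s) k - (\<nu> * kabs k powr (2 * \<beta>)) *\<^sub>R v s k)
    has_integral (v t k - v 0 k)) {0..t}"
proof -
  let ?h = "\<lambda>s. buoy (\<theta> s) k - Bop (LamV (- 2 * \<alpha>) (v s)) (v s) k - (\<nu> * kabs k powr (2 * \<beta>)) *\<^sub>R v s k"
  \<comment> \<open>The differential equation for mode \<open>k\<close> holds only once
    \<open>k\<close> belongs to the truncation, so the sequence is shifted by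
    \<open>N\<close>.\<close>
  obtain N where N: "\<And>n. N \<le> n \<Longrightarrow> k \<in> K n" using K(3)[OF k] by (auto simp: eventually_sequentially)
  let ?f = "\<lambda>n s. velocity_rhs \<nu> \<alpha> \<beta> (K (n + N)) (vs (n + N) s) (ts (n + N) s) k"
  have I: "(?f n has_integral (vs (n + N) t k - vs (n + N) 0 k)) {0..t}" for n
    using t N[of "n + N"] by (intro fundamental_theorem_of_calculus)
      (auto intro: has_vector_derivative_within_subset[OF galerkinD(5)[OF G]])
  have lim: "(\<lambda>n. ?f n s) \<longlonglongrightarrow> ?h s" if s: "s \<in> {0..t}" for s
  proof -
    have sT: "s \<in> {0..T}" using s t by auto
    have "bounded_linear (leray k)" using linear_leray by (simp add: linear_conv_bounded_linear)
    moreover have "(\<lambda>n. emb (ts n s) k - (\<Sum>l\<in>K n. conv_term (LamV (- 2 * \<alpha>) (vs n s)) (vs n s) k l) - (\<nu> * kabs k powr (2 * \<beta>)) *\<^sub>R vs n s k)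
      \<longlonglongrightarrow> emb (\<theta> s) k - (\<Sum>\<^sub>\<infinity>l. conv_term (LamV (- 2 * \<alpha>) (v s)) (v s) k l) - (\<nu> * kabs k powr (2 * \<beta>)) *\<^sub>R v s k"
      unfolding emb_def
      by (intro tendsto_intros tendsto_vec_lambda velocity_convection_limit(2)[OF sT] lim_v[OF sT])
         (auto intro: lim_\<theta>[OF sT])
    ultimately have "(\<lambda>n. velocity_rhs \<nu> \<alpha> \<beta> (K n) (vs n s) (ts n s) k) \<longlonglongrightarrow>
      leray k (emb (\<theta> s) k - (\<Sum>\<^sub>\<infinity>l. conv_term (LamV (- 2 * \<alpha>) (v s)) (v s) k l) - (\<nu> * kabs k powr (2 * \<beta>)) *\<^sub>R v s k)"
      unfolding velocity_rhs_def by (rule bounded_linear.tendsto)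
    \<comment> \<open>The limit is solenoidal, so the projection leaves the dissipative term alone
      and the expression takes the form required by \<open>is_solution\<close>.\<close>
    then have "(\<lambda>n. velocity_rhs \<nu> \<alpha> \<beta> (K n) (vs n s) (ts n s) k) \<longlonglongrightarrow> ?h s"
      using solenoidalD(3)[OF solenoidal_limit[OF sT], of k] by (simp add: buoy_eq Bop_def)
    then show ?thesis by (rule LIMSEQ_ignore_initial_segment)
  qed
  have le: "norm (?f n s) \<le> L k" if "s \<in> {0..t}" for n s
    using that t N[of "n + N"] by (intro rhs_le) auto
  note D = dominated_convergence[where f = ?f and g = ?h and h = "\<lambda>_. L k" and S = "{0..t}",
      OF has_integral_integrable[OF I] integrable_const_ivl le lim]
  have "(\<lambda>n. vs (n + N) t k - vs (n + N) 0 k) \<longlonglongrightarrow> v t k - v 0 k"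
    using t T by (intro tendsto_diff LIMSEQ_ignore_initial_segment lim_v) auto
  then have eq: "integral {0..t} ?h = v t k - v 0 k"
    using D(2) LIMSEQ_unique unfolding integral_unique[OF I] by blast
  show ?thesis using integrable_integral[OF D(1)] unfolding eq .
qed

lemma temperature_equation:
  assumes t: "t \<in> {0..T}" and k: "k \<noteq> 0"
  shows "((\<lambda>s. - advect (LamV (- 2 * \<alpha>) (v s)) (\<theta> s) k) has_integral (\<theta> t k - \<theta> 0 k)) {0..t}"
proof -
  let ?h = "\<lambda>s. - advect (LamV (- 2 * \<alpha>) (v s)) (\<theta> s) k"
  obtain N where N: "\<And>n. N \<le> n \<Longrightarrow> k \<in> K n" using K(3)[OF k] by (auto simp: eventually_sequentially)
  let ?f = "\<lambda>n s. temperature_rhs \<alpha> (K (n + N)) (vs (n + N) s) (ts (n + N) s) k"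
  have I: "(?f n has_integral (ts (n + N) t k - ts (n + N) 0 k)) {0..t}" for n
    using t N[of "n + N"] by (intro fundamental_theorem_of_calculus)
      (auto intro: has_vector_derivative_within_subset[OF galerkinD(6)[OF G]])
  have lim: "(\<lambda>n. ?f n s) \<longlonglongrightarrow> ?h s" if s: "s \<in> {0..t}" for s
  proof -
    have sT: "s \<in> {0..T}" using s t by auto
    have "(\<lambda>n. temperature_rhs \<alpha> (K n) (vs n s) (ts n s) k) \<longlonglongrightarrow> ?h s"
      unfolding temperature_rhs_def by (intro tendsto_minus temperature_convection_limit(2)[OF sT])
    then show ?thesis by (rule LIMSEQ_ignore_initial_segment)
  qed
  have le: "norm (?f n s) \<le> L k" if "s \<in> {0..t}" for n s
    using that t N[of "n + N"] by (intro rhs_le) auto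
  note D = dominated_convergence[where f = ?f and g = ?h and h = "\<lambda>_. L k" and S = "{0..t}",
      OF has_integral_integrable[OF I] integrable_const_ivl le lim]
  have "(\<lambda>n. ts (n + N) t k - ts (n + N) 0 k) \<longlonglongrightarrow> \<theta> t k - \<theta> 0 k"
    using t T by (intro tendsto_diff LIMSEQ_ignore_initial_segment lim_\<theta>) auto
  then have eq: "integral {0..t} ?h = \<theta> t k - \<theta> 0 k"
    using D(2) LIMSEQ_unique unfolding integral_unique[OF I] by blast
  show ?thesis using integrable_integral[OF D(1)] unfolding eq .
qed

lemma is_solution_limit: "is_solution \<nu> \<alpha> \<beta> T v \<theta>"
  unfolding is_solution_def Let_def
  using velocity_convection_limit(1) temperature_convection_limit(1) velocity_equation temperature_equation
  by blast

text \<open>Beyond radius \<open>R\<close> the ramp equals 1, so a bound for the ramped weight is a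
  bound for the Sobolev tail.\<close>

lemma tails:
  assumes \<epsilon>: "0 < \<epsilon>"
  shows "\<exists>R. \<forall>t\<in>{0..T}. \<forall>F. finite F \<longrightarrow> (\<forall>k\<in>F. R \<le> kabs k) \<longrightarrow>
    (\<Sum>k\<in>F. (norm (v t k))\<^sup>2 * kabs k powr (2 * r)) \<le> \<epsilon> \<and> (\<Sum>k\<in>F. (norm (\<theta> t k))\<^sup>2 * kabs k powr (2 * (r - \<beta>))) \<le> \<epsilon>"
proof -
  obtain R where R: "1 \<le> R" and small: "\<And>F. \<lbrakk>finite F; 0 \<notin> F\<rbrakk> \<Longrightarrow> (\<Sum>k\<in>F. e k * (min 1 (kabs k / R))\<^sup>2) \<le> \<epsilon> / C"
    by (rule weighted_tail_small[of e M "\<epsilon> / C"]) (use e \<epsilon> C in auto)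
  have "(\<Sum>k\<in>F. (norm (v t k))\<^sup>2 * kabs k powr (2 * r)) \<le> \<epsilon> \<and> (\<Sum>k\<in>F. (norm (\<theta> t k))\<^sup>2 * kabs k powr (2 * (r - \<beta>))) \<le> \<epsilon>"
    if t: "t \<in> {0..T}" and F: "finite F" "\<forall>k\<in>F. R \<le> kabs k" for t F
  proof
    have w: "(wgt s R k)\<^sup>2 = kabs k powr (2 * s)" if "k \<in> F" for s k
      using F that R by (intro wgt_power2) auto
    show "(\<Sum>k\<in>F. (norm (v t k))\<^sup>2 * kabs k powr (2 * r)) \<le> \<epsilon>"
      using weighted_limit_le(1)[OF F(1) R t small] w C by (simp add: mult.commute)
    show "(\<Sum>k\<in>F. (norm (\<theta> t k))\<^sup>2 * kabs k powr (2 * (r - \<beta>))) \<le> \<epsilon>"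
      using weighted_limit_le(2)[OF F(1) R t small] w C by (simp add: mult.commute)
  qed
  then show ?thesis by blast
qed

lemma contV_limit: "contV T r v"
  unfolding contV_def vnorm2_eq
proof (intro conjI ballI)
  fix t assume t: "t \<in> {0..T}"
  have "sobolev2 r (v t) \<le> ennreal (b\<^sup>2)" by (rule sobolev2_leI) (rule sobolev_limit_le(1)[OF _ _ t])
  then have "sobolev2 r (v t) < \<infinity>" by (rule le_less_trans) simp
  then show "v t \<in> Vs r"
    using solenoidal_limit[OF t] by (auto simp: Vs_def vnorm2_eq solenoidal_def)
  show "((\<lambda>s. sobolev2 r (\<lambda>k. v s k - v t k)) \<longlongrightarrow> 0) (at t within {0..T})"
    by (rule sobolev2_tendsto_zero[OF continuous_modes(1) t]) (use tails in meson)
qed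

lemma contH_limit: "contH T (r - \<beta>) \<theta>"
  unfolding contH_def snorm2_eq
proof (intro conjI ballI)
  fix t assume t: "t \<in> {0..T}"
  have "sobolev2 (r - \<beta>) (\<theta> t) \<le> ennreal (b\<^sup>2)" by (rule sobolev2_leI) (rule sobolev_limit_le(2)[OF _ _ t])
  then have "sobolev2 (r - \<beta>) (\<theta> t) < \<infinity>" by (rule le_less_trans) simp
  then show "\<theta> t \<in> Hs (r - \<beta>)"
    using temperature_real_limit[OF t] by (auto simp: Hs_def snorm2_eq)
  show "((\<lambda>s. sobolev2 (r - \<beta>) (\<lambda>k. \<theta> s k - \<theta> t k)) \<longlongrightarrow> 0) (at t within {0..T})"
    by (rule sobolev2_tendsto_zero[OF continuous_modes(2) t]) (use tails in meson)
qed

text \<open>Two limits in order: at a fixed number of modes the truncation index tends to infinity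
  by dominated convergence, and then the number of modes grows by monotone convergence. The bound
  \<open>C * M\<close> is uniform in both.\<close>

lemma L2V_limit: "L2V T (r + \<beta>) v"
proof -
  let ?g = "\<lambda>m t. \<Sum>k\<in>modes (real m). (norm (v t k))\<^sup>2 * kabs k powr (2 * (r + \<beta>))"
  let ?gn = "\<lambda>m n t. \<Sum>k\<in>modes (real m). (norm (vs n t k))\<^sup>2 * kabs k powr (2 * (r + \<beta>))"
  have cont: "continuous_on {0..T} (?g m)" for m
    by (intro continuous_intros continuous_modes)
  have contn: "continuous_on {0..T} (?gn m n)" for m n
    by (intro continuous_intros galerkin_continuous[OF G])
  have T0: "T \<in> {0..T}" using T by simp
  have int_le: "integral {0..T} (?g m) \<le> C * M" for m
  proof (rule LIMSEQ_le_const2)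
    show "(\<lambda>n. integral {0..T} (?gn m n)) \<longlonglongrightarrow> integral {0..T} (?g m)"
    proof (rule dominated_convergence(2))
      fix n t assume t: "t \<in> {0..T}"
      have "norm (?gn m n t) = ?gn m n t" by (simp add: sum_nonneg)
      also have "\<dots> \<le> (\<Sum>k\<in>modes (real m). b\<^sup>2 * kabs k powr (2 * (r + \<beta>)))"
        using mode_bound(1)[OF t] by (intro sum_mono mult_right_mono power_mono) auto
      finally show "norm (?gn m n t) \<le> (\<Sum>k\<in>modes (real m). b\<^sup>2 * kabs k powr (2 * (r + \<beta>)))" .
    next
      fix t assume t: "t \<in> {0..T}"
      show "(\<lambda>n. ?gn m n t) \<longlonglongrightarrow> ?g m t" by (intro tendsto_intros lim_v t)
    next
      show "?gn m n integrable_on {0..T}" for n by (intro integrable_continuous_real contn)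
      show "(\<lambda>t. \<Sum>k\<in>modes (real m). b\<^sup>2 * kabs k powr (2 * (r + \<beta>))) integrable_on {0..T}"
        by (rule integrable_const_ivl)
    qed
    show "\<exists>N. \<forall>n\<ge>N. integral {0..T} (?gn m n) \<le> C * M"
    proof (intro exI[of _ 0] allI impI)
      fix n
      have "integral {0..T} (?gn m n) \<le> integral {0..T} (\<lambda>s. (nrm (K n) (wgt (r + \<beta>) 1) (vs n s))\<^sup>2)"
      proof (rule integral_le)
        show "?gn m n integrable_on {0..T}" by (intro integrable_continuous_real contn)
        show "(\<lambda>s. (nrm (K n) (wgt (r + \<beta>) 1) (vs n s))\<^sup>2) integrable_on {0..T}"
          by (intro integrable_continuous_real continuous_intros galerkin_continuous_nrm[OF G])
        fix t assume t: "t \<in> {0..T}"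
        have "?gn m n t = (\<Sum>k\<in>modes (real m). (wgt (r + \<beta>) 1 k)\<^sup>2 * (norm (vs n t k))\<^sup>2)"
          by (intro sum.cong refl) (auto simp: wgt_power2 kabs_ge_1 modes_def)
        also have "\<dots> \<le> (\<Sum>k\<in>K n. (wgt (r + \<beta>) 1 k)\<^sup>2 * (norm (vs n t k))\<^sup>2)"
          using K(1) by (intro sum_le_of_support) (auto simp: galerkinD(3)[OF G t])
        finally show "?gn m n t \<le> (nrm (K n) (wgt (r + \<beta>) 1) (vs n t))\<^sup>2" by (simp add: nrm_power2)
      qed
      also have "\<dots> \<le> C * (\<Sum>k\<in>K n. e k * (min 1 (kabs k / 1))\<^sup>2)"
        using bound[OF order_refl T0, of n] zero_le_power2[of "nrm (K n) (wgt r 1) (vs n T)"]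
          zero_le_power2[of "nrm (K n) (wgt (r - \<beta>) 1) (emb (ts n T))"] by linarith
      also have "\<dots> \<le> C * M" using C small_one[OF K(1,2), of n] by (intro mult_left_mono) auto
      finally show "integral {0..T} (?gn m n) \<le> C * M" .
    qed
  qed
  let ?G = "\<lambda>m t. indicator {0..T} t *\<^sub>R ?g m t"
  have meas: "?G m \<in> borel_measurable borel" for m
    by (rule borel_measurable_continuous_on_indicator[OF _ cont]) simp
  have G_nonneg: "0 \<le> ?G m t" for m t by (auto simp: indicator_def intro!: sum_nonneg)
  have nn: "(\<integral>\<^sup>+ t. ennreal (?G m t) \<partial>lborel) \<le> ennreal (C * M)" for m
  proof -
    have "(?g m has_integral integral {0..T} (?g m)) {0..T}"
      by (intro integrable_integral integrable_continuous_real cont)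
    then have "((\<lambda>t. if t \<in> {0..T} then ?g m t else 0) has_integral integral {0..T} (?g m)) UNIV"
      by (simp only: has_integral_restrict_UNIV)
    moreover have "(\<lambda>t. if t \<in> {0..T} then ?g m t else 0) = ?G m" by (auto simp: fun_eq_iff)
    ultimately have "(?G m has_integral integral {0..T} (?g m)) UNIV" by simp
    then have "(\<integral>\<^sup>+ t. ennreal (?G m t) \<partial>lborel) = ennreal (integral {0..T} (?g m))"
      by (rule nn_integral_has_integral_lborel[OF meas G_nonneg])
    then show ?thesis using int_le[of m] by (simp add: ennreal_leI)
  qed
  have "vnorm2 (r + \<beta>) (v t) * indicator {0..T} t = (SUP m. ennreal (?G m t))" for t
    by (cases "t \<in> {0..T}") (simp_all add: vnorm2_eq sobolev2_eq_SUP_modes)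
  then have "(\<integral>\<^sup>+ t. vnorm2 (r + \<beta>) (v t) * indicator {0..T} t \<partial>lborel) = (\<integral>\<^sup>+ t. (SUP m. ennreal (?G m t)) \<partial>lborel)"
    by simp
  also have "\<dots> = (SUP m. \<integral>\<^sup>+ t. ennreal (?G m t) \<partial>lborel)"
  proof (rule nn_integral_monotone_convergence_SUP)
    show "incseq (\<lambda>m t. ennreal (?G m t))"
    proof (intro incseq_SucI le_funI ennreal_leI)
      fix m t
      have "modes (real m) \<subseteq> modes (real (Suc m))" by (auto simp: modes_def)
      then have "?g m t \<le> ?g (Suc m) t" by (intro sum_mono2[OF finite_modes]) auto
      then show "?G m t \<le> ?G (Suc m) t" by (auto simp: indicator_def)
    qed
    show "(\<lambda>t. ennreal (?G m t)) \<in> borel_measurable lborel" for m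
      using meas[of m] by measurable
  qed
  also have "\<dots> \<le> ennreal (C * M)" by (intro SUP_least nn)
  also have "\<dots> < \<infinity>" by simp
  finally show ?thesis unfolding L2V_def .
qed

end

theorem theorem10:
  fixes \<nu> T \<alpha> \<beta> r :: real and v0 :: vfield and \<theta>0 :: sfield
  assumes "\<nu> > 0" and "T > 0" and "\<alpha> \<ge> 0" and "\<beta> \<ge> 0"
    and "1/2 < \<beta>" and "\<beta> < 5/4" and "\<alpha> + \<beta> = 5/4"
    and "r > max (2 * \<beta>) (\<beta> + 1)"
    and "v0 \<in> Vs r" and "\<theta>0 \<in> Hs (r - \<beta>)"
  shows "\<exists>v \<theta>. is_solution \<nu> \<alpha> \<beta> T v \<theta> \<and> v 0 = v0 \<and> \<theta> 0 = \<theta>0 \<and>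
           contV T r v \<and> L2V T (r + \<beta>) v \<and> contH T (r - \<beta>) \<theta>"
proof -
  have r: "2 * \<beta> < r" "\<beta> < r" and \<beta>: "0 < \<beta>" using assms by auto
  have v0: "solenoidal v0" "sobolev2 r v0 < \<infinity>"
    using assms(9) by (auto simp: Vs_def solenoidal_def vnorm2_eq)
  have \<theta>0: "\<theta>0 0 = 0" "\<And>k. \<theta>0 (- k) = cnj (\<theta>0 k)" "sobolev2 (r - \<beta>) \<theta>0 < \<infinity>"
    using assms(10) by (auto simp: Hs_def snorm2_eq)
  obtain M1 where M1: "0 \<le> M1" "\<And>F. \<lbrakk>finite F; 0 \<notin> F\<rbrakk> \<Longrightarrow> (\<Sum>k\<in>F. (norm (v0 k))\<^sup>2 * kabs k powr (2 * r)) \<le> M1"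
    using sobolev2_finiteD[OF v0(2)] by blast
  obtain M2 where M2: "0 \<le> M2" "\<And>F. \<lbrakk>finite F; 0 \<notin> F\<rbrakk> \<Longrightarrow> (\<Sum>k\<in>F. (norm (\<theta>0 k))\<^sup>2 * kabs k powr (2 * (r - \<beta>))) \<le> M2"
    using sobolev2_finiteD[OF \<theta>0(3)] by blast
  define M where "M = M1 + M2"
  have M: "0 \<le> M" using M1 M2 by (simp add: M_def)
  \<comment> \<open>Both data enter one density, so that a single radius makes both tails
    small.\<close>
  define e where "e = (\<lambda>k. (norm (v0 k))\<^sup>2 * kabs k powr (2 * r) + (norm (\<theta>0 k))\<^sup>2 * kabs k powr (2 * (r - \<beta>)))"
  have e_sum: "sum e F \<le> M" if "finite F" "0 \<notin> F" for F
    unfolding e_def M_def sum.distrib using M1(2)[OF that] M2(2)[OF that] by linarith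
  obtain C where C: "0 < C" and apriori: "\<And>K v \<theta> R t. \<lbrakk>finite K; 0 \<notin> K; galerkin \<nu> \<alpha> \<beta> T K v \<theta>;
      (nrm K (wgt r 1) (v 0))\<^sup>2 + (nrm K (wgt (r - \<beta>) 1) (emb (\<theta> 0)))\<^sup>2 \<le> M; 1 \<le> R; t \<in> {0..T}\<rbrakk> \<Longrightarrow>
    (nrm K (wgt r R) (v t))\<^sup>2 + (nrm K (wgt (r - \<beta>) R) (emb (\<theta> t)))\<^sup>2
      + integral {0..t} (\<lambda>s. (nrm K (wgt (r + \<beta>) R) (v s))\<^sup>2)
    \<le> C * ((nrm K (wgt r R) (v 0))\<^sup>2 + (nrm K (wgt (r - \<beta>) R) (emb (\<theta> 0)))\<^sup>2)"
    using galerkin_apriori[OF assms(7,5,6) r(1) assms(1) less_imp_le[OF assms(2)] M] by blast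
  define K where "K = (\<lambda>n::nat. modes (real n))"
  have K: "finite (K n)" "0 \<notin> K n" "- k \<in> K n \<longleftrightarrow> k \<in> K n" for n k by (simp_all add: K_def)
  have K_ev: "\<forall>\<^sub>F n in sequentially. k \<in> K n" if "k \<noteq> 0" for k
  proof -
    obtain N :: nat where "kabs k \<le> real N" using real_arch_simple by blast
    then show ?thesis using that
      by (intro eventually_sequentiallyI[of N]) (auto simp: K_def modes_def)
  qed
  have "\<exists>v \<theta>. galerkin \<nu> \<alpha> \<beta> T (K n) v \<theta> \<and> (\<forall>k. v 0 k = (if k \<in> K n then v0 k else 0)) \<and> (\<forall>k. \<theta> 0 k = (if k \<in> K n then \<theta>0 k else 0))" for n
  proof -
    let ?a = "\<lambda>k. if k \<in> K n then v0 k else 0" and ?b = "\<lambda>k. if k \<in> K n then \<theta>0 k else 0"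
    have a: "solenoidal ?a"
      using solenoidalD[OF v0(1)] by (auto simp: solenoidal_def K(3))
    have b: "?b (- k) = cnj (?b k)" for k
      by (simp add: K(3) \<theta>0(2))
    have ab: "k \<notin> K n \<Longrightarrow> ?a k = 0" "k \<notin> K n \<Longrightarrow> ?b k = 0" for k by simp_all
    obtain v \<theta> where "galerkin \<nu> \<alpha> \<beta> T (K n) v \<theta>" "\<And>k. v 0 k = ?a k" "\<And>k. \<theta> 0 k = ?b k"
      using galerkin_exists[where a = ?a and b = ?b and K = "K n", OF less_imp_le[OF assms(1)]
          less_imp_le[OF assms(2)] K(1,2) K(3) a ab(1) b ab(2)] by blast
    then show ?thesis by blast
  qed
  then obtain vs ts where G: "\<And>n. galerkin \<nu> \<alpha> \<beta> T (K n) (vs n) (ts n)"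
    and init: "\<And>n k. vs n 0 k = (if k \<in> K n then v0 k else 0)" "\<And>n k. ts n 0 k = (if k \<in> K n then \<theta>0 k else 0)"
    by metis
  \<comment> \<open>This rewrites the initial value in the a priori bound as a ramped sum of
    \<open>e\<close>, the form that \<open>weighted_tail_small\<close> makes small.\<close>
  have init_nrm: "(nrm (K n) (wgt r R) (vs n 0))\<^sup>2 + (nrm (K n) (wgt (r - \<beta>) R) (emb (ts n 0)))\<^sup>2
      = (\<Sum>k\<in>K n. e k * (min 1 (kabs k / R))\<^sup>2)" for n R
    unfolding nrm_power2 sum.distrib[symmetric]
    by (intro sum.cong refl) (simp add: init e_def wgt_def power_mult_distrib powr_square algebra_simps)
  interpret S: galerkin_sequence \<nu> \<alpha> \<beta> T r C M K vs ts e
  proof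
    fix n and R t :: real assume R: "1 \<le> R" and t: "t \<in> {0..T}"
    have "(\<Sum>k\<in>K n. e k * (min 1 (kabs k / 1))\<^sup>2) \<le> sum e (K n)"
      by (intro sum_mono) (simp add: e_def mult_left_le power_le_one)
    then have "(nrm (K n) (wgt r 1) (vs n 0))\<^sup>2 + (nrm (K n) (wgt (r - \<beta>) 1) (emb (ts n 0)))\<^sup>2 \<le> M"
      unfolding init_nrm using e_sum[OF K(1,2), of n] by linarith
    from apriori[OF K(1,2) G this R t]
    show "(nrm (K n) (wgt r R) (vs n t))\<^sup>2 + (nrm (K n) (wgt (r - \<beta>) R) (emb (ts n t)))\<^sup>2
      + integral {0..t} (\<lambda>s. (nrm (K n) (wgt (r + \<beta>) R) (vs n s))\<^sup>2)
      \<le> C * (\<Sum>k\<in>K n. e k * (min 1 (kabs k / R))\<^sup>2)"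
      unfolding init_nrm .
  qed (use assms(1-3) \<beta> r C K K_ev G e_sum in \<open>auto simp: e_def\<close>)
  obtain \<sigma> where \<sigma>: "strict_mono (\<sigma> :: nat \<Rightarrow> nat)"
    and conv: "\<And>k t. t \<in> {0..T} \<Longrightarrow> convergent (\<lambda>n. vs (\<sigma> n) t k)" "\<And>k t. t \<in> {0..T} \<Longrightarrow> convergent (\<lambda>n. ts (\<sigma> n) t k)"
    by (rule S.convergent_subsequence) blast
  define v where "v = (\<lambda>t k. lim (\<lambda>n. vs (\<sigma> n) t k))"
  define \<theta> where "\<theta> = (\<lambda>t k. lim (\<lambda>n. ts (\<sigma> n) t k))"
  \<comment> \<open>A subsequence still exhausts the nonzero modes and satisfies the same bounds, so
    it is again an instance.\<close>
  interpret L: galerkin_limit \<nu> \<alpha> \<beta> T r C M "\<lambda>n. K (\<sigma> n)" "\<lambda>n. vs (\<sigma> n)" "\<lambda>n. ts (\<sigma> n)" e v \<theta>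
  proof
    show "\<forall>\<^sub>F n in sequentially. k \<in> K (\<sigma> n)" if "k \<noteq> 0" for k
      by (rule eventually_subseq[OF \<sigma> K_ev[OF that]])
  qed (use S.\<nu> S.T S.\<alpha> S.\<beta> S.C K G S.e S.bound conv in \<open>auto simp: v_def \<theta>_def convergent_LIMSEQ_iff\<close>)
  have T0: "0 \<in> {0..T}" using assms(2) by simp
  \<comment> \<open>A nonzero mode eventually lies in the truncation, where its initial value is the
    untruncated one; the zero mode vanishes on both sides.\<close>
  have "v 0 = v0"
  proof
    fix k
    show "v 0 k = v0 k"
    proof (cases "k = 0")
      case True
      then show ?thesis using solenoidalD(1)[OF L.solenoidal_limit[OF T0]] solenoidalD(1)[OF v0(1)] by simp
    next
      case False
      have "\<forall>\<^sub>F n in sequentially. vs (\<sigma> n) 0 k = v0 k"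
        using L.K(3)[OF False] by eventually_elim (simp add: init)
      then show ?thesis by (rule LIMSEQ_unique[OF L.lim_v[OF T0] tendsto_eventually])
    qed
  qed
  moreover have "\<theta> 0 = \<theta>0"
  proof
    fix k
    show "\<theta> 0 k = \<theta>0 k"
    proof (cases "k = 0")
      case True
      then show ?thesis using L.temperature_real_limit(1)[OF T0] \<theta>0(1) by simp
    next
      case False
      have "\<forall>\<^sub>F n in sequentially. ts (\<sigma> n) 0 k = \<theta>0 k"
        using L.K(3)[OF False] by eventually_elim (simp add: init)
      then show ?thesis by (rule LIMSEQ_unique[OF L.lim_\<theta>[OF T0] tendsto_eventually])
    qed
  qed
  ultimately show ?thesis
    using L.is_solution_limit L.contV_limit L.L2V_limit L.contH_limit by blast
qed

end
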